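(* Let $m\in\mathbb Z^+$ and $\mathcal D_{2m}=\{(z,w)\in\mathbb C^2:|z|^2+|w|^{2m}<1\}$, and let $SK_{\mathcal D_{2m}}(z,w)=S_{\mathcal D_{2m}}(z,w)^3/K_{\mathcal D_{2m}}(z,w)^2$ for $(z,w)\in\mathcal D_{2m}$, where $S_{\mathcal D_{2m}}(z,w)$ and $K_{\mathcal D_{2m}}(z,w)$ are the diagonal values at $(z,w)$ of the Fefferman--Szegő kernel and of the Bergman kernel of $\mathcal D_{2m}$. (i) If $\xi=(0,e^{i\theta})\in\partial\mathcal D_{2m}$ with $\theta\in(-\pi,\pi]$, then $$\lim_{(z,w)\to\xi}SK_{\mathcal D_{2m}}(z,w)=\frac1{32\pi^2}.$$ (ii) If $\xi=(e^{i\theta},0)\in\partial\mathcal D_{2m}$ with $\theta\in(-\pi,\pi]$, then $$\lim_{\substack{(z,w)\to\xi\\ |w|^{2m}=o(1-|z|^2-|w|^{2m})}}SK_{\mathcal D_{2m}}(z,w)=\frac1{6^3\pi^2}\,\frac{(m+2)^3}{(m+1)^2}.$$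
   Context: All limits are over points $(z,w)\in\mathcal D_{2m}$; in (ii) the approach is restricted so that $|w|^{2m}/(1-|z|^2-|w|^{2m})\to0$. Put $\rho(z,w)=|z|^2+|w|^{2m}-1$ and let $\sigma_{\mathrm E}$ be the Euclidean surface measure on $\partial\mathcal D_{2m}$. The Fefferman surface area measure is $d\sigma_{\mathrm F}=\varpi_{\mathrm F}\,d\sigma_{\mathrm E}$ with $$\varpi_{\mathrm F}=\frac1{|d\rho|}\left|\det\begin{pmatrix}\rho&\partial_{\bar j}\rho\\ \partial_i\rho&\partial_i\partial_{\bar j}\rho\end{pmatrix}_{1\le i,j\le 2}\right|^{\frac13},\qquad |d\rho|=\big(|\partial_z\rho|^2+|\partial_w\rho|^2\big)^{1/2},$$ i.e. $\varpi_{\mathrm F}(z,w)=\dfrac{(m^2|w|^{2m-2})^{1/3}}{\sqrt{|z|^2+m^2|w|^{4m-2}}}$ on $\partial\mathcal D_{2m}$. For $\xi\in\partial\mathcal D_{2m}$ let $\nu_\xi$ be the outward unit normal and let $\delta_\xi(z)$ be the minimum of the Euclidean distances from $z$ to $\partial\mathcal D_{2m}$ and to the tangent plane of $\partial\mathcal D_{2m}$ at $\xi$. For $\alpha>0$ let $\Gamma_\alpha(\xi)=\{z\in\mathcal D_{2m}:|(\xi-z)\cdot\overline{\nu_\xi}|<(1+\alpha)\delta_\xi(z),\ |\xi-z|^2<\alpha\delta_\xi(z)\}$, where $\cdot$ is the complex bilinear dot product, and let $\mathcal N(f)(\xi)=\sup_{z\in\Gamma_\alpha(\xi)}|f(z)|$.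 The Fefferman--Hardy space $\mathrm H^2_{\mathrm F}(\partial\mathcal D_{2m})$ is the set of holomorphic $f$ on $\mathcal D_{2m}$ with $\mathcal N(f)\in L^2(\partial\mathcal D_{2m},\sigma_{\mathrm F})$. Each such $f$ has a non-tangential boundary value $f^*$ $\sigma_{\mathrm F}$-a.e., and with the norm $\big(\int|f^*|^2d\sigma_{\mathrm F}\big)^{1/2}$ the space is a reproducing kernel Hilbert space. Its reproducing kernel $S_{\mathcal D_{2m}}(\zeta,\eta)$, satisfying $f(\zeta)=\int_{\partial\mathcal D_{2m}}S_{\mathcal D_{2m}}(\zeta,\xi)f^*(\xi)\,d\sigma_{\mathrm F}(\xi)$, is the Fefferman--Szegő kernel. The Bergman kernel is with respect to Lebesgue measure on $\mathbb C^2$; its diagonal values are $$K_{\mathcal D_{2m}}(z,w)=\frac{(m+1)(1-|z|^2)^{\frac1m}-(m-1)|w|^2}{m\pi^2\big((1-|z|^2)^{\frac1m}-|w|^2\big)^3(1-|z|^2)^{\frac{2m-1}m}}.$$ *)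

theory Defs
  imports "HOL-Analysis.Analysis" "HOL-Library.Landau_Symbols"
begin

text \<open>
  Points of $\mathbf{C}^2$ are pairs of type \<^typ>\<open>complex \<times> complex\<close>. The norm and the distance
  of this type are the Euclidean ones, its inner product is the real one (the real part of the
  Hermitian product), and \<^const>\<open>lborel\<close> is Lebesgue measure on $\mathbf{C}^2$.
\<close>

type_synonym C2 = "complex \<times> complex"

definition domain_rho :: "nat \<Rightarrow> C2 \<Rightarrow> real" where
  "domain_rho m = (\<lambda>(z, w). norm z ^ 2 + norm w ^ (2 * m) - 1)"

definition egg_domain :: "nat \<Rightarrow> C2 set" where
  "egg_domain m = {(z, w). norm z ^ 2 + norm w ^ (2 * m) < 1}"


subsection \<open>Complex analysis in two variables\<close>

text \<open>For an open set \<open>U\<close>: a complex linear total derivative exists at every point.\<close>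

definition holomorphic2_on :: "(C2 \<Rightarrow> complex) \<Rightarrow> C2 set \<Rightarrow> bool" where
  "holomorphic2_on f U \<longleftrightarrow>
     (\<forall>p\<in>U. \<exists>a b. (f has_derivative (\<lambda>(h, k). a * h + b * k)) (at p))"

text \<open>
  Wirtinger derivatives $\frac12(\partial_x - i\partial_y)$ and $\frac12(\partial_x + i\partial_y)$
  in the complex coordinate with unit vector \<open>e\<close>, which is \<open>(1, 0)\<close> for \<open>z\<close> and \<open>(0, 1)\<close>
  for \<open>w\<close>; the real directions x and y are \<open>e\<close> and \<open>\<i> e\<close>.
\<close>

definition wirtinger :: "C2 \<Rightarrow> (C2 \<Rightarrow> complex) \<Rightarrow> C2 \<Rightarrow> complex" where
  "wirtinger e u p =
     (frechet_derivative u (at p) e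
        - \<i> * frechet_derivative u (at p) (\<i> * fst e, \<i> * snd e)) / 2"

definition wirtinger_bar :: "C2 \<Rightarrow> (C2 \<Rightarrow> complex) \<Rightarrow> C2 \<Rightarrow> complex" where
  "wirtinger_bar e u p =
     (frechet_derivative u (at p) e
        + \<i> * frechet_derivative u (at p) (\<i> * fst e, \<i> * snd e)) / 2"

abbreviation d_z :: "(C2 \<Rightarrow> complex) \<Rightarrow> C2 \<Rightarrow> complex" where "d_z \<equiv> wirtinger (1, 0)"
abbreviation d_w :: "(C2 \<Rightarrow> complex) \<Rightarrow> C2 \<Rightarrow> complex" where "d_w \<equiv> wirtinger (0, 1)"
abbreviation d_zbar :: "(C2 \<Rightarrow> complex) \<Rightarrow> C2 \<Rightarrow> complex" where "d_zbar \<equiv> wirtinger_bar (1, 0)"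
abbreviation d_wbar :: "(C2 \<Rightarrow> complex) \<Rightarrow> C2 \<Rightarrow> complex" where "d_wbar \<equiv> wirtinger_bar (0, 1)"


subsection \<open>Bergman kernel\<close>

definition bergman_space :: "C2 set \<Rightarrow> (C2 \<Rightarrow> complex) set" where
  "bergman_space U =
     {f. holomorphic2_on f U \<and> (\<integral>\<^sup>+p\<in>U. ennreal (norm (f p) ^ 2) \<partial>lborel) < \<infinity>}"

definition is_bergman_kernel :: "C2 set \<Rightarrow> (C2 \<Rightarrow> C2 \<Rightarrow> complex) \<Rightarrow> bool" where
  "is_bergman_kernel U K \<longleftrightarrow>
     (\<forall>\<zeta>\<in>U. (\<lambda>\<eta>. cnj (K \<zeta> \<eta>)) \<in> bergman_space U \<and>
        (\<forall>f\<in>bergman_space U. f \<zeta> = (LINT \<eta>:U|lborel. K \<zeta> \<eta> * f \<eta>)))"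

text \<open>
  The reproducing property determines the kernel on \<open>U \<times> U\<close>; the choice operator only fixes the
  irrelevant values outside.
\<close>

definition bergman_kernel :: "C2 set \<Rightarrow> C2 \<Rightarrow> C2 \<Rightarrow> complex" where
  "bergman_kernel U = (SOME K. is_bergman_kernel U K)"


subsection \<open>Euclidean and Fefferman surface measure\<close>

text \<open>
  The map \<open>egg_param m\<close> is injective and smooth on \<open>egg_param_dom\<close> and covers the boundary of the
  domain except for the circle \<open>z = 0\<close>, which has surface measure zero. The surface measure is the
  push-forward of the area element, i.e. of the square root of the Gram determinant of the
  coordinate tangent vectors. It is a measure on the Borel sets of the boundary.
\<close>

definition egg_param :: "nat \<Rightarrow> real \<times> complex \<Rightarrow> C2" where
  "egg_param m = (\<lambda>(\<phi>, w). (of_real (sqrt (1 - norm w ^ (2 * m))) * cis \<phi>, w))"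

definition egg_param_dom :: "(real \<times> complex) set" where
  "egg_param_dom = {-pi<..pi} \<times> ball 0 1"

definition area_element :: "(real \<times> complex \<Rightarrow> C2) \<Rightarrow> real \<times> complex \<Rightarrow> real" where
  "area_element \<Phi> u =
     (let b = vector [(1, 0), (0, 1), (0, \<i>)] :: (real \<times> complex) ^ 3;
          T = frechet_derivative \<Phi> (at u)
      in sqrt (det (\<chi> i j. T (b $ i) \<bullet> T (b $ j))))"

definition surface_measure :: "nat \<Rightarrow> C2 measure" where
  "surface_measure m =
     distr (density (restrict_space lborel egg_param_dom)
              (\<lambda>u. ennreal (area_element (egg_param m) u)))
           (restrict_space borel (frontier (egg_domain m)))
           (egg_param m)"

definition rho_gradient_norm :: "nat \<Rightarrow> C2 \<Rightarrow> real" where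
  "rho_gradient_norm m p =
     (let \<rho> = (\<lambda>q. complex_of_real (domain_rho m q))
      in sqrt (norm (d_z \<rho> p) ^ 2 + norm (d_w \<rho> p) ^ 2))"

definition fefferman_weight :: "nat \<Rightarrow> C2 \<Rightarrow> real" where
  "fefferman_weight m p =
     (let \<rho> = (\<lambda>q. complex_of_real (domain_rho m q));
          M = vector
            [vector [\<rho> p,     d_zbar \<rho> p,         d_wbar \<rho> p],
             vector [d_z \<rho> p, d_z (d_zbar \<rho>) p,   d_z (d_wbar \<rho>) p],
             vector [d_w \<rho> p, d_w (d_zbar \<rho>) p,   d_w (d_wbar \<rho>) p]] :: complex ^ 3 ^ 3
      in root 3 (norm (det M)) / rho_gradient_norm m p)"

definition fefferman_measure :: "nat \<Rightarrow> C2 measure" where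
  "fefferman_measure m = density (surface_measure m) (\<lambda>p. ennreal (fefferman_weight m p))"


subsection \<open>Approach regions and the Fefferman--Hardy space\<close>

text \<open>
  In complex notation the real gradient of \<open>\<rho>\<close> is twice the vector of the derivatives
  \<open>d_zbar \<rho>\<close> and \<open>d_wbar \<rho>\<close>; it points outward because \<open>\<rho> < 0\<close> inside the domain.
\<close>

definition unit_normal :: "nat \<Rightarrow> C2 \<Rightarrow> C2" where
  "unit_normal m \<xi> =
     (let \<rho> = (\<lambda>q. complex_of_real (domain_rho m q))
      in (1 / rho_gradient_norm m \<xi>) *\<^sub>R (d_zbar \<rho> \<xi>, d_wbar \<rho> \<xi>))"

definition tangent_plane :: "nat \<Rightarrow> C2 \<Rightarrow> C2 set" where
  "tangent_plane m \<xi> = {p. (p - \<xi>) \<bullet> unit_normal m \<xi> = 0}"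

definition approach_dist :: "nat \<Rightarrow> C2 \<Rightarrow> C2 \<Rightarrow> real" where
  "approach_dist m \<xi> p =
     min (infdist p (frontier (egg_domain m))) (infdist p (tangent_plane m \<xi>))"

definition bilinear_dot :: "C2 \<Rightarrow> C2 \<Rightarrow> complex" where
  "bilinear_dot p q = fst p * fst q + snd p * snd q"

definition approach_region :: "nat \<Rightarrow> real \<Rightarrow> C2 \<Rightarrow> C2 set" where
  "approach_region m \<alpha> \<xi> =
     {p \<in> egg_domain m.
        norm (bilinear_dot (\<xi> - p) (map_prod cnj cnj (unit_normal m \<xi>)))
          < (1 + \<alpha>) * approach_dist m \<xi> p \<and>
        norm (\<xi> - p) ^ 2 < \<alpha> * approach_dist m \<xi> p}"

definition nt_maximal :: "nat \<Rightarrow> real \<Rightarrow> (C2 \<Rightarrow> complex) \<Rightarrow> C2 \<Rightarrow> ennreal" where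
  "nt_maximal m \<alpha> f \<xi> = (SUP p\<in>approach_region m \<alpha> \<xi>. ennreal (norm (f p)))"

definition fefferman_hardy :: "nat \<Rightarrow> real \<Rightarrow> (C2 \<Rightarrow> complex) set" where
  "fefferman_hardy m \<alpha> =
     {f. holomorphic2_on f (egg_domain m) \<and>
         nt_maximal m \<alpha> f \<in> borel_measurable (fefferman_measure m) \<and>
         (\<integral>\<^sup>+\<xi>. nt_maximal m \<alpha> f \<xi> ^ 2 \<partial>fefferman_measure m) < \<infinity>}"

text \<open>\<open>nt_boundary_value m \<alpha> f g\<close>: \<open>g\<close> is a (Borel) version of the boundary function $f^*$.\<close>

definition nt_boundary_value ::
    "nat \<Rightarrow> real \<Rightarrow> (C2 \<Rightarrow> complex) \<Rightarrow> (C2 \<Rightarrow> complex) \<Rightarrow> bool" where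
  "nt_boundary_value m \<alpha> f g \<longleftrightarrow>
     g \<in> borel_measurable (fefferman_measure m) \<and>
     (AE \<xi> in fefferman_measure m. (f \<longlongrightarrow> g \<xi>) (at \<xi> within approach_region m \<alpha> \<xi>))"

text \<open>
  The kernel is conjugate-holomorphic in its second variable, and in the reproducing formula its
  values there are those of the boundary function \<open>s\<close>. Every element of \<open>fefferman_hardy m \<alpha>\<close>
  has a boundary function, unique almost everywhere, so the inner quantification over \<open>g\<close> just
  names $f^*$.
\<close>

definition is_fefferman_szego_kernel ::
    "nat \<Rightarrow> real \<Rightarrow> (C2 \<Rightarrow> C2 \<Rightarrow> complex) \<Rightarrow> bool" where
  "is_fefferman_szego_kernel m \<alpha> S \<longleftrightarrow>
     (\<forall>\<zeta>\<in>egg_domain m.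
        (\<lambda>\<eta>. cnj (S \<zeta> \<eta>)) \<in> fefferman_hardy m \<alpha> \<and>
        (\<exists>s. nt_boundary_value m \<alpha> (S \<zeta>) s \<and>
           (\<forall>f\<in>fefferman_hardy m \<alpha>. \<forall>g. nt_boundary_value m \<alpha> f g \<longrightarrow>
              f \<zeta> = (LINT \<xi>|fefferman_measure m. s \<xi> * g \<xi>))))"

text \<open>As for the Bergman kernel, the values on the domain are determined.\<close>

definition fefferman_szego_kernel :: "nat \<Rightarrow> real \<Rightarrow> C2 \<Rightarrow> C2 \<Rightarrow> complex" where
  "fefferman_szego_kernel m \<alpha> = (SOME S. is_fefferman_szego_kernel m \<alpha> S)"

definition SK :: "nat \<Rightarrow> real \<Rightarrow> C2 \<Rightarrow> complex" where
  "SK m \<alpha> p =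
     fefferman_szego_kernel m \<alpha> p p ^ 3 / bergman_kernel (egg_domain m) p p ^ 2"

end

theory Submission
  imports Defs "HOL-Complex_Analysis.Complex_Analysis"
begin

text \<open>
  Both kernels are computed from the orthogonal monomials \<open>z^j w^k\<close>. Their squared norms turn out to be
  proportional to $j!/(\beta_k\,(\gamma+k/m)_j)$, so the binomial series in \<open>j\<close> gives kernels of the form
  $(1-z\bar z')^{-\gamma} q(u)$ with $u = w\bar w'(1-z\bar z')^{-1/m}$ and a power series \<open>q\<close>. Here
  \<open>\<gamma> = 2 + 1/m\<close> for Bergman and \<open>\<gamma> = 1 + (m+2)/(3m)\<close> for Fefferman--Szego, so on the diagonal the powers
  of $1-|z|^2$ cancel in \<open>S^3/K^2\<close>. What remains is the function
  $(c+(1-c)u)^3 / (8\pi^2((m+1)-(m-1)u)^2)$ with \<open>c = (m+2)/3\<close> and $u = |w|^2(1-|z|^2)^{-1/m}$; the two limits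
  are its values at \<open>u = 1\<close> and \<open>u = 0\<close>.

  The reproducing property is tested on monomials, because a holomorphic function on a complete Reinhardt
  domain is the sum of its power series and its torus means select the coefficients. A Hardy function is
  reached from inside by the dilations \<open>f(r \<xi>)\<close>, since \<open>r \<xi>\<close> lies in the approach region at \<open>\<xi>\<close> for all \<open>r\<close>
  close to 1, uniformly in \<open>\<xi>\<close>; the maximal function is then the dominating function.
\<close>

section \<open>Averages over rotations\<close>

text \<open>Both kernels are fixed by choice operators, so the task is to exhibit one function with
  the reproducing property and to see that any two such functions agree on the diagonal. The
  parameters come from the variable t = |w|^2, in which Lebesgue measure on the plane becomes pi dt.
  Squared norms of z^j w^k become Beta integrals of t^(p-1) (1 - t^m)^n, with p = k + 1 for the
  volume and p = k + (m+2)/3 for the boundary: there the area element equals |d rho| and cancels the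
  denominator of the Fefferman weight, while the remaining cube root contributes t^((m-1)/3). Such
  an integral has the Pochhammer parameter p/m, the origin of both exponents \<gamma>; three times
  the boundary one is 4 + 2/m, twice the volume one. Moments of f against monomials are found by
  averaging over rotations of both coordinates, because the power series of f comes with no bound up
  to the boundary. The kernel series, by contrast, is bounded uniformly in its second variable and
  can be integrated term by term.\<close>

text \<open>A translation-invariant measure is determined by its value on the unit ball, by a Fubini argument.\<close>

lemma lborel_distr_isometry:
  fixes f :: "'a::euclidean_space \<Rightarrow> 'a"
  assumes lin: "linear f" and iso: "\<And>x. norm (f x) = norm x"
  shows "distr lborel borel f = lborel"
proof -
  define N where "N = distr lborel borel f"
  have fm[measurable]: "f \<in> borel_measurable borel"
    using lin by (simp add: borel_measurable_continuous_onI linear_continuous_on linear_linear)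
  have sN[simp, measurable_cong]: "sets N = sets borel" and spN[simp]: "space N = UNIV"
    by (simp_all add: N_def)
  have "inj f"
    using iso lin by (metis linear_injective_0 norm_eq_zero)
  then have "surj f"
    using lin linear_injective_imp_surjective by blast
  \<comment> \<open>A shift by c after \<open>f\<close> is \<open>f\<close> after the shift by a
    preimage d of c, so N inherits translation invariance.\<close>
  have trN: "distr N borel ((+) c) = N" for c
  proof -
    obtain d where d: "f d = c"
      using \<open>surj f\<close> by (metis surjD)
    have "distr N borel ((+) c) = distr lborel borel ((+) c \<circ> f)"
      unfolding N_def by (intro distr_distr) auto
    also have "(+) c \<circ> f = f \<circ> (+) d"
      using d lin by (auto simp: fun_eq_iff linear_add)
    also have "distr lborel borel (f \<circ> (+) d) = distr (distr lborel borel ((+) d)) borel f"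
      by (intro distr_distr[symmetric]) auto
    also have "\<dots> = N"
      by (simp add: lborel_distr_plus N_def)
    finally show ?thesis .
  qed
  have tr: "(\<integral>\<^sup>+x. h (c + x) \<partial>N) = (\<integral>\<^sup>+x. h x \<partial>N)" if [measurable]: "h \<in> borel_measurable borel"
    for h :: "'a \<Rightarrow> ennreal" and c
    by (subst (2) trN[of c, symmetric]) (simp add: nn_integral_distr)
  have trL: "(\<integral>\<^sup>+x. h (c + x) \<partial>lborel) = (\<integral>\<^sup>+x. h x \<partial>lborel)" if [measurable]: "h \<in> borel_measurable borel"
    for h :: "'a \<Rightarrow> ennreal" and c
    by (subst (2) lborel_distr_plus[of c, symmetric]) (simp add: nn_integral_distr)
  have ballN: "emeasure N (ball 0 r) = emeasure lborel (ball 0 r :: 'a set)" for r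
  proof -
    have "f -` ball 0 r = ball 0 r"
      using iso by auto
    then show ?thesis
      by (simp add: N_def emeasure_distr)
  qed
  have "sigma_finite_measure N"
  proof
    show "\<exists>A. countable A \<and> A \<subseteq> sets N \<and> \<Union>A = space N \<and> (\<forall>a\<in>A. emeasure N a \<noteq> \<infinity>)"
      using ballN emeasure_lborel_ball_finite[of "0::'a"]
      by (intro exI[of _ "range (\<lambda>n::nat. ball 0 (real n))"]) (auto simp: reals_Archimedean2 less_top)
  qed
  then interpret P: pair_sigma_finite lborel N
    by (intro pair_sigma_finite.intro) (auto simp: sigma_finite_lborel)
  define B where "B = (ball 0 1 :: 'a set)"
  define v where "v = emeasure lborel B"
  have [measurable]: "B \<in> sets borel"
    by (simp add: B_def)
  \<comment> \<open>The factor \<open>v\<close> is cancelled at the end, so it has to be nonzero and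
    finite.\<close>
  have "unit_ball_vol (real DIM('a)) \<noteq> 0"
    by (metis less_irrefl of_nat_0_le_iff unit_ball_vol_pos)
  then have v: "v \<noteq> 0" "v \<noteq> \<infinity>"
    using emeasure_lborel_ball_finite[of "0::'a" 1] by (auto simp: v_def B_def emeasure_ball)
  have "emeasure N A = emeasure lborel A" if [measurable]: "A \<in> sets borel" for A
  proof -
    \<comment> \<open>The product integral of the indicators of A and B is shifted twice, x by y
      under N and then y by -x under Lebesgue measure; what remains is the integral over A of the
      N-measure of a reflected and translated ball, which is \<open>v\<close>.\<close>
    have "emeasure N A * v = (\<integral>\<^sup>+y. (\<integral>\<^sup>+x. indicator A x * indicator B y \<partial>N) \<partial>lborel)"
      by (simp add: nn_integral_multc nn_integral_cmult v_def)
    also have "\<dots> = (\<integral>\<^sup>+y. (\<integral>\<^sup>+x. indicator A (y + x) * indicator B y \<partial>N) \<partial>lborel)"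
    proof (rule nn_integral_cong)
      fix y
      show "(\<integral>\<^sup>+x. indicator A x * indicator B y \<partial>N) = (\<integral>\<^sup>+x. indicator A (y + x) * indicator B y \<partial>N)"
        using tr[of "\<lambda>x. indicator A x * indicator B y" y] by simp
    qed
    also have "\<dots> = (\<integral>\<^sup>+x. (\<integral>\<^sup>+y. indicator A (y + x) * indicator B y \<partial>lborel) \<partial>N)"
      by (intro P.Fubini'[symmetric]) auto
    also have "\<dots> = (\<integral>\<^sup>+x. (\<integral>\<^sup>+y. indicator A y * indicator B (y - x) \<partial>lborel) \<partial>N)"
    proof (rule nn_integral_cong)
      fix x
      show "(\<integral>\<^sup>+y. indicator A (y + x) * indicator B y \<partial>lborel)
          = (\<integral>\<^sup>+y. indicator A y * indicator B (y - x) \<partial>lborel)"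
        using trL[of "\<lambda>y. indicator A y * indicator B (y - x)" x] by (simp add: add.commute)
    qed
    also have "\<dots> = (\<integral>\<^sup>+y. (\<integral>\<^sup>+x. indicator A y * indicator B (y - x) \<partial>N) \<partial>lborel)"
      by (intro P.Fubini') auto
    also have "\<dots> = (\<integral>\<^sup>+y. indicator A y * v \<partial>lborel)"
    proof (rule nn_integral_cong)
      fix y
      have "(\<integral>\<^sup>+x. indicator B (y - x) \<partial>N) = (\<integral>\<^sup>+x. indicator B (- y + x) \<partial>N)"
        by (intro nn_integral_cong) (auto simp: B_def indicator_def norm_minus_commute)
      also have "\<dots> = (\<integral>\<^sup>+x. indicator B x \<partial>N)"
        by (rule tr) auto
      also have "\<dots> = v"
        using ballN[of 1] by (simp add: v_def B_def)
      finally show "(\<integral>\<^sup>+x. indicator A y * indicator B (y - x) \<partial>N) = indicator A y * v"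
        by (simp add: nn_integral_cmult)
    qed
    also have "\<dots> = emeasure lborel A * v"
      by (simp add: nn_integral_multc)
    finally show ?thesis
      using v by (metis infinity_ennreal_def mult_divide_eq_ennreal)
  qed
  then have "N = lborel"
    by (intro measure_eqI) auto
  then show ?thesis
    by (simp add: N_def)
qed

text \<open>Each \<open>T c\<close> preserves M, so the integral of F composed with
  \<open>T c\<close> does not depend on c; averaging over the probability measure C and exchanging
  the integrals puts the average inside. Later C is the circle or the torus of rotations.\<close>

lemma integral_average:
  fixes F :: "'a \<Rightarrow> 'b::{banach, second_countable_topology}"
  assumes M: "sigma_finite_measure M" and C: "finite_measure C" and C1: "measure C (space C) = 1"
    and T[measurable]: "case_prod T \<in> measurable (C \<Otimes>\<^sub>M M) M"
    and inv: "\<And>c. c \<in> space C \<Longrightarrow> distr M M (T c) = M"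
    and F: "integrable M F"
  shows "(\<integral>x. F x \<partial>M) = (\<integral>x. (\<integral>c. F (T c x) \<partial>C) \<partial>M)"
proof -
  interpret C: finite_measure C by fact
  interpret pair_sigma_finite C M
    by (intro pair_sigma_finite.intro M C.sigma_finite_measure_axioms)
  have [measurable]: "F \<in> borel_measurable M"
    using F by simp
  have Tc[measurable]: "T c \<in> measurable M M" if "c \<in> space C" for c
    using measurable_compose[OF measurable_Pair1'[OF that, of M] T] by simp
  have int: "integrable M (\<lambda>x. F (T c x))" if "c \<in> space C" for c
    using F that by (subst integrable_distr_eq[symmetric, where N = M]) (auto simp: inv)
  have eq: "(\<integral>x. F (T c x) \<partial>M) = (\<integral>x. F x \<partial>M)"
    and eq_norm: "(\<integral>x. norm (F (T c x)) \<partial>M) = (\<integral>x. norm (F x) \<partial>M)" if "c \<in> space C" for c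
    using that inv[OF that]
      integral_distr[of "T c" M M F] integral_distr[of "T c" M M "\<lambda>x. norm (F x)"]
    by auto
  have "integrable (C \<Otimes>\<^sub>M M) (\<lambda>(c, x). F (T c x))"
  proof (rule Fubini_integrable)
    show "integrable C (\<lambda>c. \<integral>x. norm (case (c, x) of (c, x) \<Rightarrow> F (T c x)) \<partial>M)"
      by (subst Bochner_Integration.integrable_cong[OF refl, where g = "\<lambda>c. \<integral>x. norm (F x) \<partial>M"])
        (auto simp: eq_norm)
  qed (auto intro!: AE_I2 int)
  then have "(\<integral>x. (\<integral>c. F (T c x) \<partial>C) \<partial>M) = (\<integral>c. (\<integral>x. F (T c x) \<partial>M) \<partial>C)"
    by (rule Fubini_integral)
  also have "\<dots> = (\<integral>c. (\<integral>x. F x \<partial>M) \<partial>C)"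
    by (intro Bochner_Integration.integral_cong refl eq) auto
  also have "\<dots> = (\<integral>x. F x \<partial>M)"
    using C1 by simp
  finally show ?thesis ..
qed

text \<open>Domination is asked of the finite sums of norms, the form in which the kernel estimates
  come; \<open>h\<close> enumerates the indices, which reduces the claim to integrating an ordinary
  series of functions.\<close>

lemma has_sum_integral_dominated:
  fixes f :: "'i \<Rightarrow> 'a \<Rightarrow> 'b::{banach, second_countable_topology}"
  assumes h: "bij (h :: nat \<Rightarrow> 'i)"
    and f[measurable]: "\<And>i. f i \<in> borel_measurable M"
    and w: "integrable M w"
    and bound: "\<And>x F. x \<in> space M \<Longrightarrow> finite F \<Longrightarrow> (\<Sum>i\<in>F. norm (f i x)) \<le> w x"
    and sum: "\<And>x. x \<in> space M \<Longrightarrow> ((\<lambda>i. f i x) has_sum s x) UNIV"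
  shows "((\<lambda>i. \<integral>x. f i x \<partial>M) has_sum (\<integral>x. s x \<partial>M)) UNIV"
proof -
  have int: "integrable M (f i)" for i
  proof (rule Bochner_Integration.integrable_bound[OF w])
    show "AE x in M. norm (f i x) \<le> norm (w x)"
      using bound[of _ "{i}"] by (intro AE_I2) fastforce
  qed simp
  have part: "(\<Sum>n<N. norm (f (h n) x)) \<le> w x" if "x \<in> space M" for N x
    using bound[OF that, of "h ` {..<N}"] h sum.reindex[of h "{..<N}" "\<lambda>i. norm (f i x)"]
    by (auto simp: bij_def inj_on_def)
  have summ: "summable (\<lambda>n. norm (f (h n) x))" if "x \<in> space M" for x
    using part[OF that] by (intro summableI_nonneg_bounded) auto
  have summI: "summable (\<lambda>n. \<integral>x. norm (f (h n) x) \<partial>M)"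
  proof (rule summableI_nonneg_bounded)
    fix N
    have "(\<Sum>n<N. \<integral>x. norm (f (h n) x) \<partial>M) = (\<integral>x. (\<Sum>n<N. norm (f (h n) x)) \<partial>M)"
      using int by (intro Bochner_Integration.integral_sum[symmetric]) auto
    also have "\<dots> \<le> (\<integral>x. w x \<partial>M)"
      using int w part by (intro integral_mono) auto
    finally show "(\<Sum>n<N. \<integral>x. norm (f (h n) x) \<partial>M) \<le> (\<integral>x. w x \<partial>M)" .
  qed simp
  have "(\<lambda>n. \<integral>x. f (h n) x \<partial>M) sums (\<integral>x. (\<Sum>n. f (h n) x) \<partial>M)"
    using summ summI int by (intro sums_integral) auto
  also have "(\<integral>x. (\<Sum>n. f (h n) x) \<partial>M) = (\<integral>x. s x \<partial>M)"
  proof (rule Bochner_Integration.integral_cong)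
    fix x assume "x \<in> space M"
    then have "((\<lambda>n. f (h n) x) has_sum s x) UNIV"
      using sum[of x] has_sum_reindex_bij_betw[of h UNIV UNIV "\<lambda>i. f i x" "s x"] h by simp
    then show "(\<Sum>n. f (h n) x) = s x"
      by (metis has_sum_imp_sums sums_unique)
  qed simp
  finally have "((\<lambda>n. \<integral>x. f (h n) x \<partial>M) has_sum (\<integral>x. s x \<partial>M)) UNIV"
    using int by (intro norm_summable_imp_has_sum summable_comparison_test[OF _ summI]) auto
  then show ?thesis
    using has_sum_reindex_bij_betw[of h UNIV UNIV "\<lambda>i. \<integral>x. f i x \<partial>M"] h by simp
qed

section \<open>Normalised angle measure and radial integrals in the plane\<close>

definition angle_measure :: "real measure" where
  "angle_measure = density lborel (\<lambda>t. ennreal (indicator {-pi..pi} t / (2 * pi)))"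

lemma sets_angle_measure[simp, measurable_cong]: "sets angle_measure = sets borel"
  and space_angle_measure[simp]: "space angle_measure = UNIV"
  by (simp_all add: angle_measure_def)

lemma integral_angle_measure:
  fixes f :: "real \<Rightarrow> 'a::{banach, second_countable_topology}"
  assumes [measurable]: "f \<in> borel_measurable borel"
  shows "(\<integral>t. f t \<partial>angle_measure) = (1 / (2 * pi)) *\<^sub>R (LINT t:{-pi..pi}|lborel. f t)"
proof -
  have "(\<integral>t. f t \<partial>angle_measure) = (\<integral>t. (indicator {-pi..pi} t / (2 * pi)) *\<^sub>R f t \<partial>lborel)"
    unfolding angle_measure_def by (intro integral_density) auto
  also have "\<dots> = (\<integral>t. (1 / (2 * pi)) *\<^sub>R (indicator {-pi..pi} t *\<^sub>R f t) \<partial>lborel)"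
    by simp
  finally show ?thesis
    unfolding set_lebesgue_integral_def by (metis integral_scaleR_right)
qed

lemma emeasure_angle_measure: "emeasure angle_measure UNIV = 1"
proof -
  have "emeasure angle_measure UNIV = (\<integral>\<^sup>+t. ennreal (1 / (2 * pi)) * indicator {-pi..pi} t \<partial>lborel)"
    unfolding angle_measure_def by (subst emeasure_density) (auto intro!: nn_integral_cong simp: indicator_def)
  also have "\<dots> = 1"
    by (simp add: nn_integral_cmult ennreal_mult[symmetric])
  finally show ?thesis .
qed

interpretation angle_measure: finite_measure angle_measure
  by standard (simp add: emeasure_angle_measure)

lemma measure_angle_measure[simp]: "measure angle_measure UNIV = 1"
  by (simp add: measure_def emeasure_angle_measure)

lemma measurable_cis[measurable]: "cis \<in> borel_measurable borel"
  by (intro borel_measurable_continuous_onI continuous_intros)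

text \<open>The antiderivative of a nonconstant character takes the same value at -pi and pi. This
  orthogonality is behind all coefficient extractions.\<close>

lemma integral_angle_measure_cis:
  "(\<integral>t. cis (of_int n * t) \<partial>angle_measure) = of_bool (n = 0)"
proof (cases "n = 0")
  case False
  define F where "F = (\<lambda>t. cis (of_int n * t) / (\<i> * of_int n))"
  have "((\<lambda>t. exp (\<i> * of_int n * of_real t) / (\<i> * of_int n)) has_vector_derivative
      exp (\<i> * of_int n * of_real t)) (at t within {-pi..pi})" for t
    using False
    by (intro has_vector_derivative_real_field) (auto intro!: derivative_eq_intros)
  then have "(F has_vector_derivative cis (of_int n * t)) (at t within {-pi..pi})" for t
    by (simp add: F_def cis_conv_exp mult.assoc)
  then have "((\<lambda>t. cis (of_int n * t)) has_integral F pi - F (-pi)) {-pi..pi}"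
    by (intro fundamental_theorem_of_calculus) auto
  moreover have "F pi = F (-pi)"
    using sin_npi_int[of n] by (simp add: F_def cis.ctr mult.commute)
  moreover have "set_integrable lborel {-pi..pi} (\<lambda>t. cis (of_int n * t))"
    by (intro borel_integrable_atLeastAtMost' continuous_intros)
  ultimately have "(LINT t:{-pi..pi}|lborel. cis (of_int n * t)) = 0"
    by (simp add: set_borel_integral_eq_integral integral_unique)
  then show ?thesis
    using False by (simp add: integral_angle_measure)
qed (simp)

text \<open>The disc |w|^2 <= a has area pi a, so both measures agree on the half-lines, which
  generate the Borel sets. It replaces polar coordinates: in t = |w|^2 there is no Jacobian.\<close>

lemma distr_norm_square_complex:
  "distr lborel borel (\<lambda>w::complex. norm w ^ 2) = density lborel (\<lambda>t. ennreal (pi * indicator {0..} t))"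
    (is "?M = ?N")
proof -
  have M: "emeasure ?M {..a} = ennreal (pi * max 0 a)" for a
  proof (cases "a \<ge> 0")
    case True
    have "(\<lambda>w::complex. norm w ^ 2) -` {..a} = cball 0 (sqrt a)"
      using True by (auto simp: real_le_rsqrt sqrt_ge_absD real_sqrt_le_iff' abs_le_square_iff)
    then show ?thesis
      using True by (simp add: emeasure_distr emeasure_cball eval_unit_ball_vol)
  next
    case False
    then have "(\<lambda>w::complex. norm w ^ 2) -` {..a} = {}"
      by (auto simp: not_le) (meson leD less_le_trans zero_le_power2)
    then show ?thesis
      using False by (simp add: emeasure_distr)
  qed
  have N: "emeasure ?N {..a} = ennreal (pi * max 0 a)" for a
  proof -
    have "emeasure ?N {..a} = (\<integral>\<^sup>+t. ennreal pi * indicator {0..a} t \<partial>lborel)"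
      by (subst emeasure_density) (auto intro!: nn_integral_cong simp: indicator_def)
    then show ?thesis
      by (simp add: nn_integral_cmult ennreal_mult'[symmetric] emeasure_lborel_Icc_eq max_def)
  qed
  show ?thesis
  proof (rule measure_eqI_generator_eq[where \<Omega> = UNIV and E = "range atMost" and A = "\<lambda>i. {..real i}"])
    show "Int_stable (range atMost :: real set set)"
      by (auto simp: Int_stable_def)
    show "(\<Union>i. {..real i}) = (UNIV :: real set)"
      by (auto simp: real_arch_simple)
    have "sets borel = sigma_sets UNIV (range (atMost :: real \<Rightarrow> real set))"
      by (simp add: borel_eq_atMost)
    then show "sets ?M = sigma_sets UNIV (range atMost)" "sets ?N = sigma_sets UNIV (range atMost)"
      by simp_all
  qed (auto simp: M N)
qed

lemma integral_complex_radial: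
  fixes h :: "real \<Rightarrow> 'a::{banach, second_countable_topology}"
  assumes [measurable]: "h \<in> borel_measurable borel"
  shows "(\<integral>w. h (norm (w::complex) ^ 2) \<partial>lborel) = pi *\<^sub>R (LINT t:{0..}|lborel. h t)"
proof -
  have "(\<integral>w. h (norm (w::complex) ^ 2) \<partial>lborel) = integral\<^sup>L (distr lborel borel (\<lambda>w::complex. norm w ^ 2)) h"
    by (rule integral_distr[symmetric]) auto
  also have "\<dots> = (\<integral>t. (pi * indicator {0..} t) *\<^sub>R h t \<partial>lborel)"
    unfolding distr_norm_square_complex by (intro integral_density) auto
  also have "\<dots> = (\<integral>t. pi *\<^sub>R (indicator {0..} t *\<^sub>R h t) \<partial>lborel)"
    by simp
  finally show ?thesis
    unfolding set_lebesgue_integral_def by (metis integral_scaleR_right)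
qed

lemma integrable_complex_radial_iff:
  fixes h :: "real \<Rightarrow> 'a::{banach, second_countable_topology}"
  assumes [measurable]: "h \<in> borel_measurable borel"
  shows "integrable lborel (\<lambda>w::complex. h (norm w ^ 2)) \<longleftrightarrow> set_integrable lborel {0..} h"
proof -
  have "integrable lborel (\<lambda>w::complex. h (norm w ^ 2)) \<longleftrightarrow>
      integrable (distr lborel borel (\<lambda>w::complex. norm w ^ 2)) h"
    by (rule integrable_distr_eq[symmetric]) auto
  also have "\<dots> \<longleftrightarrow> integrable lborel (\<lambda>t. (pi * indicator {0..} t) *\<^sub>R h t)"
    unfolding distr_norm_square_complex by (intro integrable_density) auto
  also have "(\<lambda>t. (pi * indicator {0..} t) *\<^sub>R h t) = (\<lambda>t. pi *\<^sub>R (indicator {0..} t *\<^sub>R h t))"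
    by simp
  also have "integrable lborel (\<lambda>t. pi *\<^sub>R g t) \<longleftrightarrow> integrable lborel g" for g :: "real \<Rightarrow> 'a"
    using integrable_scaleR_right[of "1 / pi" lborel "\<lambda>t. pi *\<^sub>R g t"] by auto
  finally show ?thesis
    unfolding set_integrable_def .
qed

lemma lborel_rotate:
  "distr lborel borel (\<lambda>w::complex. cis t * w) = lborel"
  "distr lborel borel (\<lambda>(z::complex, w::complex). (cis s * z, cis t * w)) = lborel"
proof -
  show "distr lborel borel (\<lambda>w::complex. cis t * w) = lborel"
    by (rule lborel_distr_isometry) (auto simp: norm_mult intro!: linearI simp: algebra_simps)
  show "distr lborel borel (\<lambda>(z::complex, w::complex). (cis s * z, cis t * w)) = lborel"
    by (rule lborel_distr_isometry) (auto simp: norm_Pair norm_mult intro!: linearI simp: algebra_simps)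
qed

section \<open>Power series on complete Reinhardt domains\<close>

text \<open>The Taylor series is dominated on the circle through z by a convergent series of
  constants, so it is integrated term by term and orthogonality leaves n = j.\<close>

lemma angle_mean_holomorphic:
  assumes g: "g holomorphic_on ball 0 R" and z: "norm z < R"
  shows "(\<integral>t. g (cis t * z) * cis (- (real j * t)) \<partial>angle_measure) = (deriv ^^ j) g 0 / fact j * z ^ j"
proof -
  define c where "c = (\<lambda>n. (deriv ^^ n) g 0 / fact n)"
  have ps: "(\<lambda>n. c n * x ^ n) sums g x" if "norm x < R" for x
    using holomorphic_power_series[OF g, of x] that by (simp add: c_def)
  \<comment> \<open>Absolute convergence at z is inherited from convergence at a slightly larger
    radius.\<close>
  have abs: "summable (\<lambda>n. norm (c n * z ^ n))"
  proof -
    obtain r where "norm z < r" "r < R"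
      using z dense by blast
    then have "summable (\<lambda>n. c n * of_real r ^ n)" "norm z < norm (complex_of_real r)"
      using ps[of "of_real r"] norm_ge_zero[of z] by (auto simp: sums_iff simp del: norm_ge_zero)
    then show ?thesis
      by (rule powser_insidea)
  qed
  have "((\<lambda>n. \<integral>t. c n * z ^ n * cis (of_int (int n - int j) * t) \<partial>angle_measure) has_sum
      (\<integral>t. g (cis t * z) * cis (- (real j * t)) \<partial>angle_measure)) UNIV"
  proof (rule has_sum_integral_dominated[where h = id and w = "\<lambda>_. \<Sum>n. norm (c n * z ^ n)"])
    fix F :: "nat set" and t :: real assume "finite F"
    then show "(\<Sum>n\<in>F. norm (c n * z ^ n * cis (of_int (int n - int j) * t))) \<le> (\<Sum>n. norm (c n * z ^ n))"
      using sum_le_suminf[OF abs, of F] by (simp add: norm_mult)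
  next
    fix t :: real
    have "(\<lambda>n. c n * (cis t * z) ^ n * cis (- (real j * t))) sums (g (cis t * z) * cis (- (real j * t)))"
      using z by (intro sums_mult2 ps) (simp add: norm_mult)
    moreover have "c n * (cis t * z) ^ n * cis (- (real j * t)) = c n * z ^ n * cis (of_int (int n - int j) * t)" for n
    proof -
      have "cis t ^ n * cis (- (real j * t)) = cis (of_int (int n - int j) * t)"
        unfolding Complex.DeMoivre cis_mult by (simp add: left_diff_distrib)
      moreover have "c n * (cis t * z) ^ n * cis (- (real j * t)) = c n * z ^ n * (cis t ^ n * cis (- (real j * t)))"
        by (simp add: power_mult_distrib)
      ultimately show ?thesis
        by simp
    qed
    ultimately show "((\<lambda>n. c n * z ^ n * cis (of_int (int n - int j) * t)) has_sum
        g (cis t * z) * cis (- (real j * t))) UNIV"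
      using abs by (intro norm_summable_imp_has_sum) (auto simp: norm_mult)
  qed auto
  moreover have "(\<integral>t. c n * z ^ n * cis (of_int (int n - int j) * t) \<partial>angle_measure) = (if n = j then c j * z ^ j else 0)" for n
    by (simp only: integral_mult_right_zero integral_angle_measure_cis) auto
  ultimately have "((\<lambda>n. if n = j then c j * z ^ j else 0) has_sum
      (\<integral>t. g (cis t * z) * cis (- (real j * t)) \<partial>angle_measure)) UNIV"
    by simp
  moreover have "((\<lambda>n. if n = j then c j * z ^ j else 0) has_sum (c j * z ^ j)) UNIV"
    using has_sum_finite_neutralI[of "{j}" UNIV "\<lambda>n. if n = j then c j * z ^ j else 0"] by auto
  ultimately have "(\<integral>t. g (cis t * z) * cis (- (real j * t)) \<partial>angle_measure) = c j * z ^ j"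
    by (rule has_sum_unique)
  then show ?thesis
    by (simp add: c_def)
qed

text \<open>The Fourier coefficient with index (j, k) of f on the torus through (z, w), as an
  iterated integral with the z-angle inside.\<close>

definition torus_mean :: "(C2 \<Rightarrow> complex) \<Rightarrow> nat \<Rightarrow> nat \<Rightarrow> complex \<Rightarrow> complex \<Rightarrow> complex" where
  "torus_mean f j k z w =
     (\<integral>t. (\<integral>s. f (cis s * z, cis t * w) * cis (- (real j * s)) \<partial>angle_measure) * cis (- (real k * t)) \<partial>angle_measure)"

section \<open>Double power series on complete Reinhardt domains\<close>

locale reinhardt_domain =
  fixes D :: "C2 set"
  assumes open_D: "open D"
    and nonempty_D: "D \<noteq> {}"
    and complete_D: "(z, w) \<in> D \<Longrightarrow> norm z' \<le> norm z \<Longrightarrow> norm w' \<le> norm w \<Longrightarrow> (z', w') \<in> D"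
begin

lemma enlarge:
  assumes "(z, w) \<in> D"
  obtains e where "e > 0" "(of_real (norm z + e), of_real (norm w + e)) \<in> D"
proof -
  have "(of_real (norm z), of_real (norm w)) \<in> D"
    using complete_D[OF assms] by simp
  then obtain e where e: "e > 0" "ball (of_real (norm z), of_real (norm w)) e \<subseteq> D"
    using open_D open_contains_ball by blast
  have "(of_real (norm z + e / 3), of_real (norm w + e / 3)) \<in> ball (complex_of_real (norm z), complex_of_real (norm w)) e"
  proof -
    have "dist (complex_of_real (norm z), complex_of_real (norm w)) (of_real (norm z + e / 3), of_real (norm w + e / 3))
       \<le> norm (complex_of_real (e / 3)) + norm (complex_of_real (e / 3))"
      using norm_Pair_le[of "- complex_of_real (e / 3)" "- complex_of_real (e / 3)"]
      by (simp add: dist_norm)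
    also have "\<dots> < e"
      using e by simp
    finally show ?thesis
      by simp
  qed
  then show ?thesis
    using e that[of "e / 3"] by auto
qed

lemma polydisc_subset: "(z, w) \<in> D \<Longrightarrow> cball 0 (norm z) \<times> cball 0 (norm w) \<subseteq> D"
  using complete_D by auto

lemma torus_bound:
  assumes f: "continuous_on D f" and zw: "(z, w) \<in> D"
  obtains M where "\<And>z' w'. norm z' \<le> norm z \<Longrightarrow> norm w' \<le> norm w \<Longrightarrow> norm (f (z', w') :: complex) \<le> M"
proof -
  have "compact (f ` (cball 0 (norm z) \<times> cball 0 (norm w)))"
    using polydisc_subset[OF zw] f
    by (intro compact_continuous_image compact_Times) (auto intro: continuous_on_subset)
  then have "bounded (f ` (cball 0 (norm z) \<times> cball 0 (norm w)))"
    by (rule compact_imp_bounded)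
  then obtain M where "\<forall>x\<in>f ` (cball 0 (norm z) \<times> cball 0 (norm w)). norm x \<le> M"
    by (auto simp: bounded_iff)
  then show ?thesis
    by (intro that[of M]) auto
qed

lemma torus_measurable:
  assumes f: "continuous_on D f" and zw: "(z, w) \<in> D"
  shows "(\<lambda>(s, t). f (cis s * z, cis t * w) :: complex) \<in> borel_measurable (borel \<Otimes>\<^sub>M borel)"
proof -
  have "continuous_on UNIV (\<lambda>x::real \<times> real. f (cis (fst x) * z, cis (snd x) * w))"
    using complete_D[OF zw]
    by (intro continuous_on_compose2[OF f] continuous_intros) (auto simp: norm_mult)
  then show ?thesis
    by (simp add: borel_prod borel_measurable_continuous_onI split_def)
qed

lemma torus_mean_swap:
  assumes f: "continuous_on D f" and zw: "(z, w) \<in> D"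
  shows "torus_mean f j k z w =
    (\<integral>s. (\<integral>t. f (cis s * z, cis t * w) * cis (- (real k * t)) \<partial>angle_measure) * cis (- (real j * s)) \<partial>angle_measure)"
proof -
  obtain M where M: "\<And>z' w'. norm z' \<le> norm z \<Longrightarrow> norm w' \<le> norm w \<Longrightarrow> norm (f (z', w')) \<le> M"
    using torus_bound[OF f zw] by blast
  interpret pair_sigma_finite angle_measure angle_measure
    by (intro pair_sigma_finite.intro) unfold_locales
  note [measurable] = torus_measurable[OF f zw]
  have "emeasure (angle_measure \<Otimes>\<^sub>M angle_measure) UNIV < \<infinity>"
    using angle_measure.emeasure_pair_measure_Times[of UNIV angle_measure UNIV]
    by (simp add: emeasure_angle_measure)
  then interpret P: finite_measure "angle_measure \<Otimes>\<^sub>M angle_measure"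
    by unfold_locales (simp add: space_pair_measure)
  have "integrable (angle_measure \<Otimes>\<^sub>M angle_measure)
      (\<lambda>(s, t). f (cis s * z, cis t * w) * cis (- (real j * s)) * cis (- (real k * t)))"
    by (rule P.integrable_const_bound[where B = M]) (auto simp: norm_mult intro!: M AE_I2)
  note Fubini_integral[OF this]
  moreover have "(\<integral>t. f (cis s * z, cis t * w) * cis (- (real j * s)) * cis (- (real k * t)) \<partial>angle_measure)
      = (\<integral>t. f (cis s * z, cis t * w) * cis (- (real k * t)) \<partial>angle_measure) * cis (- (real j * s))" for s
    by (subst integral_mult_left_zero[symmetric]) (simp only: mult_ac)
  ultimately show ?thesis
    by (simp add: torus_mean_def)
qed

text \<open>In \<open>a k j\<close> and in all index pairs \<open>(k, j)\<close> below, \<open>k\<close> is the exponent of \<open>w\<close> and \<open>j\<close> that of \<open>z\<close>.\<close>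

theorem power_series:
  assumes f: "continuous_on D f"
    and slice_z: "\<And>w. (\<lambda>z. f (z, w)) holomorphic_on {z. (z, w) \<in> D}"
    and slice_w: "\<And>z. (\<lambda>w. f (z, w)) holomorphic_on {w. (z, w) \<in> D}"
  obtains a where
    "\<And>z w j k. (z, w) \<in> D \<Longrightarrow> torus_mean f j k z w = a k j * z ^ j * w ^ k"
    "\<And>z w. (z, w) \<in> D \<Longrightarrow> ((\<lambda>(k, j). a k j * z ^ j * w ^ k) has_sum f (z, w)) UNIV"
proof -
  \<comment> \<open>\<open>h j\<close> and \<open>g k\<close> are the Taylor coefficients of the
    one-variable slices. Taken in one order, the torus mean is z^j times a function of w; in the
    other, it is w^k times a function of z. Together this forces the monomial form.\<close>
  define h where "h = (\<lambda>j w. (deriv ^^ j) (\<lambda>z. f (z, w)) 0 / fact j)"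
  define g where "g = (\<lambda>k z. (deriv ^^ k) (\<lambda>w. f (z, w)) 0 / fact k)"
  have ball_z: "\<exists>R. (\<lambda>z. f (z, w)) holomorphic_on ball 0 R \<and> norm z < R"
    and ball_w: "\<exists>R. (\<lambda>w. f (z, w)) holomorphic_on ball 0 R \<and> norm w < R" if "(z, w) \<in> D" for z w
  proof -
    obtain e where e: "e > 0" "(of_real (norm z + e), of_real (norm w + e)) \<in> D"
      using enlarge[OF \<open>(z, w) \<in> D\<close>] .
    have "ball 0 (norm z + e) \<subseteq> {z. (z, w) \<in> D}"
      using e(1) by (auto intro!: complete_D[OF e(2)] simp del: of_real_add)
    then show "\<exists>R. (\<lambda>z. f (z, w)) holomorphic_on ball 0 R \<and> norm z < R"
      using holomorphic_on_subset[OF slice_z] e by (intro exI[of _ "norm z + e"]) auto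
    have "ball 0 (norm w + e) \<subseteq> {w. (z, w) \<in> D}"
      using e(1) by (auto intro!: complete_D[OF e(2)] simp del: of_real_add)
    then show "\<exists>R. (\<lambda>w. f (z, w)) holomorphic_on ball 0 R \<and> norm w < R"
      using holomorphic_on_subset[OF slice_w] e by (intro exI[of _ "norm w + e"]) auto
  qed
  have mean_z: "(\<integral>s. f (cis s * z, w) * cis (- (real j * s)) \<partial>angle_measure) = h j w * z ^ j"
    and mean_w: "(\<integral>t. f (z, cis t * w) * cis (- (real k * t)) \<partial>angle_measure) = g k z * w ^ k"
    if "(z, w) \<in> D" for z w j k
    using ball_z[OF that] ball_w[OF that]
      angle_mean_holomorphic[of "\<lambda>z. f (z, w)" _ z j] angle_mean_holomorphic[of "\<lambda>w. f (z, w)" _ w k]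
    by (auto simp: h_def g_def)
  define A where "A = (\<lambda>j k w. \<integral>t. h j (cis t * w) * cis (- (real k * t)) \<partial>angle_measure)"
  define B where "B = (\<lambda>j k z. \<integral>s. g k (cis s * z) * cis (- (real j * s)) \<partial>angle_measure)"
  have PA: "torus_mean f j k z w = z ^ j * A j k w" if "(z, w) \<in> D" for j k z w
  proof -
    have "(z, cis t * w) \<in> D" for t
      using complete_D[OF that] by (simp add: norm_mult)
    then show ?thesis
      unfolding torus_mean_def A_def
      by (simp add: mean_z mult.assoc mult.left_commute[of _ "z ^ j"] flip: integral_mult_right_zero)
  qed
  have PB: "torus_mean f j k z w = w ^ k * B j k z" if "(z, w) \<in> D" for j k z w
  proof -
    have "(cis s * z, w) \<in> D" for s
      using complete_D[OF that] by (simp add: norm_mult)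
    then show ?thesis
      unfolding torus_mean_swap[OF f that] B_def
      by (simp add: mean_w mult.assoc mult.left_commute[of _ "w ^ k"] flip: integral_mult_right_zero)
  qed
  \<comment> \<open>A point of D with both coordinates positive, so that \<open>a k j\<close> can be
    defined by dividing by e^k.\<close>
  obtain e where e: "e > 0" "(of_real e, of_real e) \<in> D"
  proof -
    obtain z w where "(z, w) \<in> D"
      using nonempty_D by auto
    then obtain e where "e > 0" "(of_real (norm z + e), of_real (norm w + e)) \<in> D"
      using enlarge by blast
    then show ?thesis
      using that[of e] complete_D[of "of_real (norm z + e)" "of_real (norm w + e)" "of_real e" "of_real e"]
      by (simp del: of_real_add)
  qed
  define a where "a = (\<lambda>k j. A j k (of_real e) / of_real e ^ k)"
  have P: "torus_mean f j k z w = a k j * z ^ j * w ^ k" if zw: "(z, w) \<in> D" for j k z w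
  proof -
    obtain d where d: "d > 0" "(of_real (norm z + d), of_real (norm w + d)) \<in> D"
      using enlarge[OF zw] .
    \<comment> \<open>The auxiliary z-coordinate r is positive and so small that both (r, w) and (r,
      e) lie in D. Comparing the two factorisations there and cancelling r^j also covers z = 0 and w
      = 0.\<close>
    define r where "r = min d e"
    have "r \<le> norm z + d"
      using norm_ge_zero[of z] unfolding r_def by linarith
    then have r: "r > 0" "(of_real r, w) \<in> D" "(of_real r, of_real e) \<in> D"
      using complete_D[OF d(2), of "of_real r" w] complete_D[OF e(2), of "of_real r" "of_real e"] d e
      by (auto simp: r_def simp del: of_real_add)
    have "of_real r ^ j * A j k w = w ^ k * B j k (of_real r)"
      using PA[OF r(2), of j k] PB[OF r(2), of j k] by simp
    moreover have "of_real r ^ j * A j k (of_real e) = of_real e ^ k * B j k (of_real r)"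
      using PA[OF r(3), of j k] PB[OF r(3), of j k] by simp
    ultimately have "of_real r ^ j * A j k w = of_real r ^ j * (w ^ k * a k j)"
      using e by (simp add: a_def field_simps)
    then have "A j k w = w ^ k * a k j"
      using r by simp
    then show ?thesis
      using PA[OF zw] by simp
  qed
  have S: "((\<lambda>(k, j). a k j * z ^ j * w ^ k) has_sum f (z, w)) UNIV" if zw: "(z, w) \<in> D" for z w
  proof -
    obtain d where d: "d > 0" "(of_real (norm z + d), of_real (norm w + d)) \<in> D"
      using enlarge[OF zw] .
    \<comment> \<open>Radii strictly beyond |z| and |w|: Cauchy estimates on the torus with radii p
      and q give geometric decay in the ratios \<open>x\<close> and \<open>y\<close>.\<close>
    define p q where "p = norm z + d" and "q = norm w + d"
    have pq: "p > norm z" "q > norm w" "p > 0" "q > 0" "(of_real p, of_real q) \<in> D"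
      using d norm_ge_zero[of z] norm_ge_zero[of w] by (auto simp: p_def q_def simp del: norm_ge_zero)
    have zq: "(z, of_real q) \<in> D"
      using complete_D[OF pq(5), of z "of_real q"] pq by simp
    have pqt: "(of_real p, cis t * of_real q) \<in> D" for t
      using complete_D[OF pq(5), of "of_real p" "cis t * of_real q"] by (simp add: norm_mult)
    have zqt: "(z, cis t * of_real q) \<in> D" for t
      using complete_D[OF zq, of z "cis t * of_real q"] by (simp add: norm_mult)
    obtain M where M: "\<And>z' w'. norm z' \<le> p \<Longrightarrow> norm w' \<le> q \<Longrightarrow> norm (f (z', w')) \<le> M"
      using torus_bound[OF f pq(5)] pq by auto
    have "norm (f (0, 0)) \<le> M"
      using pq by (intro M) auto
    then have "M \<ge> 0"
      using norm_ge_zero order_trans by blast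
    note [measurable] = torus_measurable[OF f pq(5)]
    \<comment> \<open>Integrability of u is not assumed: a non-integrable u has integral 0 by
      convention, and M is nonnegative.\<close>
    have mean_bound: "norm (\<integral>s. u s \<partial>angle_measure) \<le> M" if "\<And>s. norm (u s) \<le> M" for u :: "real \<Rightarrow> complex"
    proof (cases "integrable angle_measure u")
      case True
      have "norm (\<integral>s. u s \<partial>angle_measure) \<le> (\<integral>s. norm (u s) \<partial>angle_measure)"
        by (rule integral_norm_bound)
      also have "\<dots> \<le> (\<integral>s. M \<partial>angle_measure)"
        using True that by (intro integral_mono) auto
      finally show ?thesis
        by simp
    qed (use \<open>M \<ge> 0\<close> in \<open>simp add: not_integrable_integral_eq\<close>)
    have h_bound: "norm (h j (cis t * of_real q)) * p ^ j \<le> M" for j t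
    proof -
      have "norm (\<integral>s. f (cis s * of_real p, cis t * of_real q) * cis (- (real j * s)) \<partial>angle_measure) \<le> M"
        using pq by (intro mean_bound) (auto simp: norm_mult intro!: M)
      then show ?thesis
        using mean_z[OF pqt, of t j] pq by (simp add: norm_mult norm_power)
    qed
    have a_bound: "norm (a k j) * p ^ j * q ^ k \<le> M" for j k
    proof -
      have "norm (torus_mean f j k (of_real p) (of_real q)) \<le> M"
        unfolding torus_mean_def using pq
        by (intro mean_bound) (auto simp: norm_mult intro!: mean_bound M)
      then show ?thesis
        using P[OF pq(5), of j k] pq by (simp add: norm_mult norm_power)
    qed
    define x y where "x = norm z / p" and "y = norm w / q"
    have xy: "x \<ge> 0" "y \<ge> 0" "x < 1" "y < 1"
      using pq by (auto simp: x_def y_def)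
    have geo: "((\<lambda>j. x ^ j) has_sum (1 / (1 - x))) UNIV" "((\<lambda>k. y ^ k) has_sum (1 / (1 - y))) UNIV"
      using xy by (auto intro!: sums_nonneg_imp_has_sum geometric_sums)
    \<comment> \<open>Written as a circle mean, the slice coefficient is a parametric integral and
      hence measurable in t.\<close>
    have h_meas[measurable]: "(\<lambda>t. h j (cis t * of_real q)) \<in> borel_measurable borel" for j
    proof -
      have "h j (cis t * of_real q) =
          (\<integral>s. f (cis s * of_real p, cis t * of_real q) * cis (- (real j * s)) \<partial>angle_measure) / of_real p ^ j" for t
        using mean_z[OF pqt, of t j] pq by simp
      then show ?thesis
        by simp
    qed
    \<comment> \<open>The z-slice series on the circle of radius q is integrated against the k-th
      character; this gives the power series of \<open>g k\<close>, with coefficients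
      \<open>a k j\<close>.\<close>
    have inner: "((\<lambda>j. a k j * z ^ j) has_sum g k z) UNIV" for k
    proof -
      have "((\<lambda>j. \<integral>t. h j (cis t * of_real q) * z ^ j * cis (- (real k * t)) \<partial>angle_measure) has_sum
          (\<integral>t. f (z, cis t * of_real q) * cis (- (real k * t)) \<partial>angle_measure)) UNIV"
      proof (rule has_sum_integral_dominated[where h = id and w = "\<lambda>_. M * (1 / (1 - x))"])
        have le: "norm (h j (cis t * of_real q) * z ^ j) \<le> M * x ^ j" for j t
        proof -
          have "norm (h j (cis t * of_real q) * z ^ j) = (norm (h j (cis t * of_real q)) * p ^ j) * x ^ j"
            using pq by (simp add: x_def norm_mult norm_power power_divide)
          also have "\<dots> \<le> M * x ^ j"
            using xy by (intro mult_right_mono h_bound) auto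
          finally show ?thesis .
        qed
        {
          fix t :: real and F :: "nat set" assume "finite F"
          have "(\<Sum>j\<in>F. norm (h j (cis t * of_real q) * z ^ j * cis (- (real k * t)))) \<le> (\<Sum>j\<in>F. M * x ^ j)"
            using le by (intro sum_mono) (simp add: norm_mult)
          also have "\<dots> \<le> M * (1 / (1 - x))"
            unfolding sum_distrib_left[symmetric] using xy \<open>M \<ge> 0\<close> \<open>finite F\<close>
              sum_le_suminf[of "\<lambda>j. x ^ j" F]
            by (intro mult_left_mono) (auto simp: suminf_geometric)
          finally show "(\<Sum>j\<in>F. norm (h j (cis t * of_real q) * z ^ j * cis (- (real k * t)))) \<le> M * (1 / (1 - x))" .
        next
          fix t :: real
          obtain R where R: "(\<lambda>z. f (z, cis t * of_real q)) holomorphic_on ball 0 R" "norm z < R"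
            using ball_z[OF zqt] by blast
          have "(\<lambda>j. h j (cis t * of_real q) * z ^ j) sums f (z, cis t * of_real q)"
            using holomorphic_power_series[OF R(1), of z] R(2) by (simp add: h_def)
          moreover have "summable (\<lambda>j. norm (h j (cis t * of_real q) * z ^ j))"
          proof (rule summable_comparison_test)
            show "summable (\<lambda>j. M * x ^ j)"
              using xy by (intro summable_mult summable_geometric) auto
          qed (use le in auto)
          ultimately have "((\<lambda>j. h j (cis t * of_real q) * z ^ j) has_sum f (z, cis t * of_real q)) UNIV"
            by (intro norm_summable_imp_has_sum)
          then show "((\<lambda>j. h j (cis t * of_real q) * z ^ j * cis (- (real k * t))) has_sum
              f (z, cis t * of_real q) * cis (- (real k * t))) UNIV"
            by (rule has_sum_cmult_left)
        }
      qed auto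
      also have "(\<integral>t. f (z, cis t * of_real q) * cis (- (real k * t)) \<partial>angle_measure) = g k z * of_real q ^ k"
        by (rule mean_w[OF zq])
      also have "(\<lambda>j. \<integral>t. h j (cis t * of_real q) * z ^ j * cis (- (real k * t)) \<partial>angle_measure)
          = (\<lambda>j. a k j * z ^ j * of_real q ^ k)"
      proof
        fix j
        have "of_real p ^ j * A j k (of_real q) = a k j * of_real p ^ j * of_real q ^ k"
          using trans[OF PA[OF pq(5), of j k, symmetric] P[OF pq(5), of j k]] .
        then have "A j k (of_real q) = a k j * of_real q ^ k"
          using pq by simp
        moreover have "(\<integral>t. h j (cis t * of_real q) * z ^ j * cis (- (real k * t)) \<partial>angle_measure)
            = z ^ j * A j k (of_real q)"
          unfolding A_def by (subst integral_mult_right_zero[symmetric]) (simp only: mult_ac)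
        ultimately show "(\<integral>t. h j (cis t * of_real q) * z ^ j * cis (- (real k * t)) \<partial>angle_measure) = a k j * z ^ j * of_real q ^ k"
          by (simp only: mult_ac)
      qed
      finally show ?thesis
        using pq by (simp add: has_sum_cmult_left_iff)
    qed
    have abs: "(\<lambda>u. norm (case u of (k, j) \<Rightarrow> a k j * z ^ j * w ^ k)) summable_on UNIV"
    proof (rule Infinite_Sum.abs_summable_on_comparison_test')
      show "(\<lambda>(k, j). M * (x ^ j * y ^ k)) summable_on UNIV"
      proof -
        have "(\<lambda>(k, j). x ^ j * y ^ k) summable_on UNIV \<times> UNIV"
        proof (rule summable_on_SigmaI[where g = "\<lambda>k. 1 / (1 - x) * y ^ k"])
          show "((\<lambda>j. case (k, j) of (k, j) \<Rightarrow> x ^ j * y ^ k) has_sum 1 / (1 - x) * y ^ k) UNIV" for k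
            using has_sum_cmult_left[OF geo(1)] by simp
          show "(\<lambda>k. 1 / (1 - x) * y ^ k) summable_on UNIV"
            using has_sum_cmult_right[OF geo(2)] by (rule has_sum_imp_summable)
        qed (use xy in auto)
        then have "(\<lambda>u. M * (case u of (k, j) \<Rightarrow> x ^ j * y ^ k)) summable_on UNIV"
          by (intro summable_on_cmult_right) simp
        then show ?thesis
          by (simp add: case_prod_unfold)
      qed
      fix u :: "nat \<times> nat"
      obtain k j where u: "u = (k, j)"
        by force
      have "norm (a k j * z ^ j * w ^ k) = (norm (a k j) * p ^ j * q ^ k) * (x ^ j * y ^ k)"
        using pq by (simp add: x_def y_def norm_mult norm_power power_divide)
      also have "\<dots> \<le> M * (x ^ j * y ^ k)"
        using xy by (intro mult_right_mono a_bound) auto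
      finally show "norm (case u of (k, j) \<Rightarrow> a k j * z ^ j * w ^ k) \<le> (case u of (k, j) \<Rightarrow> M * (x ^ j * y ^ k))"
        by (simp add: u)
    qed
    obtain R where R: "(\<lambda>w. f (z, w)) holomorphic_on ball 0 R" "norm w < R"
      using ball_w[OF zw] by blast
    \<comment> \<open>The iterated sum is f (z, w) by the w-slice; absolute summability identifies
      it with the unordered double sum.\<close>
    have "(\<lambda>k. g k z * w ^ k) sums f (z, w)"
      using holomorphic_power_series[OF R(1), of w] R(2) by (simp add: g_def)
    moreover have "((\<lambda>(k, j). a k j * z ^ j * w ^ k) has_sum (\<Sum>\<^sub>\<infinity>(k, j). a k j * z ^ j * w ^ k)) (UNIV \<times> UNIV)"
      using Infinite_Sum.abs_summable_summable[OF abs] by simp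
    then have "((\<lambda>k. g k z * w ^ k) has_sum (\<Sum>\<^sub>\<infinity>(k, j). a k j * z ^ j * w ^ k)) UNIV"
      by (rule has_sum_SigmaD) (auto intro!: has_sum_cmult_left inner)
    then have "(\<lambda>k. g k z * w ^ k) sums (\<Sum>\<^sub>\<infinity>(k, j). a k j * z ^ j * w ^ k)"
      by (rule has_sum_imp_sums)
    ultimately have "(\<Sum>\<^sub>\<infinity>(k, j). a k j * z ^ j * w ^ k) = f (z, w)"
      using sums_unique2 by blast
    then show ?thesis
      using has_sum_infsum[OF Infinite_Sum.abs_summable_summable[OF abs]] by simp
  qed
  show ?thesis
    using that[of a] P S by blast
qed

end

section \<open>Holomorphic functions of two variables\<close>

lemma holomorphic2_on_const: "holomorphic2_on (\<lambda>_. c) U"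
  unfolding holomorphic2_on_def by (intro ballI exI[of _ 0]) (simp add: case_prod_unfold)

lemma holomorphic2_on_fst: "holomorphic2_on fst U"
  unfolding holomorphic2_on_def
  by (intro ballI, rule exI[of _ 1], rule exI[of _ 0])
     (auto intro!: derivative_eq_intros simp: case_prod_unfold)

lemma holomorphic2_on_snd: "holomorphic2_on snd U"
  unfolding holomorphic2_on_def
  by (intro ballI, rule exI[of _ 0], rule exI[of _ 1])
     (auto intro!: derivative_eq_intros simp: case_prod_unfold)

lemma holomorphic2_on_mult:
  assumes "holomorphic2_on f U" "holomorphic2_on g U"
  shows "holomorphic2_on (\<lambda>p. f p * g p) U"
  unfolding holomorphic2_on_def
proof
  fix p assume p: "p \<in> U"
  obtain a b where f: "(f has_derivative (\<lambda>(h, k). a * h + b * k)) (at p)"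
    using assms(1) p unfolding holomorphic2_on_def by blast
  obtain a' b' where g: "(g has_derivative (\<lambda>(h, k). a' * h + b' * k)) (at p)"
    using assms(2) p unfolding holomorphic2_on_def by blast
  from has_derivative_mult[OF f g]
  have "((\<lambda>p. f p * g p) has_derivative (\<lambda>(h, k). (f p * a' + a * g p) * h + (f p * b' + b * g p) * k)) (at p)"
    by (simp add: case_prod_unfold algebra_simps)
  then show "\<exists>a b. ((\<lambda>p. f p * g p) has_derivative (\<lambda>(h, k). a * h + b * k)) (at p)"
    by blast
qed

lemma holomorphic2_on_compose:
  assumes "holomorphic2_on f U" "g holomorphic_on V" "open V" "f ` U \<subseteq> V"
  shows "holomorphic2_on (\<lambda>p. g (f p)) U"
  unfolding holomorphic2_on_def
proof
  fix p assume p: "p \<in> U"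
  obtain a b where f: "(f has_derivative (\<lambda>(h, k). a * h + b * k)) (at p)"
    using assms(1) p unfolding holomorphic2_on_def by blast
  have "(g has_field_derivative deriv g (f p)) (at (f p))"
    using assms p by (intro holomorphic_derivI[of g V]) auto
  then have "(g has_derivative (*) (deriv g (f p))) (at (f p))"
    by (simp add: has_field_derivative_def)
  from has_derivative_compose[OF f this]
  have "((\<lambda>p. g (f p)) has_derivative (\<lambda>(h, k). (deriv g (f p) * a) * h + (deriv g (f p) * b) * k)) (at p)"
    by (simp add: case_prod_unfold algebra_simps)
  then show "\<exists>a b. ((\<lambda>p. g (f p)) has_derivative (\<lambda>(h, k). a * h + b * k)) (at p)"
    by blast
qed

lemma holomorphic2_on_cmult: "holomorphic2_on f U \<Longrightarrow> holomorphic2_on (\<lambda>p. c * f p) U"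
  by (intro holomorphic2_on_mult holomorphic2_on_const)

lemma holomorphic2_on_imp_continuous_on: "holomorphic2_on f U \<Longrightarrow> continuous_on U f"
  unfolding holomorphic2_on_def
  by (metis continuous_at_imp_continuous_on has_derivative_continuous)

lemma holomorphic2_on_slice:
  assumes f: "holomorphic2_on f U"
  shows "(\<lambda>z. f (z, w)) holomorphic_on {z. (z, w) \<in> U}"
    and "(\<lambda>w. f (z, w)) holomorphic_on {w. (z, w) \<in> U}"
proof -
  have "\<exists>d. ((\<lambda>z. f (z, w)) has_field_derivative d) (at z)"
    "\<exists>d. ((\<lambda>w. f (z, w)) has_field_derivative d) (at w)" if zw: "(z, w) \<in> U" for z w
  proof -
    obtain a b where f: "(f has_derivative (\<lambda>(h, k). a * h + b * k)) (at (z, w))"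
      using assms zw unfolding holomorphic2_on_def by blast
    have "((\<lambda>z. (z, w)) has_derivative (\<lambda>h. (h, 0))) (at z)"
      by (auto intro!: derivative_eq_intros)
    from has_derivative_compose[OF this f]
    show "\<exists>d. ((\<lambda>z. f (z, w)) has_field_derivative d) (at z)"
      unfolding has_field_derivative_def by (intro exI[of _ a]) simp
    have "((\<lambda>w. (z, w)) has_derivative (\<lambda>k. (0, k))) (at w)"
      by (auto intro!: derivative_eq_intros)
    from has_derivative_compose[OF this f]
    show "\<exists>d. ((\<lambda>w. f (z, w)) has_field_derivative d) (at w)"
      unfolding has_field_derivative_def by (intro exI[of _ b]) simp
  qed
  then show "(\<lambda>z. f (z, w)) holomorphic_on {z. (z, w) \<in> U}"
    and "(\<lambda>w. f (z, w)) holomorphic_on {w. (z, w) \<in> U}"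
    unfolding holomorphic_on_def field_differentiable_def
    by (meson has_field_derivative_at_within mem_Collect_eq)+
qed

section \<open>The egg domains and their weighted kernels\<close>

text \<open>Kept as an explicit inequality, the form that the kernel estimates up to the boundary
  use; the proof of \<open>frontier_egg_domain\<close> identifies it with the topological
  closure.\<close>

definition egg_closure :: "nat \<Rightarrow> C2 set" where
  "egg_closure m = {(z, w). norm z ^ 2 + norm w ^ (2 * m) \<le> 1}"

lemma egg_domain_subset_closure: "egg_domain m \<subseteq> egg_closure m"
  by (auto simp: egg_domain_def egg_closure_def)

lemma egg_closure_norm:
  assumes m: "m \<ge> 1" and "(z, w) \<in> egg_closure m"
  shows "norm z \<le> 1" "norm w \<le> 1"
proof -
  have "norm z ^ 2 \<le> 1" "norm w ^ (2 * m) \<le> 1"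
    using assms zero_le_power[OF norm_ge_zero[of w], of "2 * m"] zero_le_power2[of "norm z"]
    unfolding egg_closure_def mem_Collect_eq case_prod_conv by linarith+
  then show "norm z \<le> 1" "norm w \<le> 1"
    using m by (auto simp: power_le_one_iff)
qed

lemma egg_domain_norm:
  assumes m: "m \<ge> 1" and "(z, w) \<in> egg_domain m"
  shows "norm z < 1" "norm w < 1"
proof -
  have "norm z ^ 2 < 1" "norm w ^ (2 * m) < 1"
    using assms zero_le_power[OF norm_ge_zero[of w], of "2 * m"] zero_le_power2[of "norm z"]
    unfolding egg_domain_def mem_Collect_eq case_prod_conv by linarith+
  then show "norm z < 1" "norm w < 1"
    using m by (auto simp: power_less_one_iff)
qed

lemma open_egg_domain: "open (egg_domain m)"
proof -
  have "egg_domain m = {p. norm (fst p) ^ 2 + norm (snd p) ^ (2 * m) < 1}"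
    by (auto simp: egg_domain_def)
  then show ?thesis
    by (simp add: open_Collect_less continuous_intros)
qed

lemma closed_egg_closure: "closed (egg_closure m)"
proof -
  have "egg_closure m = {p. norm (fst p) ^ 2 + norm (snd p) ^ (2 * m) \<le> 1}"
    by (auto simp: egg_closure_def)
  then show ?thesis
    by (simp add: closed_Collect_le continuous_intros)
qed

lemma compact_egg_closure:
  assumes "m \<ge> 1"
  shows "compact (egg_closure m)"
proof -
  have "egg_closure m \<subseteq> cball 0 1 \<times> cball 0 1"
    using egg_closure_norm[OF assms] by auto
  then show ?thesis
    using closed_egg_closure[of m] compact_Int_closed[OF compact_Times[OF compact_cball compact_cball], of "egg_closure m" 0 1 0 1]
    by (simp add: inf.absorb2)
qed

lemma reinhardt_egg_domain:
  assumes "m \<ge> 1"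
  shows "reinhardt_domain (egg_domain m)"
proof
  show "egg_domain m \<noteq> {}"
    using assms by (auto simp: egg_domain_def power_0_left intro!: exI[of _ 0])
  fix z w z' w' :: complex
  assume *: "(z, w) \<in> egg_domain m" "norm z' \<le> norm z" "norm w' \<le> norm w"
  then have "norm z' ^ 2 \<le> norm z ^ 2" "norm w' ^ (2 * m) \<le> norm w ^ (2 * m)"
    by (simp_all add: power_mono)
  with *(1) show "(z', w') \<in> egg_domain m"
    unfolding egg_domain_def mem_Collect_eq case_prod_conv by linarith
qed (rule open_egg_domain)

section \<open>Negative binomial series\<close>

lemma gbinomial_minus_mult_power:
  fixes b x :: "'a::field_char_0"
  shows "((- b) gchoose j) * (- x) ^ j = pochhammer b j / fact j * x ^ j"
proof -
  have "(- 1) ^ j * (- x) ^ j = x ^ j"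
    by (simp flip: power_mult_distrib)
  then show ?thesis
    by (simp add: gbinomial_pochhammer)
qed

lemma binomial_series_pochhammer:
  fixes x :: complex
  assumes "norm x < 1"
  shows "(\<lambda>j. of_real (pochhammer b j / fact j) * x ^ j) sums (1 - x) powr (- of_real b)"
  using gen_binomial_complex[of "- x" "- of_real b"] assms
  by (simp add: gbinomial_minus_mult_power flip: pochhammer_of_real)

lemma binomial_series_pochhammer_real:
  fixes x :: real
  assumes "\<bar>x\<bar> < 1"
  shows "(\<lambda>j. pochhammer b j / fact j * x ^ j) sums (1 - x) powr (- b)"
  using gen_binomial_real[of "- x" "- b"] assms by (simp add: gbinomial_minus_mult_power)

text \<open>\<open>Q\<close> is the coefficient sequence of the power series q. The powers are
  principal branches, which is harmless: \<open>v\<close> has positive real part when \<zeta> is in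
  the domain and \<eta> in its closure.\<close>

definition egg_kernel :: "nat \<Rightarrow> real \<Rightarrow> (nat \<Rightarrow> real) \<Rightarrow> C2 \<Rightarrow> C2 \<Rightarrow> complex" where
  "egg_kernel m \<gamma> Q \<zeta> \<eta> =
     (let v = 1 - fst \<zeta> * cnj (fst \<eta>)
      in v powr (- of_real \<gamma>) * (\<Sum>k. of_real (Q k) * (snd \<zeta> * cnj (snd \<eta>) * v powr (- of_real (1 / real m))) ^ k))"

section \<open>The weighted kernel: double series, bounds and regularity\<close>

locale egg_weight =
  fixes m :: nat and \<gamma> :: real and Q :: "nat \<Rightarrow> real"
  assumes m: "m \<ge> 1" and gamma: "\<gamma> > 0" and Q: "\<And>k. Q k \<ge> 0"
    and summable_Q: "\<And>t. 0 \<le> t \<Longrightarrow> t < 1 \<Longrightarrow> summable (\<lambda>k. Q k * t ^ k)"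
begin

abbreviation "K \<equiv> egg_kernel m \<gamma> Q"

definition gen :: "complex \<Rightarrow> complex" where
  "gen u = (\<Sum>k. of_real (Q k) * u ^ k)"

text \<open>The coefficient of (z cnj z')^j (w cnj w')^k once the power of 1 - z cnj z' with
  exponent -(\<gamma> + k/m) is expanded. For both kernels it turns out to be the reciprocal of the
  squared norm of z^j w^k.\<close>

definition coef :: "nat \<Rightarrow> nat \<Rightarrow> real" where
  "coef k j = Q k * (pochhammer (\<gamma> + k / m) j / fact j)"

lemma coef_nonneg: "coef k j \<ge> 0"
proof -
  have "\<gamma> + real k / real m > 0"
    using gamma by (intro add_pos_nonneg) auto
  then show ?thesis
    using Q[of k] by (simp add: coef_def pochhammer_nonneg)
qed

lemma gen_summable_norm: "norm u < 1 \<Longrightarrow> summable (\<lambda>k. norm (of_real (Q k) * u ^ k))"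
  for u :: complex
  using summable_Q[of "norm u"] Q by (simp add: norm_mult norm_power)

lemma gen_sums: "norm u < 1 \<Longrightarrow> (\<lambda>k. of_real (Q k) * u ^ k) sums gen u"
  unfolding gen_def by (rule summable_sums[OF summable_norm_cancel[OF gen_summable_norm]])

lemma gen_holomorphic: "gen holomorphic_on ball 0 1"
  by (rule power_series_holomorphic[where a = "\<lambda>k. of_real (Q k)"]) (auto intro!: gen_sums)

lemma cnj_gen: "norm u < 1 \<Longrightarrow> cnj (gen u) = gen (cnj u)"
  using gen_sums[of u] gen_sums[of "cnj u"] sums_cnj[of "\<lambda>k. of_real (Q k) * u ^ k" "gen u"]
  by (simp add: sums_iff)

definition egg_u :: "C2 \<Rightarrow> C2 \<Rightarrow> complex" where
  "egg_u \<zeta> \<eta> = snd \<zeta> * cnj (snd \<eta>) * (1 - fst \<zeta> * cnj (fst \<eta>)) powr (- of_real (1 / real m))"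

lemma K_eq: "K \<zeta> \<eta> = (1 - fst \<zeta> * cnj (fst \<eta>)) powr (- of_real \<gamma>) * gen (egg_u \<zeta> \<eta>)"
  by (simp add: egg_kernel_def gen_def egg_u_def Let_def)

text \<open>Serves as a bound below 1 for the norm of \<open>egg_u \<zeta> \<eta>\<close> that does
  not depend on \<eta>; on the domain its square is \<open>egg_u \<zeta> \<zeta>\<close>.\<close>

definition egg_tau :: "C2 \<Rightarrow> real" where
  "egg_tau \<zeta> = root (2 * m) (norm (snd \<zeta>) ^ (2 * m) / (1 - norm (fst \<zeta>) ^ 2))"

lemma egg_tau:
  assumes "\<zeta> \<in> egg_domain m"
  shows "0 \<le> egg_tau \<zeta>" "egg_tau \<zeta> < 1"
proof -
  have *: "norm (fst \<zeta>) ^ 2 + norm (snd \<zeta>) ^ (2 * m) < 1"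
    using assms by (auto simp: egg_domain_def)
  have pos: "0 \<le> norm (snd \<zeta>) ^ (2 * m)"
    by simp
  have d: "1 - norm (fst \<zeta>) ^ 2 > 0" "norm (snd \<zeta>) ^ (2 * m) < 1 - norm (fst \<zeta>) ^ 2"
    using * pos by linarith+
  then have "0 \<le> norm (snd \<zeta>) ^ (2 * m) / (1 - norm (fst \<zeta>) ^ 2)"
    using pos by (intro divide_nonneg_pos)
  then show "0 \<le> egg_tau \<zeta>"
    unfolding egg_tau_def by (rule real_root_ge_zero)
  have "norm (snd \<zeta>) ^ (2 * m) / (1 - norm (fst \<zeta>) ^ 2) < 1"
    using d by (simp only: divide_less_eq_1_pos)
  moreover have "2 * m > 0"
    using m by simp
  ultimately show "egg_tau \<zeta> < 1"
    unfolding egg_tau_def by (simp only: real_root_lt_1_iff)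
qed

text \<open>Raised to the power 2 m, the bound follows from (1 - |a|^2)(1 - |c|^2) <= (1 -
  |a||c|)^2, the difference being (|a| - |c|)^2, and from |d|^(2m) <= 1 - |c|^2 on the closure. It
  is stated for moduli because these also majorise the double series.\<close>

lemma abs_u_le_tau:
  assumes z: "\<zeta> \<in> egg_domain m" and e: "\<eta> \<in> egg_closure m"
  defines "x \<equiv> norm (fst \<zeta>) * norm (fst \<eta>)"
  shows "x < 1" "norm (snd \<zeta>) * norm (snd \<eta>) * (1 - x) powr (- 1 / m) \<le> egg_tau \<zeta>"
proof -
  obtain a b c d where ab: "\<zeta> = (a, b)" and cd: "\<eta> = (c, d)"
    by fastforce
  have n: "norm a < 1" "norm c \<le> 1"
    using egg_domain_norm[OF m] egg_closure_norm[OF m] z e ab cd by auto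
  then have "norm a * norm c \<le> norm a * 1"
    by (intro mult_left_mono) auto
  then show x: "x < 1"
    using n by (simp add: x_def ab cd)
  have a2: "norm a ^ 2 < 1"
    using n by (simp add: power_less_one_iff)
  have pw: "((1 - x) powr (- 1 / m)) ^ (2 * m) = 1 / (1 - x) ^ 2"
  proof -
    have "((1 - x) powr (- 1 / m)) ^ (2 * m) = (1 - x) powr (- 1 / m * (2 * m))"
      using x by (subst powr_powr[symmetric]) (simp add: powr_realpow[symmetric])
    also have "- 1 / m * (2 * m) = - real 2"
      using m by simp
    finally show ?thesis
      using x by (simp add: powr_minus powr_realpow divide_inverse)
  qed
  have "(norm b * norm d * (1 - x) powr (- 1 / m)) ^ (2 * m) = norm b ^ (2 * m) * (norm d ^ (2 * m) / (1 - x) ^ 2)"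
    unfolding power_mult_distrib pw by simp
  also have "\<dots> \<le> norm b ^ (2 * m) * (1 / (1 - norm a ^ 2))"
  proof (rule mult_left_mono)
    have "norm d ^ (2 * m) * (1 - norm a ^ 2) \<le> (1 - norm c ^ 2) * (1 - norm a ^ 2)"
      using e cd a2 by (intro mult_right_mono) (auto simp: egg_closure_def)
    also have "\<dots> \<le> (1 - x) ^ 2"
      using zero_le_power2[of "norm a - norm c"] by (simp add: x_def ab cd power2_eq_square algebra_simps)
    finally show "norm d ^ (2 * m) / (1 - x) ^ 2 \<le> 1 / (1 - norm a ^ 2)"
      using a2 x by (simp add: field_simps)
  qed simp
  also have "\<dots> = egg_tau \<zeta> ^ (2 * m)"
    using m a2 by (simp add: egg_tau_def ab)
  finally show "norm (snd \<zeta>) * norm (snd \<eta>) * (1 - x) powr (- 1 / m) \<le> egg_tau \<zeta>"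
    using egg_tau(1)[OF z] m ab cd by (simp add: power_mono_iff)
qed

lemma fst_prod_less:
  assumes "\<zeta> \<in> egg_domain m" "\<eta> \<in> egg_closure m"
  shows "norm (fst \<zeta> * cnj (fst \<eta>)) < 1" "1 - fst \<zeta> * cnj (fst \<eta>) \<notin> \<real>\<^sub>\<le>\<^sub>0" "Re (1 - fst \<zeta> * cnj (fst \<eta>)) > 0"
proof -
  show n: "norm (fst \<zeta> * cnj (fst \<eta>)) < 1"
    using abs_u_le_tau(1)[OF assms] by (simp add: norm_mult)
  then show "Re (1 - fst \<zeta> * cnj (fst \<eta>)) > 0"
    using complex_Re_le_cmod[of "fst \<zeta> * cnj (fst \<eta>)"] by simp
  then show "1 - fst \<zeta> * cnj (fst \<eta>) \<notin> \<real>\<^sub>\<le>\<^sub>0"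
    by (auto simp: complex_nonpos_Reals_iff)
qed

lemma norm_u_le_tau:
  assumes "\<zeta> \<in> egg_domain m" "\<eta> \<in> egg_closure m"
  shows "norm (egg_u \<zeta> \<eta>) \<le> egg_tau \<zeta>" "norm (egg_u \<zeta> \<eta>) < 1"
proof -
  define x where "x = norm (fst \<zeta>) * norm (fst \<eta>)"
  have x: "x < 1"
    using abs_u_le_tau(1)[OF assms] by (simp add: x_def)
  have le: "1 - x \<le> norm (1 - fst \<zeta> * cnj (fst \<eta>))"
    using norm_triangle_ineq2[of 1 "fst \<zeta> * cnj (fst \<eta>)"] by (simp add: x_def norm_mult)
  have "norm (egg_u \<zeta> \<eta>) = norm (snd \<zeta>) * norm (snd \<eta>) * norm (1 - fst \<zeta> * cnj (fst \<eta>)) powr (- 1 / m)"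
    by (simp add: egg_u_def norm_mult norm_powr_real_powr')
  also have "\<dots> \<le> norm (snd \<zeta>) * norm (snd \<eta>) * (1 - x) powr (- 1 / m)"
    using le x by (intro mult_left_mono powr_mono2') auto
  also have "\<dots> \<le> egg_tau \<zeta>"
    using abs_u_le_tau(2)[OF assms] by (simp add: x_def)
  finally show "norm (egg_u \<zeta> \<eta>) \<le> egg_tau \<zeta>" .
  then show "norm (egg_u \<zeta> \<eta>) < 1"
    using egg_tau(2)[OF assms(1)] by simp
qed

definition kernel_term :: "C2 \<Rightarrow> C2 \<Rightarrow> nat \<times> nat \<Rightarrow> complex" where
  "kernel_term \<zeta> \<eta> = (\<lambda>(k, j). of_real (coef k j) * (fst \<zeta> * cnj (fst \<eta>)) ^ j * (snd \<zeta> * cnj (snd \<eta>)) ^ k)"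

definition kernel_bound :: "C2 \<Rightarrow> real" where
  "kernel_bound \<zeta> = (1 - norm (fst \<zeta>)) powr (- \<gamma>) * (\<Sum>k. Q k * egg_tau \<zeta> ^ k)"

text \<open>The sum over j is the binomial series with exponent \<gamma> + k/m, whose value splits
  into v^(-\<gamma>) and a factor that turns w cnj w' to the k into u^k; the sum over k is then
  \<open>gen\<close>. The same computation with moduli gives absolute convergence and a bound that
  is uniform over \<eta> in the closure.\<close>

lemma kernel_expansion:
  assumes z: "\<zeta> \<in> egg_domain m" and e: "\<eta> \<in> egg_closure m"
  shows "(kernel_term \<zeta> \<eta> has_sum K \<zeta> \<eta>) UNIV"
    and "finite F \<Longrightarrow> (\<Sum>i\<in>F. norm (kernel_term \<zeta> \<eta> i)) \<le> kernel_bound \<zeta>"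
proof -
  define X where "X = norm (fst \<zeta>) * norm (fst \<eta>)"
  define Y where "Y = norm (snd \<zeta>) * norm (snd \<eta>)"
  define U where "U = Y * (1 - X) powr (- 1 / m)"
  have X: "0 \<le> X" "X < 1" "X \<le> norm (fst \<zeta>)" "norm (fst \<zeta>) < 1"
    using abs_u_le_tau(1)[OF z e] egg_domain_norm[OF m, of "fst \<zeta>" "snd \<zeta>"] z
      egg_closure_norm[OF m, of "fst \<eta>" "snd \<eta>"] e
      mult_left_mono[of "norm (fst \<eta>)" 1 "norm (fst \<zeta>)"]
    by (auto simp: X_def)
  have U: "0 \<le> U" "U \<le> egg_tau \<zeta>" "U < 1"
    using abs_u_le_tau(2)[OF z e] egg_tau[OF z] by (auto simp: U_def X_def Y_def)
  have Y: "Y \<ge> 0"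
    by (simp add: Y_def)
  have norm_term: "norm (kernel_term \<zeta> \<eta> (k, j)) = coef k j * X ^ j * Y ^ k" for k j
    using coef_nonneg[of k j] by (simp add: kernel_term_def norm_mult norm_power X_def Y_def)
  have inner: "((\<lambda>j. coef k j * X ^ j * Y ^ k) has_sum ((1 - X) powr (- \<gamma>) * (Q k * U ^ k))) UNIV" for k
  proof -
    have "(\<lambda>j. Q k * Y ^ k * (pochhammer (\<gamma> + k / m) j / fact j * X ^ j)) sums
        (Q k * Y ^ k * (1 - X) powr (- (\<gamma> + k / m)))"
      using X by (intro sums_mult binomial_series_pochhammer_real) auto
    also have "(\<lambda>j. Q k * Y ^ k * (pochhammer (\<gamma> + k / m) j / fact j * X ^ j)) = (\<lambda>j. coef k j * X ^ j * Y ^ k)"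
      by (simp add: coef_def fun_eq_iff mult_ac)
    also have "Q k * Y ^ k * (1 - X) powr (- (\<gamma> + k / m)) = (1 - X) powr (- \<gamma>) * (Q k * U ^ k)"
    proof -
      have "(1 - X) powr (- (\<gamma> + k / m)) = (1 - X) powr (- \<gamma>) * ((1 - X) powr (- 1 / m)) ^ k"
        using X by (simp add: powr_realpow[symmetric] powr_powr powr_add[symmetric] add_divide_distrib)
      then show ?thesis
        by (simp add: U_def power_mult_distrib mult_ac)
    qed
    finally show ?thesis
      using coef_nonneg X Y by (intro sums_nonneg_imp_has_sum) (auto intro!: mult_nonneg_nonneg)
  qed
  have outer: "((\<lambda>k. (1 - X) powr (- \<gamma>) * (Q k * U ^ k)) has_sum ((1 - X) powr (- \<gamma>) * (\<Sum>k. Q k * U ^ k))) UNIV"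
    using U Q by (intro sums_nonneg_imp_has_sum sums_mult summable_sums summable_Q) auto
  have "(\<lambda>i. norm (kernel_term \<zeta> \<eta> i)) summable_on UNIV \<times> UNIV"
    using inner outer by (intro summable_on_SigmaI[where g = "\<lambda>k. (1 - X) powr (- \<gamma>) * (Q k * U ^ k)"])
      (auto simp: norm_term has_sum_imp_summable intro!: mult_nonneg_nonneg coef_nonneg zero_le_power X Y)
  then have summ: "(\<lambda>i. norm (kernel_term \<zeta> \<eta> i)) summable_on UNIV"
    by simp
  have tot: "((\<lambda>i. norm (kernel_term \<zeta> \<eta> i)) has_sum ((1 - X) powr (- \<gamma>) * (\<Sum>k. Q k * U ^ k))) (UNIV \<times> UNIV)"
    using inner outer summ by (intro has_sum_SigmaI) (auto simp: norm_term)
  show "(\<Sum>i\<in>F. norm (kernel_term \<zeta> \<eta> i)) \<le> kernel_bound \<zeta>" if "finite F"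
  proof -
    have "(\<Sum>i\<in>F. norm (kernel_term \<zeta> \<eta> i)) \<le> (1 - X) powr (- \<gamma>) * (\<Sum>k. Q k * U ^ k)"
      using tot that by (intro finite_sum_le_has_sum[where A = UNIV]) auto
    also have "\<dots> \<le> kernel_bound \<zeta>"
      unfolding kernel_bound_def
    proof (intro mult_mono suminf_le suminf_nonneg)
      show "(1 - X) powr (- \<gamma>) \<le> (1 - norm (fst \<zeta>)) powr (- \<gamma>)"
        using X gamma by (intro powr_mono2') auto
    qed (use U Q egg_tau[OF z] in \<open>auto intro!: summable_Q mult_left_mono power_mono\<close>)
    finally show ?thesis .
  qed
  define v where "v = 1 - fst \<zeta> * cnj (fst \<eta>)"
  have v0: "v \<noteq> 0"
    using fst_prod_less(2)[OF z e] by (auto simp: v_def)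
  have innerc: "((\<lambda>j. kernel_term \<zeta> \<eta> (k, j)) has_sum (v powr (- of_real \<gamma>) * (of_real (Q k) * egg_u \<zeta> \<eta> ^ k))) UNIV" for k
  proof (rule norm_summable_imp_has_sum)
    show "summable (\<lambda>j. norm (kernel_term \<zeta> \<eta> (k, j)))"
      unfolding norm_term by (rule summable_on_imp_summable[OF has_sum_imp_summable[OF inner]])
    have "(\<lambda>j. of_real (Q k) * (snd \<zeta> * cnj (snd \<eta>)) ^ k * (of_real (pochhammer (\<gamma> + k / m) j / fact j) * (fst \<zeta> * cnj (fst \<eta>)) ^ j)) sums
        (of_real (Q k) * (snd \<zeta> * cnj (snd \<eta>)) ^ k * v powr (- of_real (\<gamma> + k / m)))"
      unfolding v_def by (intro sums_mult binomial_series_pochhammer fst_prod_less z e)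
    also have "(\<lambda>j. of_real (Q k) * (snd \<zeta> * cnj (snd \<eta>)) ^ k * (of_real (pochhammer (\<gamma> + k / m) j / fact j) * (fst \<zeta> * cnj (fst \<eta>)) ^ j))
       = (\<lambda>j. kernel_term \<zeta> \<eta> (k, j))"
      by (simp add: kernel_term_def coef_def fun_eq_iff mult_ac)
    also have "of_real (Q k) * (snd \<zeta> * cnj (snd \<eta>)) ^ k * v powr (- of_real (\<gamma> + k / m))
        = v powr (- of_real \<gamma>) * (of_real (Q k) * egg_u \<zeta> \<eta> ^ k)"
    proof -
      \<comment> \<open>The splitting is safe for the principal branch: all powers are exponentials
        of multiples of one logarithm.\<close>
      have "v powr (- of_real (\<gamma> + k / m)) = v powr (- of_real \<gamma>) * (v powr (- of_real (1 / m))) ^ k"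
        using v0 by (simp add: powr_def exp_of_nat_mult[symmetric] exp_add[symmetric] algebra_simps)
      then show ?thesis
        by (simp add: egg_u_def v_def power_mult_distrib mult_ac)
    qed
    finally show "(\<lambda>j. kernel_term \<zeta> \<eta> (k, j)) sums (v powr (- of_real \<gamma>) * (of_real (Q k) * egg_u \<zeta> \<eta> ^ k))" .
  qed
  have "((\<lambda>k. of_real (Q k) * egg_u \<zeta> \<eta> ^ k) has_sum gen (egg_u \<zeta> \<eta>)) UNIV"
    using norm_u_le_tau(2)[OF z e] by (intro norm_summable_imp_has_sum gen_summable_norm gen_sums)
  then have outerc: "((\<lambda>k. v powr (- of_real \<gamma>) * (of_real (Q k) * egg_u \<zeta> \<eta> ^ k)) has_sum K \<zeta> \<eta>) UNIV"
    unfolding K_eq v_def by (rule has_sum_cmult_right)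
  have "(kernel_term \<zeta> \<eta> has_sum K \<zeta> \<eta>) (UNIV \<times> UNIV)"
    using innerc outerc summ by (intro has_sum_SigmaI) (auto intro: Infinite_Sum.abs_summable_summable)
  then show "(kernel_term \<zeta> \<eta> has_sum K \<zeta> \<eta>) UNIV"
    by simp
qed

lemma norm_K_le:
  assumes "\<zeta> \<in> egg_domain m" "\<eta> \<in> egg_closure m"
  shows "norm (K \<zeta> \<eta>) \<le> kernel_bound \<zeta>"
proof -
  have summ: "(\<lambda>i. norm (kernel_term \<zeta> \<eta> i)) summable_on UNIV"
    using kernel_expansion(2)[OF assms]
    by (intro nonneg_bdd_above_summable_on) (auto intro!: bdd_aboveI2)
  have "norm (K \<zeta> \<eta>) = norm (\<Sum>\<^sub>\<infinity>i. kernel_term \<zeta> \<eta> i)"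
    using kernel_expansion(1)[OF assms] by (simp add: infsumI)
  also have "\<dots> \<le> (\<Sum>\<^sub>\<infinity>i. norm (kernel_term \<zeta> \<eta> i))"
    using summ by (rule norm_infsum_bound)
  also have "\<dots> \<le> kernel_bound \<zeta>"
    using kernel_expansion(2)[OF assms] summ by (intro infsum_le_finite_sums) auto
  finally show ?thesis .
qed

text \<open>Conjugation passes through the powers because their base avoids the nonpositive reals.
  In this form no conjugate of \<eta> is left, so holomorphy in \<eta> can be read off.\<close>

lemma cnj_K:
  assumes "\<zeta> \<in> egg_domain m" "\<eta> \<in> egg_closure m"
  shows "cnj (K \<zeta> \<eta>) = (1 - cnj (fst \<zeta>) * fst \<eta>) powr (- of_real \<gamma>) *
    gen (cnj (snd \<zeta>) * snd \<eta> * (1 - cnj (fst \<zeta>) * fst \<eta>) powr (- of_real (1 / real m)))"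
  using fst_prod_less[OF assms] norm_u_le_tau(2)[OF assms]
  unfolding K_eq by (simp add: cnj_gen egg_u_def cnj_powr)

lemma cnj_K_holomorphic:
  assumes z: "\<zeta> \<in> egg_domain m"
  shows "holomorphic2_on (\<lambda>\<eta>. cnj (K \<zeta> \<eta>)) (egg_domain m)"
proof -
  define V where "V = ball (0 :: complex) 1"
  have sub: "\<eta> \<in> egg_closure m" if "\<eta> \<in> egg_domain m" for \<eta>
    using egg_domain_subset_closure that by auto
  have V: "cnj (fst \<zeta>) * fst \<eta> \<in> V" if "\<eta> \<in> egg_domain m" for \<eta>
    using fst_prod_less(1)[OF z sub[OF that]] by (simp add: V_def norm_mult)
  have pos: "1 - x \<notin> \<real>\<^sub>\<le>\<^sub>0" if "x \<in> V" for x
  proof -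
    have "Re x < 1"
      using that complex_Re_le_cmod[of x] by (simp add: V_def)
    then show ?thesis
      by (simp add: complex_nonpos_Reals_iff)
  qed
  have p: "holomorphic2_on (\<lambda>\<eta>. (1 - cnj (fst \<zeta>) * fst \<eta>) powr c) (egg_domain m)" for c
    using V pos
    by (intro holomorphic2_on_compose[where f = "\<lambda>\<eta>. cnj (fst \<zeta>) * fst \<eta>" and g = "\<lambda>x. (1 - x) powr c" and V = V]
        holomorphic2_on_cmult holomorphic2_on_fst holomorphic_intros) (auto simp: V_def)
  define k where "k = (\<lambda>\<eta>. (1 - cnj (fst \<zeta>) * fst \<eta>) powr (- of_real \<gamma>) *
    gen (cnj (snd \<zeta>) * snd \<eta> * (1 - cnj (fst \<zeta>) * fst \<eta>) powr (- of_real (1 / real m))))"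
  have "norm (cnj (snd \<zeta>) * snd \<eta> * (1 - cnj (fst \<zeta>) * fst \<eta>) powr (- of_real (1 / real m))) < 1"
    if "\<eta> \<in> egg_domain m" for \<eta>
  proof -
    have "cnj (egg_u \<zeta> \<eta>) = cnj (snd \<zeta>) * snd \<eta> * (1 - cnj (fst \<zeta>) * fst \<eta>) powr (- of_real (1 / real m))"
      using fst_prod_less[OF z sub[OF that]] by (simp add: egg_u_def cnj_powr)
    then show ?thesis
      using norm_u_le_tau(2)[OF z sub[OF that]] by (metis complex_mod_cnj)
  qed
  then have "holomorphic2_on k (egg_domain m)"
    unfolding k_def
    by (intro holomorphic2_on_mult p holomorphic2_on_compose[OF _ gen_holomorphic] holomorphic2_on_cmult holomorphic2_on_snd)
       auto
  moreover have "((\<lambda>\<eta>. cnj (K \<zeta> \<eta>)) has_derivative d) (at \<eta>)"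
    if "\<eta> \<in> egg_domain m" "(k has_derivative d) (at \<eta>)" for \<eta> d
    by (rule has_derivative_transform_within_open[OF that(2) open_egg_domain that(1)])
       (use z sub in \<open>simp add: cnj_K k_def\<close>)
  ultimately show ?thesis
    unfolding holomorphic2_on_def by blast
qed

text \<open>On the closure the base keeps positive real part and |u| stays below 1. This provides
  the boundary values of the kernel.\<close>

lemma K_continuous:
  assumes z: "\<zeta> \<in> egg_domain m"
  shows "continuous_on (egg_closure m) (K \<zeta>)"
proof -
  have c: "continuous_on (egg_closure m) (\<lambda>\<eta>. (1 - fst \<zeta> * cnj (fst \<eta>)) powr c)" for c
  proof (intro continuous_intros)
    show "egg_closure m \<subseteq> {\<eta>. 0 \<le> Re (1 - fst \<zeta> * cnj (fst \<eta>)) \<or> Im (1 - fst \<zeta> * cnj (fst \<eta>)) \<noteq> 0}"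
      using fst_prod_less(3)[OF z] less_imp_le by blast
    show "0 < Re c" if "\<eta> \<in> egg_closure m" "1 - fst \<zeta> * cnj (fst \<eta>) = 0" for \<eta>
      using fst_prod_less(3)[OF z that(1)] that(2) by simp
  qed
  have g: "continuous_on (ball 0 1) gen"
    using gen_holomorphic holomorphic_on_imp_continuous_on by blast
  have "continuous_on (egg_closure m) (egg_u \<zeta>)"
    unfolding egg_u_def by (intro continuous_intros c)
  then have "continuous_on (egg_closure m) (\<lambda>\<eta>. gen (egg_u \<zeta> \<eta>))"
    using norm_u_le_tau(2)[OF z] by (intro continuous_on_compose2[OF g]) auto
  then show ?thesis
    unfolding K_eq by (intro continuous_intros c)
qed

text \<open>The kernel series is dominated uniformly on the closure, so it is integrated term by
  term, and the moments turn it into the power series of f. Both kernels are covered: M is Lebesgue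
  measure on the domain with F = f, or the Fefferman measure with F a boundary function, and X is
  the inclusion.\<close>

theorem reproducing:
  fixes F :: "'a \<Rightarrow> complex"
  assumes z: "(z, w) \<in> egg_domain m"
    and X: "X \<in> borel_measurable M" "\<And>p. p \<in> space M \<Longrightarrow> X p \<in> egg_closure m"
    and F: "integrable M F"
    and moments: "\<And>k j. of_real (coef k j) * (\<integral>p. cnj (fst (X p) ^ j * snd (X p) ^ k) * F p \<partial>M) = a k j"
    and series: "((\<lambda>(k, j). a k j * z ^ j * w ^ k) has_sum f) UNIV"
  shows "(\<integral>p. K (z, w) (X p) * F p \<partial>M) = f"
proof -
  note [measurable] = X(1)
  have [measurable]: "(\<lambda>p. fst (X p)) \<in> borel_measurable M" "(\<lambda>p. snd (X p)) \<in> borel_measurable M"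
    by (auto intro!: measurable_compose[OF X(1)] borel_measurable_continuous_onI
        continuous_on_fst[OF continuous_on_id] continuous_on_snd[OF continuous_on_id])
  have [measurable]: "cnj \<in> borel_measurable borel"
    by (intro borel_measurable_continuous_onI continuous_intros)
  have [measurable]: "F \<in> borel_measurable M"
    using F by simp
  have "((\<lambda>i. \<integral>p. kernel_term (z, w) (X p) i * F p \<partial>M) has_sum (\<integral>p. K (z, w) (X p) * F p \<partial>M)) UNIV"
  proof (rule has_sum_integral_dominated[where h = prod_decode and w = "\<lambda>p. kernel_bound (z, w) * norm (F p)"])
    show "bij prod_decode"
      by (rule bij_prod_decode)
    show "(\<lambda>p. kernel_term (z, w) (X p) i * F p) \<in> borel_measurable M" for i
      by (cases i) (simp add: kernel_term_def)
    show "integrable M (\<lambda>p. kernel_bound (z, w) * norm (F p))"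
      using F by simp
    fix p and G :: "(nat \<times> nat) set" assume p: "p \<in> space M"
    {
      assume "finite G"
      have "(\<Sum>i\<in>G. norm (kernel_term (z, w) (X p) i * F p)) = (\<Sum>i\<in>G. norm (kernel_term (z, w) (X p) i)) * norm (F p)"
        by (simp add: norm_mult sum_distrib_right)
      also have "\<dots> \<le> kernel_bound (z, w) * norm (F p)"
        using kernel_expansion(2)[OF z X(2)[OF p] \<open>finite G\<close>] by (intro mult_right_mono) auto
      finally show "(\<Sum>i\<in>G. norm (kernel_term (z, w) (X p) i * F p)) \<le> kernel_bound (z, w) * norm (F p)" .
    }
    show "((\<lambda>i. kernel_term (z, w) (X p) i * F p) has_sum K (z, w) (X p) * F p) UNIV"
      by (intro has_sum_cmult_left kernel_expansion z X p)
  qed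
  moreover have "(\<integral>p. kernel_term (z, w) (X p) i * F p \<partial>M) = (case i of (k, j) \<Rightarrow> a k j * z ^ j * w ^ k)" for i
  proof (cases i)
    case (Pair k j)
    have "(\<integral>p. kernel_term (z, w) (X p) i * F p \<partial>M) =
        (\<integral>p. (of_real (coef k j) * z ^ j * w ^ k) * (cnj (fst (X p) ^ j * snd (X p) ^ k) * F p) \<partial>M)"
      by (intro Bochner_Integration.integral_cong) (auto simp: kernel_term_def Pair power_mult_distrib)
    also have "\<dots> = (of_real (coef k j) * z ^ j * w ^ k) * (\<integral>p. cnj (fst (X p) ^ j * snd (X p) ^ k) * F p \<partial>M)"
      by (rule integral_mult_right_zero)
    also have "\<dots> = a k j * z ^ j * w ^ k"
      unfolding moments[symmetric] by (simp only: mult_ac)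
    finally show ?thesis
      by (simp add: Pair)
  qed
  ultimately show ?thesis
    using series by (simp add: has_sum_unique)
qed

end

section \<open>Moments\<close>

text \<open>The Beta value (1/m) B(p/m, j + 1).\<close>

definition radial_moment :: "nat \<Rightarrow> real \<Rightarrow> nat \<Rightarrow> real" where
  "radial_moment m p j = fact j / (real m * pochhammer (p / real m) (Suc j))"

text \<open>Splitting off one factor 1 - s^m relates j + 1 at p to j at p and at p + m, so the
  induction runs over all p. In b = p/m the shift by m is a shift by 1, which the Pochhammer symbols
  absorb.\<close>

lemma has_integral_radial_moment:
  assumes m: "m \<ge> 1" and p: "p > 0"
  shows "((\<lambda>s. s powr (p - 1) * (1 - s ^ m) ^ j) has_integral radial_moment m p j) {0..1}"
  using p
proof (induction j arbitrary: p)
  case 0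
  then show ?case
    using has_integral_powr_from_0[of "p - 1" 1] m by (simp add: radial_moment_def)
next
  case (Suc j)
  define b where "b = p / m"
  have b: "b > 0"
    using Suc.prems m by (simp add: b_def)
  have "((\<lambda>s. s powr (p - 1) * (1 - s ^ m) ^ j - s powr (p + m - 1) * (1 - s ^ m) ^ j) has_integral
      (radial_moment m p j - radial_moment m (p + m) j)) {0..1}"
    using Suc.prems by (intro has_integral_diff Suc.IH) auto
  also have "radial_moment m p j - radial_moment m (p + m) j = radial_moment m p (Suc j)"
  proof -
    have b1: "(p + m) / m = b + 1"
      using m by (simp add: b_def add_divide_distrib)
    define P where "P = pochhammer (b + 1) j"
    have P: "P > 0"
      using b by (simp add: P_def pochhammer_pos)
    define c where "c = b + 1 + j"
    have c: "c > 0" "fact (Suc j) = (c - b) * fact j"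
      using b by (simp_all add: c_def)
    have e: "pochhammer b (Suc j) = b * P" "pochhammer (b + 1) (Suc j) = c * P"
      "pochhammer b (Suc (Suc j)) = b * c * P"
      using pochhammer_rec[of b j] pochhammer_rec[of b "Suc j"] pochhammer_Suc[of "b + 1" j]
      by (simp_all add: P_def c_def mult_ac)
    show ?thesis
      unfolding radial_moment_def b1 unfolding b_def[symmetric] e c(2) using P b m c(1)
      by (simp add: divide_simps) (simp add: algebra_simps)
  qed
  finally show ?case
  proof (rule has_integral_eq[rotated])
    fix s :: real assume "s \<in> {0..1}"
    then have "s powr (p + m - 1) = s powr (p - 1) * s ^ m"
      by (cases "s = 0") (auto simp: powr_realpow[symmetric] powr_add[symmetric] algebra_simps)
    then show "s powr (p - 1) * (1 - s ^ m) ^ j - s powr (p + m - 1) * (1 - s ^ m) ^ j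
        = s powr (p - 1) * (1 - s ^ m) ^ Suc j"
      by (simp add: algebra_simps)
  qed
qed

text \<open>The origin is excluded since \<open>0 powr (p - 1) = 0\<close> also for \<open>p = 1\<close>.\<close>

lemma complex_radial_moment:
  fixes p :: real and j :: nat
  assumes m: "m \<ge> 1" and p: "p > 0"
  defines "h \<equiv> \<lambda>t. indicator {0<..<1} t * (t powr (p - 1) * (1 - t ^ m) ^ j)"
  shows "integrable lborel (\<lambda>w::complex. h (norm w ^ 2))"
    and "(\<integral>w. h (norm (w::complex) ^ 2) \<partial>lborel) = pi * radial_moment m p j"
proof -
  have [measurable]: "h \<in> borel_measurable borel"
    unfolding h_def by measurable
  have pos: "0 \<le> h t" for t
    by (auto simp: h_def indicator_def power_le_one)
  have "((\<lambda>s. s powr (p - 1) * (1 - s ^ m) ^ j) has_integral radial_moment m p j) {0<..<1}"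
    using has_integral_radial_moment[OF m p, of j] by (simp add: has_integral_Icc_iff_Ioo)
  then have "(\<integral>\<^sup>+t. ennreal (indicator {0<..<1} t * (t powr (p - 1) * (1 - t ^ m) ^ j)) \<partial>lborel) = ennreal (radial_moment m p j)"
    by (rule nn_integral_has_integral_lebesgue[rotated]) (auto simp: power_le_one)
  then have nn: "(\<integral>\<^sup>+t. ennreal (h t) \<partial>lborel) = ennreal (radial_moment m p j)"
    by (simp add: h_def)
  have rm: "radial_moment m p j \<ge> 0"
    using p m by (simp add: radial_moment_def pochhammer_nonneg)
  have int: "integrable lborel h"
    using nn pos by (intro integrableI_nonneg) auto
  have h: "indicator {0..} t *\<^sub>R h t = h t" for t
    by (auto simp: h_def indicator_def)
  show "integrable lborel (\<lambda>w::complex. h (norm w ^ 2))"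
    by (subst integrable_complex_radial_iff) (simp_all add: set_integrable_def h int del: real_scaleR_def)
  have "(\<integral>w. h (norm (w::complex) ^ 2) \<partial>lborel) = pi * (\<integral>t. h t \<partial>lborel)"
    by (subst integral_complex_radial) (simp_all add: set_lebesgue_integral_def h[unfolded real_scaleR_def])
  also have "(\<integral>t. h t \<partial>lborel) = radial_moment m p j"
    using nn pos rm by (subst integral_eq_nn_integral) auto
  finally show "(\<integral>w. h (norm (w::complex) ^ 2) \<partial>lborel) = pi * radial_moment m p j" .
qed

lemma AE_complex_nonzero: "AE w in lborel. w \<noteq> (0 :: complex)"
  by (rule AE_lborel_singleton)

lemma disc_moment:
  fixes c :: real
  assumes c: "c \<ge> 0"
  shows "(\<integral>z. indicator {z. norm z ^ 2 < c} (z :: complex) * norm z ^ (2 * j) \<partial>lborel) = pi * c ^ Suc j / Suc j"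
proof -
  define h where "h = (\<lambda>t. indicator {0..<c} t * t ^ j :: real)"
  have [measurable]: "h \<in> borel_measurable borel"
    unfolding h_def by measurable
  have "(\<integral>z. indicator {z. norm z ^ 2 < c} (z :: complex) * norm z ^ (2 * j) \<partial>lborel) = (\<integral>z. h (norm (z :: complex) ^ 2) \<partial>lborel)"
    by (intro Bochner_Integration.integral_cong) (auto simp: h_def indicator_def power_mult)
  also have "\<dots> = pi * (LINT t:{0..}|lborel. h t)"
    by (subst integral_complex_radial) simp_all
  also have "(LINT t:{0..}|lborel. h t) = (LINT t:{0..<c}|lborel. t ^ j)"
    unfolding set_lebesgue_integral_def
    by (intro Bochner_Integration.integral_cong) (auto simp: h_def indicator_def)
  also have "\<dots> = (LINT t:{0..c}|lborel. t ^ j)"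
    unfolding set_lebesgue_integral_def using AE_lborel_singleton[of c]
    by (intro integral_cong_AE) (auto simp: indicator_def elim!: eventually_mono)
  also have "\<dots> = c ^ Suc j / Suc j"
  proof -
    have "((\<lambda>t. t ^ j) has_integral (c ^ Suc j / Suc j - 0 ^ Suc j / Suc j)) {0..c}"
      using c
      by (intro fundamental_theorem_of_calculus)
         (auto intro!: derivative_eq_intros simp flip: has_real_derivative_iff_has_vector_derivative simp del: power_Suc)
    moreover have "set_integrable lborel {0..c} (\<lambda>t. t ^ j)"
      by (intro borel_integrable_atLeastAtMost' continuous_intros)
    ultimately show ?thesis
      by (simp add: set_borel_integral_eq_integral integral_unique)
  qed
  finally show ?thesis
    by simp
qed

lemma emeasure_egg_domain_finite:
  assumes "m \<ge> 1"
  shows "emeasure lborel (egg_domain m) < \<infinity>"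
proof -
  have "emeasure lborel (egg_domain m) \<le> emeasure lborel (egg_closure m)"
    using egg_domain_subset_closure closed_egg_closure
    by (intro emeasure_mono) (auto intro: borel_closed)
  also have "\<dots> < \<infinity>"
    by (intro emeasure_compact_finite compact_egg_closure assms)
  finally show ?thesis .
qed

lemma set_integrable_egg_domain:
  fixes f :: "C2 \<Rightarrow> 'a::{banach, second_countable_topology}"
  assumes m: "m \<ge> 1" and f: "continuous_on (egg_domain m) f"
    and g: "set_integrable lborel (egg_domain m) g" "\<And>p. p \<in> egg_domain m \<Longrightarrow> norm (f p) \<le> (g p :: real)"
  shows "set_integrable lborel (egg_domain m) f"
  unfolding set_integrable_def
proof (rule Bochner_Integration.integrable_bound[OF g(1)[unfolded set_integrable_def]])
  show "(\<lambda>p. indicator (egg_domain m) p *\<^sub>R f p) \<in> borel_measurable lborel"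
    using f open_egg_domain[of m] by (simp add: borel_measurable_continuous_on_indicator borel_open)
  show "AE p in lborel. norm (indicator (egg_domain m) p *\<^sub>R f p) \<le> norm (indicator (egg_domain m) p *\<^sub>R g p)"
  proof (rule AE_I2)
    fix p
    show "norm (indicator (egg_domain m) p *\<^sub>R f p) \<le> norm (indicator (egg_domain m) p *\<^sub>R g p)"
      using g(2)[of p] by (auto simp: indicator_def)
  qed
qed

lemma set_integrable_egg_domain_const: "m \<ge> 1 \<Longrightarrow> set_integrable lborel (egg_domain m) (\<lambda>_. c :: real)"
  using emeasure_egg_domain_finite[of m] open_egg_domain[of m]
  by (simp add: set_integrable_def borel_open)

text \<open>The z-integral over the disc |z|^2 < 1 - |w|^(2m) leaves pi (1 - |w|^(2m))^(j+1) /
  (j+1); in t = |w|^2 the rest is the radial moment with p = k + 1, and with j + 1 in place of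
  j.\<close>

lemma egg_moment:
  assumes m: "m \<ge> 1"
  shows "(LINT p:egg_domain m|lborel. norm (fst p) ^ (2 * j) * norm (snd p) ^ (2 * k))
    = pi ^ 2 / Suc j * radial_moment m (Suc k) (Suc j)"
proof -
  define f where "f = (\<lambda>(z, w :: complex). indicator (egg_domain m) (z, w) * (norm z ^ (2 * j) * norm w ^ (2 * k)) :: real)"
  define h where "h = (\<lambda>t. indicator {0<..<1} t * (t powr (real (Suc k) - 1) * (1 - t ^ m) ^ Suc j) :: real)"
  have "set_integrable lborel (egg_domain m) (\<lambda>p. norm (fst p) ^ (2 * j) * norm (snd p) ^ (2 * k))"
  proof (rule set_integrable_egg_domain[OF m _ set_integrable_egg_domain_const[OF m, of 1]])
    fix p assume "p \<in> egg_domain m"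
    then show "norm (norm (fst p) ^ (2 * j) * norm (snd p) ^ (2 * k)) \<le> 1"
      using egg_domain_norm[OF m, of "fst p" "snd p"] by (auto simp: abs_mult intro!: mult_le_one power_le_one)
  qed (intro continuous_intros)
  then have int: "integrable (lborel \<Otimes>\<^sub>M lborel) f"
    by (simp add: lborel_prod set_integrable_def f_def case_prod_unfold)
  then have int': "integrable (lborel \<Otimes>\<^sub>M lborel) (\<lambda>(z, w). f (z, w))"
    by simp
  have "(LINT p:egg_domain m|lborel. norm (fst p) ^ (2 * j) * norm (snd p) ^ (2 * k)) = integral\<^sup>L (lborel \<Otimes>\<^sub>M lborel) f"
    by (simp add: lborel_prod set_lebesgue_integral_def f_def case_prod_unfold)
  also have "\<dots> = (\<integral>w. (\<integral>z. f (z, w) \<partial>lborel) \<partial>lborel)"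
    using lborel_pair.integral_snd[OF int'] by simp
  also have "\<dots> = (\<integral>w. pi / Suc j * h (norm (w :: complex) ^ 2) \<partial>lborel)"
  proof (rule integral_cong_AE)
    show "(\<lambda>w. \<integral>z. f (z, w) \<partial>lborel) \<in> borel_measurable lborel"
      using lborel_pair.integrable_snd[OF int'] by simp
    show "(\<lambda>w. pi / Suc j * h (norm (w :: complex) ^ 2)) \<in> borel_measurable lborel"
      unfolding h_def by measurable
    show "AE w in lborel. (\<integral>z. f (z, w) \<partial>lborel) = pi / Suc j * h (norm w ^ 2)"
      using AE_complex_nonzero
    proof eventually_elim
      case (elim w)
      show ?case
      proof (cases "norm w < 1")
        case True
        then have c: "norm w ^ (2 * m) \<le> 1" "norm w ^ 2 < 1"
          by (simp_all add: power_le_one power_less_one_iff)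
        have "(\<integral>z. f (z, w) \<partial>lborel) = (\<integral>z. norm w ^ (2 * k) * (indicator {z. norm z ^ 2 < 1 - norm w ^ (2 * m)} (z :: complex) * norm z ^ (2 * j)) \<partial>lborel)"
          by (intro Bochner_Integration.integral_cong) (auto simp: f_def indicator_def egg_domain_def)
        also have "\<dots> = norm w ^ (2 * k) * (pi * (1 - norm w ^ (2 * m)) ^ Suc j / Suc j)"
          using c by (subst integral_mult_right_zero, subst disc_moment) auto
        also have "\<dots> = pi / Suc j * h (norm w ^ 2)"
          using elim c by (simp add: h_def powr_realpow mult_ac flip: power_mult)
        finally show ?thesis .
      next
        case False
        then have "f (z, w) = 0" for z
          using egg_domain_norm(2)[OF m, of z w] by (auto simp: f_def indicator_def)
        moreover have "h (norm w ^ 2) = 0"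
          using False by (auto simp: h_def indicator_def power_less_one_iff)
        ultimately show ?thesis
          by simp
      qed
    qed
  qed
  also have "\<dots> = pi / Suc j * (pi * radial_moment m (Suc k) (Suc j))"
    unfolding h_def using complex_radial_moment(2)[OF m, of "Suc k" "Suc j"] by (subst integral_mult_right_zero) simp
  finally show ?thesis
    by (simp add: power2_eq_square)
qed

text \<open>Lebesgue measure and D are invariant under the torus, so the integrand may be replaced
  by its torus average, which at (z, w) is a |z|^(2j) |w|^(2k).\<close>

lemma (in reinhardt_domain) moment_torus_mean:
  assumes f: "continuous_on D f"
    and mean: "\<And>z w. (z, w) \<in> D \<Longrightarrow> torus_mean f j k z w = a * z ^ j * w ^ k"
    and int: "set_integrable lborel D (\<lambda>p. cnj (fst p ^ j * snd p ^ k) * f p)"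
  shows "(LINT p:D|lborel. cnj (fst p ^ j * snd p ^ k) * f p)
    = a * of_real (LINT p:D|lborel. norm (fst p) ^ (2 * j) * norm (snd p) ^ (2 * k))"
proof -
  let ?A = "angle_measure \<Otimes>\<^sub>M angle_measure"
  interpret pair_sigma_finite angle_measure angle_measure
    by (intro pair_sigma_finite.intro) unfold_locales
  have one: "emeasure ?A (space ?A) = 1"
    using angle_measure.emeasure_pair_measure_Times[of UNIV angle_measure UNIV]
    by (simp add: emeasure_angle_measure space_pair_measure)
  interpret P: finite_measure ?A
    by standard (simp add: one)
  define F where "F = (\<lambda>p. indicator D p *\<^sub>R (cnj (fst p ^ j * snd p ^ k) * f p))"
  define T where "T = (\<lambda>(s, t) (z, w). (cis s * z, cis t * w) :: C2)"
  have [measurable]: "D \<in> sets borel"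
    using open_D by auto
  have "(LINT p:D|lborel. cnj (fst p ^ j * snd p ^ k) * f p) = (\<integral>p. F p \<partial>lborel)"
    by (simp add: set_lebesgue_integral_def F_def)
  also have "\<dots> = (\<integral>p. (\<integral>c. F (T c p) \<partial>?A) \<partial>lborel)"
  proof (rule integral_average)
    show "sigma_finite_measure (lborel :: C2 measure)"
      by (rule sigma_finite_lborel)
    show "finite_measure ?A"
      by unfold_locales
    show "measure ?A (space ?A) = 1"
      using one by (simp add: measure_def)
    show "integrable lborel F"
      using int by (simp add: F_def set_integrable_def)
    show "case_prod T \<in> ?A \<Otimes>\<^sub>M lborel \<rightarrow>\<^sub>M lborel"
    proof -
      have "continuous_on UNIV (\<lambda>x :: (real \<times> real) \<times> C2. (cis (fst (fst x)) * fst (snd x), cis (snd (fst x)) * snd (snd x)))"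
        by (intro continuous_intros)
      then have "(\<lambda>x :: (real \<times> real) \<times> C2. (cis (fst (fst x)) * fst (snd x), cis (snd (fst x)) * snd (snd x)))
          \<in> borel_measurable ((borel \<Otimes>\<^sub>M borel) \<Otimes>\<^sub>M borel)"
        by (simp add: borel_prod borel_measurable_continuous_onI)
      also have "(\<lambda>x :: (real \<times> real) \<times> C2. (cis (fst (fst x)) * fst (snd x), cis (snd (fst x)) * snd (snd x))) = case_prod T"
        by (auto simp: T_def fun_eq_iff)
      finally have "case_prod T \<in> borel_measurable ((borel \<Otimes>\<^sub>M borel) \<Otimes>\<^sub>M borel)" .
      moreover have "sets (?A \<Otimes>\<^sub>M (lborel :: C2 measure)) = sets ((borel \<Otimes>\<^sub>M borel) \<Otimes>\<^sub>M borel)"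
        by (intro sets_pair_measure_cong) auto
      ultimately show ?thesis
        using measurable_cong_sets[OF _ sets_lborel] by blast
    qed
    show "distr lborel lborel (T c) = lborel" for c
      using lborel_rotate(2)[of "fst c" "snd c"] by (simp add: T_def case_prod_unfold cong: distr_cong)
  qed
  also have "\<dots> = (\<integral>p. a * of_real (indicator D p * (norm (fst p) ^ (2 * j) * norm (snd p) ^ (2 * k))) \<partial>lborel)"
  proof (rule Bochner_Integration.integral_cong)
    fix p :: C2
    obtain z w where p: "p = (z, w)"
      by fastforce
    have rot: "(cis s * z, cis t * w) \<in> D \<longleftrightarrow> (z, w) \<in> D" for s t
      using complete_D[of z w "cis s * z" "cis t * w"] complete_D[of "cis s * z" "cis t * w" z w]
      by (auto simp: norm_mult)
    show "(\<integral>c. F (T c p) \<partial>?A)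
        = a * of_real (indicator D p * (norm (fst p) ^ (2 * j) * norm (snd p) ^ (2 * k)))"
    proof (cases "(z, w) \<in> D")
      case True
      define G where "G = (\<lambda>s t. f (cis s * z, cis t * w) * cis (- (real j * s)) * cis (- (real k * t)))"
      note [measurable] = torus_measurable[OF f True]
      obtain B where B: "\<And>z' w'. norm z' \<le> norm z \<Longrightarrow> norm w' \<le> norm w \<Longrightarrow> norm (f (z', w')) \<le> B"
        using torus_bound[OF f True] by blast
      have int: "integrable ?A (\<lambda>(s, t). G s t)"
        unfolding G_def
        by (rule P.integrable_const_bound[where B = B]) (auto simp: norm_mult intro!: B AE_I2)
      \<comment> \<open>The conjugate monomial rotates by exactly the characters that define the
        torus mean.\<close>
      have "F (T (s, t) p) = cnj (z ^ j * w ^ k) * G s t" for s t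
        using True rot[of s t]
        by (simp add: F_def T_def p G_def power_mult_distrib Complex.DeMoivre cis_cnj)
      then have "(\<integral>c. F (T c p) \<partial>?A)
          = (\<integral>c. cnj (z ^ j * w ^ k) * (case c of (s, t) \<Rightarrow> G s t) \<partial>?A)"
        by (intro Bochner_Integration.integral_cong) auto
      also have "\<dots> = cnj (z ^ j * w ^ k) * (\<integral>c. (case c of (s, t) \<Rightarrow> G s t) \<partial>?A)"
        by (rule integral_mult_right_zero)
      also have "(\<integral>c. (case c of (s, t) \<Rightarrow> G s t) \<partial>?A)
          = (\<integral>t. (\<integral>s. G s t \<partial>angle_measure) \<partial>angle_measure)"
        using integral_snd[OF int] by simp
      also have "\<dots> = torus_mean f j k z w"
        by (simp add: G_def torus_mean_def)
      also have "\<dots> = a * z ^ j * w ^ k"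
        by (rule mean[OF True])
      also have "cnj (z ^ j * w ^ k) * (a * z ^ j * w ^ k) = a * ((z * cnj z) ^ j * (w * cnj w) ^ k)"
        by (simp add: power_mult_distrib mult_ac)
      also have "\<dots> = a * of_real (indicator D p * (norm (fst p) ^ (2 * j) * norm (snd p) ^ (2 * k)))"
        using True by (simp add: p power_mult flip: complex_norm_square)
      finally show ?thesis .
    next
      case False
      then show ?thesis
        using rot by (auto simp: F_def T_def p case_prod_unfold)
    qed
  qed simp
  also have "\<dots> = a * of_real (LINT p:D|lborel. norm (fst p) ^ (2 * j) * norm (snd p) ^ (2 * k))"
    by (subst integral_mult_right_zero) (simp add: set_lebesgue_integral_def flip: integral_complex_of_real)
  finally show ?thesis .
qed

section \<open>The Bergman kernel\<close>

text \<open>With b = (k + 1)/m this is m b (b + 1) / pi^2: what is left of the reciprocal squared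
  norm when (b + 2)_j / j! is split off.\<close>

definition bergman_weight :: "nat \<Rightarrow> nat \<Rightarrow> real" where
  "bergman_weight m k = (real k + 1) * (real k + 1 + real m) / (real m * pi ^ 2)"

definition egg_ratio :: "nat \<Rightarrow> C2 \<Rightarrow> real" where
  "egg_ratio m p = norm (snd p) ^ 2 * (1 - norm (fst p) ^ 2) powr (- 1 / real m)"

lemma pochhammer_3_div_fact: "pochhammer 3 k / fact k = (real k + 1) * (real k + 2) / 2"
proof -
  have "pochhammer 3 k = (fact (Suc (Suc k)) :: real) / 2"
    by (induction k) (simp_all add: pochhammer_Suc algebra_simps)
  then show ?thesis
    by (simp add: field_simps)
qed

text \<open>Coefficients of at most quadratic growth are compared with those of (1 - t)^(-3), which
  are (k+1)(k+2)/2.\<close>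

lemma egg_weightI:
  assumes "m \<ge> 1" "\<gamma> > 0" "\<And>k. Q k \<ge> 0" "\<And>k. Q k \<le> c * (a + real k) * (b + real k)" "c \<ge> 0" "a \<ge> 0" "b \<ge> 0"
  shows "egg_weight m \<gamma> Q"
proof
  fix t :: real assume t: "0 \<le> t" "t < 1"
  show "summable (\<lambda>k. Q k * t ^ k)"
  proof (rule summable_comparison_test)
    show "summable (\<lambda>k. c * (a + 1) * (b + 1) * (pochhammer 3 k / fact k * t ^ k) * 2)"
      using binomial_series_pochhammer_real[of t 3] t
      by (intro summable_mult summable_mult2) (auto simp: sums_iff)
    show "\<exists>N. \<forall>k\<ge>N. norm (Q k * t ^ k) \<le> c * (a + 1) * (b + 1) * (pochhammer 3 k / fact k * t ^ k) * 2"
    proof (intro exI allI impI)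
      fix k
      have "(a + real k) * (b + real k) \<le> ((a + 1) * (real k + 1)) * ((b + 1) * (real k + 2))"
        using assms by (intro mult_mono) (auto simp: algebra_simps)
      then have "c * ((a + real k) * (b + real k)) * t ^ k \<le> c * (((a + 1) * (real k + 1)) * ((b + 1) * (real k + 2))) * t ^ k"
        using assms t by (intro mult_right_mono mult_left_mono) auto
      moreover have "norm (Q k * t ^ k) \<le> c * ((a + real k) * (b + real k)) * t ^ k"
      proof -
        have "Q k \<le> c * ((a + real k) * (b + real k))"
          using assms(4)[of k] by (simp add: mult.assoc)
        then have "Q k * t ^ k \<le> c * ((a + real k) * (b + real k)) * t ^ k"
          using t by (intro mult_right_mono) auto
        moreover have "Q k * t ^ k \<ge> 0"
          using assms(3)[of k] t by simp
        ultimately show ?thesis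
          by (simp only: real_norm_def abs_of_nonneg)
      qed
      ultimately show "norm (Q k * t ^ k) \<le> c * (a + 1) * (b + 1) * (pochhammer 3 k / fact k * t ^ k) * 2"
        by (simp add: pochhammer_3_div_fact mult_ac)
    qed
  qed
qed (use assms in auto)

lemma (in egg_weight) K_diag:
  assumes "p \<in> egg_domain m"
  shows "K p p = of_real ((1 - norm (fst p) ^ 2) powr (- \<gamma>)) * gen (of_real (egg_ratio m p))"
    and "norm (complex_of_real (egg_ratio m p)) < 1"
proof -
  have p: "p \<in> egg_closure m"
    using assms egg_domain_subset_closure by auto
  have n: "1 - norm (fst p) ^ 2 > 0"
    using egg_domain_norm(1)[OF m, of "fst p" "snd p"] assms by (simp add: power_less_one_iff)
  have v: "1 - fst p * cnj (fst p) = of_real (1 - norm (fst p) ^ 2)"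
    by (simp flip: complex_norm_square)
  have pw: "(1 - fst p * cnj (fst p)) powr (- of_real c) = of_real ((1 - norm (fst p) ^ 2) powr (- c))" for c
    unfolding v using n powr_of_real[of "1 - norm (fst p) ^ 2" "- c"] by simp
  have u: "egg_u p p = of_real (egg_ratio m p)"
    unfolding egg_u_def pw egg_ratio_def by (simp flip: complex_norm_square)
  show "K p p = of_real ((1 - norm (fst p) ^ 2) powr (- \<gamma>)) * gen (of_real (egg_ratio m p))"
    unfolding K_eq pw u by simp
  show "norm (complex_of_real (egg_ratio m p)) < 1"
    using norm_u_le_tau(2)[OF assms p] by (simp add: u)
qed

lemma sums_quadratic:
  fixes u :: complex
  assumes "norm u < 1"
  shows "(\<lambda>k. (of_nat k + 1) * (of_nat k + 2) * u ^ k) sums (2 / (1 - u) ^ 3)"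
proof -
  have u: "1 - u \<noteq> 0"
    using assms by auto
  have "(\<lambda>k. 2 * (of_real (pochhammer 3 k / fact k) * u ^ k)) sums (2 * (1 - u) powr (- of_real 3))"
    by (intro sums_mult binomial_series_pochhammer assms)
  also have "(1 - u) powr (- of_real 3) = 1 / (1 - u) ^ 3"
    using u powr_complexpow[of "1 - u" 3] by (simp add: powr_minus divide_inverse)
  finally show ?thesis
    unfolding pochhammer_3_div_fact by (simp add: mult_ac)
qed

lemma egg_weight_bergman: "m \<ge> 1 \<Longrightarrow> egg_weight m (2 + 1 / real m) (bergman_weight m)"
  by (rule egg_weightI[where a = 1 and b = "1 + real m" and c = "1 / (real m * pi ^ 2)"])
     (auto simp: bergman_weight_def add_ac intro!: add_pos_nonneg)

text \<open>Testing each kernel against the conjugate of the other gives two integrals that are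
  conjugate to each other, so L is the conjugate of K on the diagonal; the case L = K makes the
  values real. It transfers the closed form to the kernel picked by the choice operator.\<close>

lemma bergman_kernel_unique_diag:
  assumes K: "is_bergman_kernel U K" and L: "is_bergman_kernel U L" and z: "\<zeta> \<in> U"
  shows "K \<zeta> \<zeta> = L \<zeta> \<zeta>"
proof -
  have *: "L \<zeta> \<zeta> = cnj (K \<zeta> \<zeta>)" if K: "is_bergman_kernel U K" and L: "is_bergman_kernel U L" for K L
  proof -
    have mem: "(\<lambda>\<eta>. cnj (K \<zeta> \<eta>)) \<in> bergman_space U" "(\<lambda>\<eta>. cnj (L \<zeta> \<eta>)) \<in> bergman_space U"
      using K L z unfolding is_bergman_kernel_def by blast+
    have "cnj (L \<zeta> \<zeta>) = (LINT \<eta>:U|lborel. K \<zeta> \<eta> * cnj (L \<zeta> \<eta>))"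
      by (rule bspec[OF conjunct2[OF bspec[OF K[unfolded is_bergman_kernel_def] z]] mem(2)])
    moreover have "cnj (K \<zeta> \<zeta>) = (LINT \<eta>:U|lborel. L \<zeta> \<eta> * cnj (K \<zeta> \<eta>))"
      by (rule bspec[OF conjunct2[OF bspec[OF L[unfolded is_bergman_kernel_def] z]] mem(1)])
    moreover have "(LINT \<eta>:U|lborel. L \<zeta> \<eta> * cnj (K \<zeta> \<eta>)) = cnj (LINT \<eta>:U|lborel. K \<zeta> \<eta> * cnj (L \<zeta> \<eta>))"
      unfolding set_lebesgue_integral_def Bochner_Integration.integral_cnj[symmetric]
      by (intro Bochner_Integration.integral_cong) (auto simp: mult.commute)
    ultimately show ?thesis
      by (metis complex_cnj_cnj)
  qed
  show ?thesis
    using *[OF K K] *[OF K L] by simp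
qed

text \<open>With b = (k + 1)/m the squared norm contains (b)_(j+2) = b (b+1) (b+2)_j in its
  denominator; the last factor cancels the binomial coefficient, and b (b+1) cancels the
  weight.\<close>

lemma bergman_coef_moment:
  assumes m: "m \<ge> 1"
  shows "bergman_weight m k * (pochhammer (2 + 1 / m + k / m) j / fact j) *
    (pi ^ 2 / Suc j * radial_moment m (Suc k) (Suc j)) = 1"
proof -
  define b where "b = Suc k / real m"
  have b: "b > 0" "2 + 1 / m + k / m = b + 2" "real m * b = k + 1" "real m * (b + 1) = k + 1 + m"
    using m by (simp_all add: b_def field_simps)
  define P where "P = pochhammer (b + 2) j"
  have P: "P > 0"
    using b by (simp add: P_def pochhammer_pos)
  have e: "pochhammer b (Suc (Suc j)) = b * ((b + 1) * P)"
    by (simp add: P_def pochhammer_rec add_ac)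
  have w: "bergman_weight m k = real m * b * (b + 1) / pi ^ 2"
    unfolding bergman_weight_def b(4)[symmetric] b(3)[symmetric, simplified]
    using m b by (simp add: field_simps)
  have "b + 1 > 0"
    using b by simp
  then show ?thesis
    unfolding w b(2) radial_moment_def b_def[symmetric] e P_def[symmetric] fact_Suc[of j]
    using P b(1) m pi_gt_zero by (simp add: divide_simps)
qed

text \<open>From |f| <= |f|^2 + 1 and the finite volume of the domain.\<close>

lemma bergman_space_set_integrable:
  assumes m: "m \<ge> 1" and f: "f \<in> bergman_space (egg_domain m)"
  shows "set_integrable lborel (egg_domain m) f"
proof (rule set_integrable_egg_domain[OF m])
  show c: "continuous_on (egg_domain m) f"
    using f holomorphic2_on_imp_continuous_on by (auto simp: bergman_space_def)
  have [measurable]: "egg_domain m \<in> sets borel"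
    using open_egg_domain by (rule borel_open)
  have meas: "(\<lambda>p. indicator (egg_domain m) p *\<^sub>R norm (f p) ^ 2) \<in> borel_measurable borel"
    using c open_egg_domain by (intro borel_measurable_continuous_on_indicator continuous_intros borel_open)
  have "integrable lborel (\<lambda>p. indicator (egg_domain m) p *\<^sub>R norm (f p) ^ 2)"
  proof (rule integrableI_bounded)
    have "(\<integral>\<^sup>+p. ennreal (norm (indicator (egg_domain m) p *\<^sub>R norm (f p) ^ 2)) \<partial>lborel)
        = (\<integral>\<^sup>+p\<in>egg_domain m. ennreal (norm (f p) ^ 2) \<partial>lborel)"
      by (intro nn_integral_cong) (auto simp: indicator_def)
    also have "\<dots> < \<infinity>"
      using f by (simp add: bergman_space_def)
    finally show "(\<integral>\<^sup>+p. ennreal (norm (indicator (egg_domain m) p *\<^sub>R norm (f p) ^ 2)) \<partial>lborel) < \<infinity>" .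
  qed (use meas in simp)
  then have "set_integrable lborel (egg_domain m) (\<lambda>p. norm (f p) ^ 2)"
    by (simp add: set_integrable_def)
  from set_integral_add(1)[OF this set_integrable_egg_domain_const[OF m, of 1]]
  show "set_integrable lborel (egg_domain m) (\<lambda>p. norm (f p) ^ 2 + 1)" .
  show "norm (f p) \<le> norm (f p) ^ 2 + 1" for p
    using zero_le_power2[of "norm (f p) - 1/2"] by (simp add: power2_eq_square algebra_simps)
qed

theorem is_bergman_kernel_egg:
  assumes m: "m \<ge> 1"
  shows "is_bergman_kernel (egg_domain m) (egg_kernel m (2 + 1 / real m) (bergman_weight m))"
proof -
  interpret egg_weight m "2 + 1 / real m" "bergman_weight m"
    by (rule egg_weight_bergman[OF m])
  interpret R: reinhardt_domain "egg_domain m"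
    by (rule reinhardt_egg_domain[OF m])
  have [measurable]: "egg_domain m \<in> sets borel"
    using open_egg_domain by (rule borel_open)
  have space: "(\<lambda>\<eta>. cnj (K \<zeta> \<eta>)) \<in> bergman_space (egg_domain m)" if z: "\<zeta> \<in> egg_domain m" for \<zeta>
  proof -
    have "(\<integral>\<^sup>+p\<in>egg_domain m. ennreal (norm (cnj (K \<zeta> p)) ^ 2) \<partial>lborel)
        \<le> (\<integral>\<^sup>+p. ennreal (kernel_bound \<zeta> ^ 2) * indicator (egg_domain m) p \<partial>lborel)"
      using norm_K_le[OF z] egg_domain_subset_closure
      by (intro nn_integral_mono) (auto simp: indicator_def intro!: ennreal_leI power_mono)
    also have "\<dots> = ennreal (kernel_bound \<zeta> ^ 2) * emeasure lborel (egg_domain m)"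
      by (simp add: nn_integral_cmult)
    also have "\<dots> < \<infinity>"
      using emeasure_egg_domain_finite[OF m] by (simp add: ennreal_mult_less_top)
    finally show ?thesis
      using cnj_K_holomorphic[OF z] by (simp add: bergman_space_def)
  qed
  have repr: "f \<zeta> = (LINT \<eta>:egg_domain m|lborel. K \<zeta> \<eta> * f \<eta>)"
    if f: "f \<in> bergman_space (egg_domain m)" and z: "\<zeta> \<in> egg_domain m" for f \<zeta>
  proof -
    have hol: "holomorphic2_on f (egg_domain m)"
      using f by (simp add: bergman_space_def)
    note cont = holomorphic2_on_imp_continuous_on[OF hol]
    obtain a where a: "\<And>z w j k. (z, w) \<in> egg_domain m \<Longrightarrow> torus_mean f j k z w = a k j * z ^ j * w ^ k"
      "\<And>z w. (z, w) \<in> egg_domain m \<Longrightarrow> ((\<lambda>(k, j). a k j * z ^ j * w ^ k) has_sum f (z, w)) UNIV"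
      using R.power_series[OF cont holomorphic2_on_slice[OF hol]] by blast
    have int: "set_integrable lborel (egg_domain m) f"
      by (rule bergman_space_set_integrable[OF m f])
    obtain z0 w0 where zw: "\<zeta> = (z0, w0)"
      by fastforce
    have "(\<integral>\<eta>. K (z0, w0) \<eta> * f \<eta> \<partial>restrict_space lborel (egg_domain m)) = f (z0, w0)"
    proof (rule reproducing[where a = a])
      show "(z0, w0) \<in> egg_domain m"
        using z zw by simp
      then show "((\<lambda>(k, j). a k j * z0 ^ j * w0 ^ k) has_sum f (z0, w0)) UNIV"
        by (rule a(2))
      show "(\<lambda>\<eta>. \<eta>) \<in> borel_measurable (restrict_space lborel (egg_domain m))"
        by (intro measurable_restrict_space1) simp
      show "\<eta> \<in> egg_closure m" if "\<eta> \<in> space (restrict_space lborel (egg_domain m))" for \<eta>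
        using that egg_domain_subset_closure by (auto simp: space_restrict_space)
      show "integrable (restrict_space lborel (egg_domain m)) f"
        using int by (simp add: set_integrable_def integrable_restrict_space)
      fix k j
      have "set_integrable lborel (egg_domain m) (\<lambda>p. cnj (fst p ^ j * snd p ^ k) * f p)"
      proof (rule set_integrable_egg_domain[OF m])
        show "set_integrable lborel (egg_domain m) (\<lambda>p. norm (f p))"
          using int by (rule set_integrable_norm)
        show "continuous_on (egg_domain m) (\<lambda>p. cnj (fst p ^ j * snd p ^ k) * f p)"
          by (intro continuous_intros cont)
        fix p assume p: "p \<in> egg_domain m"
        have "norm (fst p) ^ j * norm (snd p) ^ k \<le> 1"
          using egg_domain_norm[OF m, of "fst p" "snd p"] p by (auto intro!: mult_le_one power_le_one)
        then show "norm (cnj (fst p ^ j * snd p ^ k) * f p) \<le> norm (f p)"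
          by (simp add: norm_mult norm_power mult_left_le_one_le)
      qed
      then have "(LINT p:egg_domain m|lborel. cnj (fst p ^ j * snd p ^ k) * f p)
          = a k j * of_real (LINT p:egg_domain m|lborel. norm (fst p) ^ (2 * j) * norm (snd p) ^ (2 * k))"
        by (intro R.moment_torus_mean[of f j k "a k j"] cont a(1))
      also have "\<dots> = a k j * of_real (pi ^ 2 / Suc j * radial_moment m (Suc k) (Suc j))"
        by (subst egg_moment[OF m]) simp
      finally have *: "(LINT p:egg_domain m|lborel. cnj (fst p ^ j * snd p ^ k) * f p) = \<dots>" .
      have "of_real (coef k j) * (\<integral>p. cnj (fst p ^ j * snd p ^ k) * f p \<partial>restrict_space lborel (egg_domain m))
          = of_real (coef k j) * (LINT p:egg_domain m|lborel. cnj (fst p ^ j * snd p ^ k) * f p)"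
        by (simp add: integral_restrict_space set_lebesgue_integral_def)
      also have "\<dots> = a k j * of_real (coef k j * (pi ^ 2 / Suc j * radial_moment m (Suc k) (Suc j)))"
        unfolding * by simp
      also have "coef k j * (pi ^ 2 / Suc j * radial_moment m (Suc k) (Suc j)) = 1"
        using bergman_coef_moment[OF m, of k j] by (simp only: coef_def)
      finally show "of_real (coef k j) * (\<integral>p. cnj (fst p ^ j * snd p ^ k) * f p \<partial>restrict_space lborel (egg_domain m)) = a k j"
        by simp
    qed
    then show ?thesis
      by (simp add: zw integral_restrict_space set_lebesgue_integral_def)
  qed
  show ?thesis
    unfolding is_bergman_kernel_def using space repr by blast
qed

theorem bergman_kernel_egg:
  assumes m: "m \<ge> 1" and p: "p \<in> egg_domain m"
  defines "u \<equiv> egg_ratio m p"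
  shows "bergman_kernel (egg_domain m) p p =
    of_real ((1 - norm (fst p) ^ 2) powr (- (2 + 1 / real m)) * ((real m + 1) - (real m - 1) * u) / (m * pi ^ 2 * (1 - u) ^ 3))"
proof -
  interpret egg_weight m "2 + 1 / real m" "bergman_weight m"
    by (rule egg_weight_bergman[OF m])
  have "is_bergman_kernel (egg_domain m) (bergman_kernel (egg_domain m))"
    unfolding bergman_kernel_def
    by (rule someI[of "\<lambda>K. is_bergman_kernel (egg_domain m) K", OF is_bergman_kernel_egg[OF m]])
  then have "bergman_kernel (egg_domain m) p p = K p p"
    using is_bergman_kernel_egg[OF m] p by (rule bergman_kernel_unique_diag)
  also have "K p p = of_real ((1 - norm (fst p) ^ 2) powr (- (2 + 1 / real m))) * gen (of_real u)"
    unfolding u_def by (rule K_diag(1)[OF p])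
  also have "gen (of_real u) = of_real (((real m + 1) - (real m - 1) * u) / (m * pi ^ 2 * (1 - u) ^ 3))"
  proof -
    have u: "norm (complex_of_real u) < 1"
      unfolding u_def by (rule K_diag(2)[OF p])
    define c where "c = complex_of_real (1 / (m * pi ^ 2))"
    \<comment> \<open>(k+1)(k+1+m) = (k+1)(k+2) + (m-1)(k+1), which splits q into the series of
      2/(1-u)^3 and (m-1)/(1-u)^2.\<close>
    have "(\<lambda>k. c * ((of_nat k + 1) * (of_nat k + 2) * of_real u ^ k + (of_nat m - 1) * (of_nat (Suc k) * of_real u ^ k)))
      sums (c * (2 / (1 - of_real u) ^ 3 + (of_nat m - 1) * (1 / (1 - of_real u) ^ 2)))"
      by (intro sums_mult sums_add sums_quadratic geometric_deriv_sums u)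
    moreover have "c * ((of_nat k + 1) * (of_nat k + 2) * of_real u ^ k + (of_nat m - 1) * (of_nat (Suc k) * of_real u ^ k))
        = of_real (bergman_weight m k) * of_real u ^ k" for k
      by (simp add: c_def bergman_weight_def algebra_simps add_divide_distrib)
    ultimately have "(\<lambda>k. of_real (bergman_weight m k) * of_real u ^ k) sums
        (c * (2 / (1 - of_real u) ^ 3 + (of_nat m - 1) * (1 / (1 - of_real u) ^ 2)))"
      by simp
    then have "gen (of_real u) = c * (2 / (1 - of_real u) ^ 3 + (of_nat m - 1) * (1 / (1 - of_real u) ^ 2))"
      using gen_sums[OF u] sums_unique2 by blast
    also have "\<dots> = of_real (1 / (m * pi ^ 2) * (2 / (1 - u) ^ 3 + (real m - 1) * (1 / (1 - u) ^ 2)))"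
      by (simp add: c_def)
    also have "1 / (m * pi ^ 2) * (2 / (1 - u) ^ 3 + (real m - 1) * (1 / (1 - u) ^ 2))
        = ((real m + 1) - (real m - 1) * u) / (m * pi ^ 2 * (1 - u) ^ 3)"
    proof -
      have "1 - u > 0"
        using u by auto
      then have "2 / (1 - u) ^ 3 + (real m - 1) * (1 / (1 - u) ^ 2) = (2 + (real m - 1) * (1 - u)) / (1 - u) ^ 3"
        by (simp add: divide_simps power2_eq_square power3_eq_cube)
      also have "2 + (real m - 1) * (1 - u) = (real m + 1) - (real m - 1) * u"
        by (simp add: algebra_simps)
      finally show ?thesis
        by simp
    qed
    finally show ?thesis .
  qed
  finally show ?thesis
    by simp
qed

section \<open>The boundary and the Fefferman measure\<close>

text \<open>Since r^(2m) <= r^2, the dilation multiplies the defining sum by at most r^2. It yields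
  both the closure of the domain and the interior dilations of boundary points.\<close>

lemma egg_scale:
  assumes m: "m \<ge> 1" and p: "p \<in> egg_closure m" and r: "0 \<le> r" "r < 1"
  shows "r *\<^sub>R p \<in> egg_domain m"
proof -
  obtain z w where zw: "p = (z, w)"
    by fastforce
  have "r ^ (2 * m) \<le> r ^ 2"
    using r m by (intro power_decreasing) auto
  then have "(r * norm z) ^ 2 + (r * norm w) ^ (2 * m) \<le> r ^ 2 * norm z ^ 2 + r ^ 2 * norm w ^ (2 * m)"
    unfolding power_mult_distrib by (intro add_left_mono mult_right_mono) auto
  also have "\<dots> = r ^ 2 * (norm z ^ 2 + norm w ^ (2 * m))"
    by (simp add: algebra_simps)
  also have "\<dots> \<le> r ^ 2 * 1"
    using p by (intro mult_left_mono) (auto simp: zw egg_closure_def)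
  also have "\<dots> < 1"
    using r by (simp add: power_less_one_iff)
  finally show ?thesis
    using r by (simp add: zw egg_domain_def)
qed

lemma frontier_egg_domain:
  assumes m: "m \<ge> 1"
  shows "frontier (egg_domain m) = {(z, w). norm z ^ 2 + norm w ^ (2 * m) = 1}"
proof -
  have "closure (egg_domain m) = egg_closure m"
  proof
    show "closure (egg_domain m) \<subseteq> egg_closure m"
      by (rule closure_minimal[OF egg_domain_subset_closure closed_egg_closure])
    show "egg_closure m \<subseteq> closure (egg_domain m)"
    proof
      fix p assume p: "p \<in> egg_closure m"
      have "(\<lambda>n. (1 - inverse (real (Suc n))) *\<^sub>R p) \<longlonglongrightarrow> (1 - 0) *\<^sub>R p"
        by (intro tendsto_intros LIMSEQ_inverse_real_of_nat)
      moreover have "(1 - inverse (real (Suc n))) *\<^sub>R p \<in> egg_domain m" for n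
        by (intro egg_scale[OF m p]) (auto simp: field_simps)
      ultimately show "p \<in> closure (egg_domain m)"
        unfolding closure_sequential
        by (intro exI[of _ "\<lambda>n. (1 - inverse (real (Suc n))) *\<^sub>R p"]) simp
    qed
  qed
  then show ?thesis
    using interior_open[OF open_egg_domain[of m]]
    by (auto simp: frontier_def egg_closure_def egg_domain_def)
qed

lemma frontier_egg_domain_iff:
  "m \<ge> 1 \<Longrightarrow> p \<in> frontier (egg_domain m) \<longleftrightarrow> norm (fst p) ^ 2 + norm (snd p) ^ (2 * m) = 1"
  by (simp add: frontier_egg_domain case_prod_unfold)

lemma frontier_subset_egg_closure: "m \<ge> 1 \<Longrightarrow> frontier (egg_domain m) \<subseteq> egg_closure m"
  by (auto simp: frontier_egg_domain egg_closure_def)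

text \<open>Reads all four derivatives off a differential written in dz, dw and their
  conjugates.\<close>

lemma wirtinger_eqI:
  assumes "(u has_derivative (\<lambda>q. a * fst q + b * cnj (fst q) + c * snd q + d * cnj (snd q))) (at p)"
  shows "d_z u p = a" "d_zbar u p = b" "d_w u p = c" "d_wbar u p = d"
  unfolding wirtinger_def wirtinger_bar_def frechet_derivative_at[OF assms, symmetric]
  by (simp_all add: algebra_simps)

definition egg_rho :: "nat \<Rightarrow> C2 \<Rightarrow> complex" where
  "egg_rho m = (\<lambda>q. complex_of_real (domain_rho m q))"

text \<open>As a polynomial in the coordinates and their conjugates, the function is open to the
  product rules even where a norm vanishes.\<close>

lemma egg_rho_eq: "egg_rho m q = fst q * cnj (fst q) + (snd q * cnj (snd q)) ^ m - 1"
  by (simp add: egg_rho_def domain_rho_def case_prod_unfold power_mult flip: complex_norm_square)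

lemma norm_square_power: "norm (w :: complex) ^ (2 * k) = (norm w ^ 2) ^ k"
  by (simp add: power_mult)

lemma egg_rho_derivatives:
  fixes p :: C2
  defines "W \<equiv> snd p * cnj (snd p)"
  shows "d_z (egg_rho m) p = cnj (fst p)" "d_zbar (egg_rho m) p = fst p"
    "d_w (egg_rho m) p = of_nat m * W ^ (m - 1) * cnj (snd p)"
    "d_wbar (egg_rho m) p = of_nat m * W ^ (m - 1) * snd p"
proof -
  have "(egg_rho m has_derivative (\<lambda>q. cnj (fst p) * fst q + fst p * cnj (fst q)
      + of_nat m * W ^ (m - 1) * cnj (snd p) * snd q + of_nat m * W ^ (m - 1) * snd p * cnj (snd q))) (at p)"
    unfolding egg_rho_eq[abs_def] W_def
    by (rule has_derivative_eq_rhs, (rule derivative_eq_intros refl)+) (simp add: fun_eq_iff algebra_simps)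
  from wirtinger_eqI[OF this]
  show "d_z (egg_rho m) p = cnj (fst p)" "d_zbar (egg_rho m) p = fst p"
    "d_w (egg_rho m) p = of_nat m * W ^ (m - 1) * cnj (snd p)"
    "d_wbar (egg_rho m) p = of_nat m * W ^ (m - 1) * snd p" .
qed

lemma egg_rho_second_derivatives:
  assumes m: "m \<ge> 1"
  shows "d_z (d_zbar (egg_rho m)) p = 1" "d_w (d_zbar (egg_rho m)) p = 0"
    "d_z (d_wbar (egg_rho m)) p = 0"
    "d_w (d_wbar (egg_rho m)) p = of_nat m ^ 2 * (snd p * cnj (snd p)) ^ (m - 1)"
proof -
  have "((\<lambda>p. fst p) has_derivative (\<lambda>q. 1 * fst q + 0 * cnj (fst q) + 0 * snd q + 0 * cnj (snd q))) (at p)"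
    by (auto intro!: derivative_eq_intros)
  from wirtinger_eqI[OF this]
  show "d_z (d_zbar (egg_rho m)) p = 1" "d_w (d_zbar (egg_rho m)) p = 0"
    by (simp_all add: egg_rho_derivatives(2)[abs_def] fun_eq_iff[symmetric])
  define W where "W = snd p * cnj (snd p)"
  define n where "n = m - 1"
  \<comment> \<open>W^n has derivative \<open>A\<close> with respect to W. For n = 0 the truncated
    exponent is harmless because of the factor n, so \<open>A * W\<close> is n W^n in every
    case.\<close>
  define A where "A = of_nat n * W ^ (n - 1)"
  have A: "A * W = of_nat n * W ^ n"
    by (cases n) (simp_all add: A_def)
  have "((\<lambda>p. of_nat m * (snd p * cnj (snd p)) ^ n * snd p) has_derivative
      (\<lambda>q. 0 * fst q + 0 * cnj (fst q) + of_nat m * (A * W + W ^ n) * snd q + of_nat m * A * snd p ^ 2 * cnj (snd q))) (at p)"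
    unfolding A_def W_def
    by (rule has_derivative_eq_rhs, (rule derivative_eq_intros refl)+) (simp add: fun_eq_iff algebra_simps power2_eq_square)
  from wirtinger_eqI[OF this]
  have "d_z (\<lambda>p. of_nat m * (snd p * cnj (snd p)) ^ n * snd p) p = 0"
    "d_w (\<lambda>p. of_nat m * (snd p * cnj (snd p)) ^ n * snd p) p = of_nat m * (A * W + W ^ n)"
    by simp_all
  moreover have "d_wbar (egg_rho m) = (\<lambda>p. of_nat m * (snd p * cnj (snd p)) ^ n * snd p)"
    by (simp add: fun_eq_iff egg_rho_derivatives(4) n_def)
  moreover have "of_nat m * (A * W + W ^ n) = of_nat m ^ 2 * W ^ n"
    using m unfolding A by (simp add: n_def of_nat_diff power2_eq_square algebra_simps)
  ultimately show "d_z (d_wbar (egg_rho m)) p = 0"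
    "d_w (d_wbar (egg_rho m)) p = of_nat m ^ 2 * (snd p * cnj (snd p)) ^ (m - 1)"
    by (simp_all add: W_def n_def)
qed

definition egg_gradient :: "nat \<Rightarrow> C2 \<Rightarrow> real" where
  "egg_gradient m p = sqrt (norm (fst p) ^ 2 + (real m * norm (snd p) ^ (2 * m - 1)) ^ 2)"

text \<open>The cube root of the absolute determinant in the Fefferman weight, a function of w
  alone.\<close>

definition weight_root :: "nat \<Rightarrow> complex \<Rightarrow> real" where
  "weight_root m w = root 3 (real m ^ 2 * norm w ^ (2 * (m - 1)))"

lemma rho_gradient_norm_egg:
  assumes m: "m \<ge> 1"
  shows "rho_gradient_norm m p = egg_gradient m p"
proof -
  have e: "2 * (m - 1) + 1 = 2 * m - 1"
    using m by simp
  have "norm (d_w (egg_rho m) p) = real m * (norm (snd p) ^ 2) ^ (m - 1) * norm (snd p)"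
    by (simp add: egg_rho_derivatives norm_mult norm_power power2_eq_square)
  also have "\<dots> = real m * norm (snd p) ^ (2 * (m - 1) + 1)"
    by (simp add: norm_square_power)
  finally have "norm (d_w (egg_rho m) p) = real m * norm (snd p) ^ (2 * m - 1)"
    unfolding e .
  then show ?thesis
    unfolding rho_gradient_norm_def egg_gradient_def Let_def egg_rho_def[symmetric]
    by (simp add: egg_rho_derivatives)
qed

text \<open>With W = |w|^2 the determinant is m^2 W^(m-1) (rho - |z|^2 - W^m), and the bracket is
  identically -1.\<close>

lemma fefferman_weight_egg:
  assumes m: "m \<ge> 1"
  shows "fefferman_weight m p = weight_root m (snd p) / egg_gradient m p"
proof -
  define W where "W = snd p * cnj (snd p)"
  define M :: "complex ^ 3 ^ 3" where "M = vector
            [vector [egg_rho m p, d_zbar (egg_rho m) p, d_wbar (egg_rho m) p],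
             vector [d_z (egg_rho m) p, d_z (d_zbar (egg_rho m)) p, d_z (d_wbar (egg_rho m)) p],
             vector [d_w (egg_rho m) p, d_w (d_zbar (egg_rho m)) p, d_w (d_wbar (egg_rho m)) p]]"
  have Wm: "W ^ m = W ^ (m - 1) * W"
    using m by (cases m) auto
  have "det M = - (of_nat m ^ 2 * W ^ (m - 1))"
    unfolding M_def det_3 egg_rho_second_derivatives[OF m]
    by (simp add: egg_rho_derivatives egg_rho_eq W_def[symmetric] Wm algebra_simps power2_eq_square)
  then have "norm (det M) = real m ^ 2 * norm (snd p) ^ (2 * (m - 1))"
    by (simp add: W_def norm_mult norm_power norm_square_power power2_eq_square)
  then show ?thesis
    unfolding fefferman_weight_def Let_def egg_rho_def[symmetric] M_def[symmetric] weight_root_def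
    by (simp add: rho_gradient_norm_egg[OF m])
qed

section \<open>Parametrisation and area element of the boundary\<close>

lemma egg_param_derivative:
  fixes w :: complex
  assumes m: "m \<ge> 1" and w: "norm w < 1"
  defines "s \<equiv> sqrt (1 - norm w ^ (2 * m))" and "A \<equiv> - real m * (norm w ^ 2) ^ (m - 1) / sqrt (1 - norm w ^ (2 * m))"
  shows "(egg_param m has_derivative
    (\<lambda>(h, k). (of_real s * (of_real h * (\<i> * cis \<phi>)) + of_real (A * (w \<bullet> k)) * cis \<phi>, k))) (at (\<phi>, w))"
proof -
  have pos: "1 - (w \<bullet> w) ^ m > 0"
    using w m by (simp add: power2_norm_eq_inner[symmetric] power_less_one_iff flip: power_mult)
  \<comment> \<open>Inner products in place of norms keep the expression differentiable at w =
    0.\<close>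
  have eq: "egg_param m = (\<lambda>p. (of_real (sqrt (1 - (snd p \<bullet> snd p) ^ m)) * exp (\<i> * of_real (fst p)), snd p))"
    by (simp add: egg_param_def fun_eq_iff cis_conv_exp power_mult power2_norm_eq_inner)
  have s: "sqrt (1 - (w \<bullet> w) ^ m) = s" "(w \<bullet> w) = norm w ^ 2"
    by (simp_all add: s_def power_mult power2_norm_eq_inner)
  have A: "A = - real m * (w \<bullet> w) ^ (m - 1) / sqrt (1 - (w \<bullet> w) ^ m)"
    by (simp add: A_def norm_square_power power2_norm_eq_inner)
  have "((\<lambda>p. sqrt (1 - (snd p \<bullet> snd p) ^ m)) has_derivative (\<lambda>p. A * (w \<bullet> snd p))) (at (\<phi>, w))"
    using pos
    by (auto intro!: derivative_eq_intros simp: A fun_eq_iff inner_commute field_simps)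
  then have "((\<lambda>p. complex_of_real (sqrt (1 - (snd p \<bullet> snd p) ^ m))) has_derivative (\<lambda>p. of_real (A * (w \<bullet> snd p)))) (at (\<phi>, w))"
    by (rule has_derivative_of_real)
  moreover have "((\<lambda>p. exp (\<i> * of_real (fst p))) has_derivative (\<lambda>p. of_real (fst p) * (\<i> * cis \<phi>))) (at (\<phi>, w))"
  proof -
    have f: "((\<lambda>p. \<i> * complex_of_real (fst p)) has_derivative (\<lambda>p. \<i> * of_real (fst p))) (at (\<phi>, w))"
      by (intro has_derivative_mult_right has_derivative_of_real has_derivative_fst has_derivative_ident)
    have g: "(exp has_derivative (*) (exp (\<i> * complex_of_real \<phi>))) (at (\<i> * complex_of_real (fst (\<phi>, w))))"
      using DERIV_exp[of "\<i> * complex_of_real \<phi>"] by (simp add: has_field_derivative_def)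
    from has_derivative_compose[OF f g] show ?thesis
      by (simp add: cis_conv_exp mult_ac)
  qed
  ultimately have "((\<lambda>p. (of_real (sqrt (1 - (snd p \<bullet> snd p) ^ m)) * exp (\<i> * of_real (fst p)), snd p)) has_derivative
     (\<lambda>p. (of_real (sqrt (1 - (snd (\<phi>, w) \<bullet> snd (\<phi>, w)) ^ m)) * (of_real (fst p) * (\<i> * cis \<phi>))
       + of_real (A * (w \<bullet> snd p)) * exp (\<i> * of_real (fst (\<phi>, w))), snd p))) (at (\<phi>, w))"
    by (intro has_derivative_Pair has_derivative_mult has_derivative_snd has_derivative_ident)
  then show ?thesis
    unfolding eq case_prod_unfold fst_conv snd_conv s(1) cis_conv_exp[symmetric] .
qed

text \<open>The \<phi>-direction is orthogonal to the two w-directions, so the Gram determinant is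
  s^2 (1 + A^2 |w|^2) with s = |z|, and (s A)^2 |w|^2 = (m |w|^(2m-1))^2. Thus the area element is
  |d rho|.\<close>

lemma area_element_egg_param:
  assumes m: "m \<ge> 1" and w: "norm w < 1"
  shows "area_element (egg_param m) (\<phi>, w) = egg_gradient m (egg_param m (\<phi>, w))"
proof -
  define s where "s = sqrt (1 - norm w ^ (2 * m))"
  define A where "A = - real m * (norm w ^ 2) ^ (m - 1) / sqrt (1 - norm w ^ (2 * m))"
  define T where "T = frechet_derivative (egg_param m) (at (\<phi>, w))"
  have T: "T = (\<lambda>(h, k). (of_real s * (of_real h * (\<i> * cis \<phi>)) + of_real (A * (w \<bullet> k)) * cis \<phi>, k))"
    unfolding T_def s_def A_def
    by (rule frechet_derivative_at[OF egg_param_derivative[OF m w], symmetric])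
  have s: "s > 0"
    using w m by (simp add: s_def power_less_one_iff)
  define c d where "c = cos \<phi>" and "d = sin \<phi>"
  have cd: "c * c + d * d = 1"
    using sin_cos_squared_add3[of \<phi>] by (simp add: c_def d_def)
  define x y where "x = Re w" and "y = Im w"
  define b where "b = (vector [(1, 0), (0, 1), (0, \<i>)] :: (real \<times> complex) ^ 3)"
  have b: "b $ 1 = (1, 0)" "b $ 2 = (0, 1)" "b $ 3 = (0, \<i>)"
    by (simp_all add: b_def)
  have T1: "T (b $ 1) = (Complex (- s * d) (s * c), 0)"
    and T2: "T (b $ 2) = (Complex (A * x * c) (A * x * d), 1)"
    and T3: "T (b $ 3) = (Complex (A * y * c) (A * y * d), \<i>)"
    by (simp_all add: T b x_def y_def complex_eq_iff c_def d_def)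
  have i11: "T (b $ 1) \<bullet> T (b $ 1) = s ^ 2"
  proof -
    have "T (b $ 1) \<bullet> T (b $ 1) = s ^ 2 * (c * c + d * d)"
      by (simp add: T1 inner_complex_def power2_eq_square algebra_simps)
    then show ?thesis
      by (simp add: cd)
  qed
  have i12: "T (b $ 1) \<bullet> T (b $ 2) = 0" "T (b $ 2) \<bullet> T (b $ 1) = 0"
    "T (b $ 1) \<bullet> T (b $ 3) = 0" "T (b $ 3) \<bullet> T (b $ 1) = 0"
    by (simp_all add: T1 T2 T3 inner_complex_def)
  have i22: "T (b $ 2) \<bullet> T (b $ 2) = A ^ 2 * x ^ 2 + 1"
  proof -
    have "T (b $ 2) \<bullet> T (b $ 2) = A ^ 2 * x ^ 2 * (c * c + d * d) + 1"
      by (simp add: T2 inner_complex_def power2_eq_square algebra_simps)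
    then show ?thesis
      by (simp add: cd)
  qed
  have i33: "T (b $ 3) \<bullet> T (b $ 3) = A ^ 2 * y ^ 2 + 1"
  proof -
    have "T (b $ 3) \<bullet> T (b $ 3) = A ^ 2 * y ^ 2 * (c * c + d * d) + 1"
      by (simp add: T3 inner_complex_def power2_eq_square algebra_simps)
    then show ?thesis
      by (simp add: cd)
  qed
  have i23: "T (b $ 2) \<bullet> T (b $ 3) = A ^ 2 * x * y" "T (b $ 3) \<bullet> T (b $ 2) = A ^ 2 * x * y"
  proof -
    have "T (b $ 2) \<bullet> T (b $ 3) = A ^ 2 * x * y * (c * c + d * d)"
      by (simp add: T2 T3 inner_complex_def power2_eq_square algebra_simps)
    then show "T (b $ 2) \<bullet> T (b $ 3) = A ^ 2 * x * y"
      by (simp add: cd)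
    then show "T (b $ 3) \<bullet> T (b $ 2) = A ^ 2 * x * y"
      by (simp add: inner_commute)
  qed
  have "area_element (egg_param m) (\<phi>, w) = sqrt (det (\<chi> i j. T (b $ i) \<bullet> T (b $ j)))"
    by (simp add: area_element_def b_def T_def Let_def)
  also have "det (\<chi> i j. T (b $ i) \<bullet> T (b $ j)) = s ^ 2 * (1 + A ^ 2 * (x ^ 2 + y ^ 2))"
    unfolding det_3 by (simp add: i11 i12 i22 i33 i23 power2_eq_square algebra_simps)
  also have "\<dots> = s ^ 2 + (s * A) ^ 2 * norm w ^ 2"
    by (simp add: cmod_def x_def y_def power_mult_distrib algebra_simps)
  also have "(s * A) ^ 2 * norm w ^ 2 = (real m * norm w ^ (2 * m - 1)) ^ 2"
  proof -
    have "s * A = - real m * (norm w ^ 2) ^ (m - 1)"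
      using s by (simp add: A_def s_def)
    then have "(s * A) ^ 2 * norm w ^ 2 = (real m * (norm w ^ (2 * (m - 1)) * norm w)) ^ 2"
      by (simp add: power_mult_distrib norm_square_power)
    also have "norm w ^ (2 * (m - 1)) * norm w = norm w ^ (2 * m - 1)"
      using m by (cases m) auto
    finally show ?thesis .
  qed
  also have "sqrt (s ^ 2 + (real m * norm w ^ (2 * m - 1)) ^ 2) = egg_gradient m (egg_param m (\<phi>, w))"
    using s by (simp add: egg_gradient_def egg_param_def s_def[symmetric] norm_mult)
  finally show ?thesis .
qed

lemma egg_param_in_frontier:
  assumes "m \<ge> 1" "u \<in> egg_param_dom"
  shows "egg_param m u \<in> frontier (egg_domain m)"
  using assms
  by (auto simp: frontier_egg_domain_iff egg_param_dom_def egg_param_def norm_mult power_le_one)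

lemma egg_gradient_pos:
  assumes m: "m \<ge> 1" and p: "p \<in> frontier (egg_domain m)"
  shows "egg_gradient m p > 0"
proof -
  have "norm (fst p) ^ 2 + norm (snd p) ^ (2 * m) = 1"
    using p by (simp add: frontier_egg_domain_iff[OF m])
  then have "fst p \<noteq> 0 \<or> snd p \<noteq> 0"
    using m by (auto simp: power_0_left)
  then show ?thesis
    using m by (auto simp: egg_gradient_def intro: add_pos_nonneg add_nonneg_pos)
qed

lemma continuous_on_egg_gradient: "continuous_on S (egg_gradient m)"
  unfolding egg_gradient_def by (intro continuous_intros)

lemma continuous_on_weight_root: "continuous_on S (weight_root m)"
  unfolding weight_root_def by (intro continuous_intros)

lemma weight_root_nonneg: "weight_root m w \<ge> 0"
  by (simp add: weight_root_def)

lemma sets_egg_param_dom[measurable]: "egg_param_dom \<in> sets borel"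
  unfolding egg_param_dom_def borel_prod[symmetric] by (intro pair_measureI) auto

lemma measurable_egg_param:
  assumes m: "m \<ge> 1"
  shows "egg_param m \<in> restrict_space lborel egg_param_dom \<rightarrow>\<^sub>M restrict_space borel (frontier (egg_domain m))"
proof (rule measurable_restrict_space2)
  show "egg_param m \<in> space (restrict_space lborel egg_param_dom) \<rightarrow> frontier (egg_domain m)"
    using egg_param_in_frontier[OF m] by (auto simp: space_restrict_space)
  have "continuous_on UNIV (\<lambda>u :: real \<times> complex. (of_real (sqrt (1 - norm (snd u) ^ (2 * m))) * cis (fst u), snd u))"
    by (intro continuous_intros)
  then have "egg_param m \<in> borel_measurable borel"
    by (simp add: egg_param_def case_prod_unfold borel_measurable_continuous_onI)
  then show "egg_param m \<in> borel_measurable (restrict_space lborel egg_param_dom)"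
    by (intro measurable_restrict_space1) simp
qed

text \<open>The area element cancels the denominator of the Fefferman weight, so in the coordinates
  (\<phi>, w) only a bounded density in w is left.\<close>

theorem fefferman_measure_eq:
  assumes m: "m \<ge> 1"
  shows "fefferman_measure m = distr
    (density (restrict_space lborel egg_param_dom) (\<lambda>u. ennreal (weight_root m (snd u))))
    (restrict_space borel (frontier (egg_domain m))) (egg_param m)"
proof -
  let ?M = "restrict_space lborel egg_param_dom" and ?N = "restrict_space borel (frontier (egg_domain m))"
  note [measurable] = measurable_egg_param[OF m]
  have area: "area_element (egg_param m) u = egg_gradient m (egg_param m u)" if "u \<in> space ?M" for u
    using that area_element_egg_param[OF m, of "snd u" "fst u"] by (auto simp: space_restrict_space egg_param_dom_def)
  have [measurable]: "egg_gradient m \<in> borel_measurable ?N" "(\<lambda>p. weight_root m (snd p)) \<in> borel_measurable ?N"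
    by (intro borel_measurable_continuous_on_restrict continuous_on_egg_gradient
        continuous_on_compose2[OF continuous_on_weight_root[of UNIV]] continuous_intros; simp)+
  have areaM[measurable]: "(\<lambda>u. ennreal (area_element (egg_param m) u)) \<in> borel_measurable ?M"
    by (subst measurable_cong[where g = "\<lambda>u. ennreal (egg_gradient m (egg_param m u))"]) (simp_all add: area)
  have weightM[measurable]: "(\<lambda>p. ennreal (fefferman_weight m p)) \<in> borel_measurable ?N"
    by (subst fefferman_weight_egg[OF m, abs_def]) measurable
  have "fefferman_measure m = distr (density (density ?M (\<lambda>u. ennreal (area_element (egg_param m) u)))
      (\<lambda>u. ennreal (fefferman_weight m (egg_param m u)))) ?N (egg_param m)"
    unfolding fefferman_measure_def surface_measure_def by (rule density_distr) measurable
  also have "density (density ?M (\<lambda>u. ennreal (area_element (egg_param m) u))) (\<lambda>u. ennreal (fefferman_weight m (egg_param m u)))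
      = density ?M (\<lambda>u. ennreal (area_element (egg_param m) u) * ennreal (fefferman_weight m (egg_param m u)))"
    by (rule density_density_eq) measurable
  also have "\<dots> = density ?M (\<lambda>u. ennreal (weight_root m (snd u)))"
  proof (rule density_cong)
    show "AE u in ?M. ennreal (area_element (egg_param m) u) * ennreal (fefferman_weight m (egg_param m u)) = ennreal (weight_root m (snd u))"
    proof (rule AE_I2)
      fix u assume u: "u \<in> space ?M"
      have "egg_gradient m (egg_param m u) > 0"
        using u egg_gradient_pos[OF m egg_param_in_frontier[OF m]] by (auto simp: space_restrict_space)
      moreover have "snd (egg_param m u) = snd u"
        by (simp add: egg_param_def case_prod_unfold)
      ultimately show "ennreal (area_element (egg_param m) u) * ennreal (fefferman_weight m (egg_param m u)) = ennreal (weight_root m (snd u))"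
        by (simp add: area[OF u] fefferman_weight_egg[OF m] ennreal_mult'[symmetric])
    qed
    have "continuous_on UNIV (\<lambda>u :: real \<times> complex. weight_root m (snd u))"
      by (intro continuous_on_compose2[OF continuous_on_weight_root[of UNIV]] continuous_intros) auto
    then have "(\<lambda>u :: real \<times> complex. weight_root m (snd u)) \<in> borel_measurable ?M"
      by (intro measurable_restrict_space1) (simp add: borel_measurable_continuous_onI)
    then show "(\<lambda>u. ennreal (weight_root m (snd u))) \<in> borel_measurable ?M"
      by measurable
  qed measurable
  finally show ?thesis .
qed

section \<open>Finiteness and moments of the Fefferman measure\<close>

lemma sets_fefferman_measure[simp, measurable_cong]:
  "sets (fefferman_measure m) = sets (restrict_space borel (frontier (egg_domain m)))"
  by (simp add: fefferman_measure_def surface_measure_def)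

lemma space_fefferman_measure[simp]: "space (fefferman_measure m) = frontier (egg_domain m)"
  by (simp add: fefferman_measure_def surface_measure_def space_restrict_space)

lemma measurable_weight_root[measurable]: "weight_root m \<in> borel_measurable borel"
  by (intro borel_measurable_continuous_onI continuous_on_weight_root)

lemma measurable_weight_root_snd: "(\<lambda>u :: real \<times> complex. weight_root m (snd u)) \<in> borel_measurable borel"
  by (intro borel_measurable_continuous_onI continuous_on_compose2[OF continuous_on_weight_root[of UNIV]] continuous_intros) auto

lemma emeasure_egg_param_dom: "emeasure lborel egg_param_dom < \<infinity>"
proof -
  have "emeasure lborel egg_param_dom \<le> emeasure lborel ({-pi..pi} \<times> cball (0::complex) 1)"
    by (intro emeasure_mono) (auto simp: egg_param_dom_def intro!: borel_closed closed_Times)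
  also have "\<dots> < \<infinity>"
    by (intro emeasure_compact_finite compact_Times) auto
  finally show ?thesis .
qed

lemma weight_root_le: "norm w \<le> 1 \<Longrightarrow> weight_root m w \<le> root 3 (real m ^ 2)"
  unfolding weight_root_def by (intro real_root_le_mono mult_left_le power_le_one) auto

lemma finite_fefferman_measure:
  assumes m: "m \<ge> 1"
  shows "finite_measure (fefferman_measure m)"
proof
  let ?M = "restrict_space lborel egg_param_dom" and ?N = "restrict_space borel (frontier (egg_domain m))"
  note [measurable] = measurable_egg_param[OF m]
  have [measurable]: "(\<lambda>u :: real \<times> complex. weight_root m (snd u)) \<in> borel_measurable ?M"
    by (intro measurable_restrict_space1) (simp add: measurable_weight_root_snd)
  have "emeasure (fefferman_measure m) (frontier (egg_domain m))
      = emeasure (density ?M (\<lambda>u. ennreal (weight_root m (snd u)))) (egg_param m -` frontier (egg_domain m) \<inter> egg_param_dom)"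
    unfolding fefferman_measure_eq[OF m]
    by (subst emeasure_distr) (auto simp: space_restrict_space sets_restrict_space)
  also have "egg_param m -` frontier (egg_domain m) \<inter> egg_param_dom = space ?M"
    using egg_param_in_frontier[OF m] by (auto simp: space_restrict_space)
  also have "emeasure (density ?M (\<lambda>u. ennreal (weight_root m (snd u)))) (space ?M)
      = (\<integral>\<^sup>+u. ennreal (weight_root m (snd u)) \<partial>?M)"
    by (subst emeasure_density[OF _ sets.top]) (simp, intro nn_integral_cong, simp)
  also have "\<dots> \<le> (\<integral>\<^sup>+u. ennreal (root 3 (real m ^ 2)) \<partial>?M)"
    by (intro nn_integral_mono ennreal_leI weight_root_le)
       (auto simp: space_restrict_space egg_param_dom_def)
  also have "\<dots> = ennreal (root 3 (real m ^ 2)) * emeasure lborel egg_param_dom"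
    by (simp add: emeasure_restrict_space space_restrict_space)
  also have "\<dots> < \<infinity>"
    using emeasure_egg_param_dom by (simp add: ennreal_mult_less_top)
  finally show "emeasure (fefferman_measure m) (space (fefferman_measure m)) \<noteq> \<infinity>"
    by simp
qed

text \<open>Fubini in the coordinates (\<phi>, w); the factor 2 pi comes from normalising the angle
  measure.\<close>

lemma integral_fefferman_measure:
  fixes G :: "C2 \<Rightarrow> complex"
  assumes m: "m \<ge> 1" and G: "continuous_on (egg_closure m) G"
  defines "\<Phi> \<equiv> \<lambda>w. (indicator (ball 0 1) w * weight_root m w) *\<^sub>R
    (\<integral>t. G (cis t * of_real (sqrt (1 - norm w ^ (2 * m))), w) \<partial>angle_measure)"
  shows "integrable lborel \<Phi>"
    and "(\<integral>p. G p \<partial>fefferman_measure m) = of_real (2 * pi) * (\<integral>w. \<Phi> w \<partial>lborel)"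
proof -
  let ?P = "\<lambda>t w. (cis t * of_real (sqrt (1 - norm w ^ (2 * m))), w) :: C2"
  let ?M = "restrict_space lborel egg_param_dom" and ?N = "restrict_space borel (frontier (egg_domain m))"
  note [measurable] = measurable_egg_param[OF m]
  have [measurable]: "G \<in> borel_measurable ?N"
    using G frontier_subset_egg_closure[OF m]
    by (intro borel_measurable_continuous_on_restrict) (rule continuous_on_subset)
  have [measurable]: "(\<lambda>u :: real \<times> complex. weight_root m (snd u)) \<in> borel_measurable ?M"
    by (intro measurable_restrict_space1) (simp add: measurable_weight_root_snd)
  define H where "H = (\<lambda>(t, w). (indicator {-pi<..pi} t * (indicator (ball 0 1) w * weight_root m w)) *\<^sub>R
      G (?P t w))"
  have closure: "?P t w \<in> egg_closure m" if "norm w < 1" for t w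
    using that by (simp add: egg_closure_def norm_mult power_le_one)
  have H: "H u = indicator egg_param_dom u *\<^sub>R (weight_root m (snd u) *\<^sub>R G (egg_param m u))" for u
    by (cases u) (auto simp: H_def egg_param_def egg_param_dom_def indicator_def mult.commute)
  obtain B where B: "\<And>p. p \<in> egg_closure m \<Longrightarrow> norm (G p) \<le> B"
    using compact_continuous_image[OF G compact_egg_closure[OF m]]
    by (meson bounded_iff compact_imp_bounded imageI)
  have Hint: "integrable (lborel \<Otimes>\<^sub>M lborel) H"
  proof -
    have hI: "integrable lborel (\<lambda>u. indicator egg_param_dom u * (root 3 (real m ^ 2) * B))"
      using emeasure_egg_param_dom by (intro integrable_mult_left) auto
    have hm: "H \<in> borel_measurable lborel"
    proof -
      have "continuous_on egg_param_dom (\<lambda>u. G (egg_param m u))"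
      proof (rule continuous_on_compose2[OF G])
        show "continuous_on egg_param_dom (egg_param m)"
          unfolding egg_param_def case_prod_unfold by (intro continuous_intros)
        show "egg_param m ` egg_param_dom \<subseteq> egg_closure m"
          using egg_param_in_frontier[OF m] frontier_subset_egg_closure[OF m] by blast
      qed
      then have "(\<lambda>u. indicator egg_param_dom u *\<^sub>R (weight_root m (snd u) *\<^sub>R G (egg_param m u))) \<in> borel_measurable borel"
        by (intro borel_measurable_continuous_on_indicator continuous_intros sets_egg_param_dom
          continuous_on_compose2[OF continuous_on_weight_root[of UNIV]]) auto
      then show ?thesis
        by (simp add: H[abs_def])
    qed
    have hb: "norm (H u) \<le> norm (indicator egg_param_dom u * (root 3 (real m ^ 2) * B))" for u
    proof (cases "u \<in> egg_param_dom")
      case True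
      then have "norm (weight_root m (snd u) *\<^sub>R G (egg_param m u)) \<le> root 3 (real m ^ 2) * B"
        using weight_root_le[of "snd u" m] egg_param_in_frontier[OF m True] frontier_subset_egg_closure[OF m]
        by (auto simp: weight_root_nonneg egg_param_dom_def intro!: mult_mono B)
      then show ?thesis
        using True unfolding H by (simp add: indicator_def)
    qed (simp add: H)
    have "integrable lborel H"
      by (rule Bochner_Integration.integrable_bound[OF hI hm AE_I2[OF hb]])
    then show ?thesis
      by (simp add: lborel_prod)
  qed
  then have Hint': "integrable (lborel \<Otimes>\<^sub>M lborel) (\<lambda>(t, w). H (t, w))"
    by simp
  have inner: "(\<integral>t. H (t, w) \<partial>lborel) = of_real (2 * pi) * \<Phi> w" for w
  proof (cases "norm w < 1")
    case True
    have c: "continuous_on UNIV (\<lambda>t. G (?P t w))"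
      using closure[OF True] by (intro continuous_on_compose2[OF G] continuous_intros) auto
    then have [measurable]: "(\<lambda>t. G (?P t w)) \<in> borel_measurable borel"
      by (rule borel_measurable_continuous_onI)
    have "(\<integral>t. H (t, w) \<partial>lborel) = (\<integral>t. weight_root m w *\<^sub>R (indicator {-pi..pi} t *\<^sub>R G (?P t w)) \<partial>lborel)"
    proof (rule integral_cong_AE)
      \<comment> \<open>The parameter interval is half-open, the angle measure lives on the closed
        one; they differ in the point -pi.\<close>
      show "AE t in lborel. H (t, w) = weight_root m w *\<^sub>R (indicator {-pi..pi} t *\<^sub>R G (?P t w))"
        using AE_lborel_singleton[of "-pi"] by eventually_elim (auto simp: H_def True indicator_def)
    qed (simp_all add: H_def)
    also have "\<dots> = weight_root m w *\<^sub>R (LINT t:{-pi..pi}|lborel. G (?P t w))"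
      unfolding set_lebesgue_integral_def by (rule integral_scaleR_right)
    also have "(LINT t:{-pi..pi}|lborel. G (?P t w))
        = (2 * pi) *\<^sub>R (\<integral>t. G (?P t w) \<partial>angle_measure)"
      by (subst integral_angle_measure) simp_all
    finally show ?thesis
      by (simp add: \<Phi>_def True scaleR_conv_of_real mult_ac)
  qed (simp add: H_def \<Phi>_def)
  have "integrable lborel (\<lambda>w. \<integral>t. H (t, w) \<partial>lborel)"
    using lborel_pair.integrable_snd[OF Hint'] by simp
  then have "integrable lborel (\<lambda>w. of_real (1 / (2 * pi)) * (of_real (2 * pi) * \<Phi> w))"
    unfolding inner by (rule integrable_mult_right)
  then show "integrable lborel \<Phi>"
    by (simp add: mult.assoc[symmetric] flip: of_real_mult)
  have "(\<integral>p. G p \<partial>fefferman_measure m) = (\<integral>u. G (egg_param m u) \<partial>density ?M (\<lambda>u. ennreal (weight_root m (snd u))))"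
    unfolding fefferman_measure_eq[OF m] by (rule integral_distr) measurable
  also have "\<dots> = (\<integral>u. weight_root m (snd u) *\<^sub>R G (egg_param m u) \<partial>?M)"
    by (rule integral_density) (auto simp: weight_root_nonneg)
  also have "\<dots> = (\<integral>u. H u \<partial>lborel)"
    by (subst integral_restrict_space) (simp, simp only: H[symmetric])
  also have "\<dots> = (\<integral>w. (\<integral>t. H (t, w) \<partial>lborel) \<partial>lborel)"
    using lborel_pair.integral_snd[OF Hint'] by (simp add: lborel_prod)
  also have "\<dots> = of_real (2 * pi) * (\<integral>w. \<Phi> w \<partial>lborel)"
    unfolding inner by (rule integral_mult_right_zero)
  finally show "(\<integral>p. G p \<partial>fefferman_measure m) = of_real (2 * pi) * (\<integral>w. \<Phi> w \<partial>lborel)" .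
qed

text \<open>The origin is excluded because \<open>0 powr 0\<close> is 0, whereas for m = 1 the
  weight there is 1.\<close>

lemma weight_root_eq_powr:
  assumes "m \<ge> 1" "w \<noteq> 0"
  shows "weight_root m w = real m powr (2 / 3) * (norm w ^ 2) powr ((real m - 1) / 3)"
proof -
  have w: "norm w ^ 2 > 0"
    using assms by simp
  have "weight_root m w = (real m ^ 2 * (norm w ^ 2) ^ (m - 1)) powr (1 / 3)"
    unfolding weight_root_def norm_square_power by (subst root_powr_inverse) (use assms in auto)
  also have "\<dots> = (real m ^ 2) powr (1 / 3) * ((norm w ^ 2) ^ (m - 1)) powr (1 / 3)"
    by (rule powr_mult)
  also have "(real m ^ 2) powr (1 / 3) = real m powr (2 / 3)"
    using assms by (simp add: powr_powr flip: powr_numeral)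
  also have "((norm w ^ 2) ^ (m - 1)) powr (1 / 3) = (norm w ^ 2) powr ((real m - 1) / 3)"
    using assms(1) by (simp only: powr_realpow[OF w, symmetric] powr_powr of_nat_diff) simp
  finally show ?thesis .
qed

text \<open>The dilated function is continuous up to the boundary. Averaging over the z-angle of the
  parametrisation and, by rotation invariance, over the w-angle produces the torus mean at r times
  the boundary point, hence the factor r^(j+k); the rest is a radial integral.\<close>

lemma fefferman_moment:
  assumes m: "m \<ge> 1" and f: "continuous_on (egg_domain m) f" and r: "0 \<le> r" "r < 1"
    and mean: "\<And>z w. (z, w) \<in> egg_domain m \<Longrightarrow> torus_mean f j k z w = a * z ^ j * w ^ k"
  shows "(\<integral>p. cnj (fst p ^ j * snd p ^ k) * f (r *\<^sub>R p) \<partial>fefferman_measure m)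
    = a * of_real (r ^ (j + k) * (2 * pi ^ 2 * real m powr (2 / 3) * radial_moment m (real k + (real m + 2) / 3) j))"
proof -
  define G where "G = (\<lambda>p. cnj (fst p ^ j * snd p ^ k) * f (r *\<^sub>R p))"
  define R where "R = (\<lambda>w :: complex. sqrt (1 - norm w ^ (2 * m)))"
  define \<Phi> where "\<Phi> = (\<lambda>w. (indicator (ball 0 1) w * weight_root m w) *\<^sub>R (\<integral>t. G (cis t * of_real (R w), w) \<partial>angle_measure))"
  have G: "continuous_on (egg_closure m) G"
    unfolding G_def
    by (intro continuous_intros continuous_on_compose2[OF f]) (use egg_scale[OF m _ r] in auto)
  have I: "integrable lborel \<Phi>"
    "(\<integral>p. G p \<partial>fefferman_measure m) = of_real (2 * pi) * (\<integral>w. \<Phi> w \<partial>lborel)"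
    using integral_fefferman_measure[OF m G] by (simp_all add: \<Phi>_def R_def)
  \<comment> \<open>The exponent p - 1 = k + (m-1)/3 collects t^k from the monomials and t^((m-1)/3)
    from the weight.\<close>
  define p where "p = real k + (real m + 2) / 3"
  have p: "p > 0"
    by (auto simp: p_def intro!: add_nonneg_pos)
  define h where "h = (\<lambda>t. indicator {0<..<1} t * (t powr (p - 1) * (1 - t ^ m) ^ j) :: real)"
  have "(\<integral>w. \<Phi> w \<partial>lborel) = (\<integral>w. (\<integral>s. \<Phi> (cis s * w) \<partial>angle_measure) \<partial>lborel)"
  proof (rule integral_average)
    have "continuous_on UNIV (\<lambda>x :: real \<times> complex. cis (fst x) * snd x)"
      by (intro continuous_intros)
    then have "(\<lambda>x :: real \<times> complex. cis (fst x) * snd x) \<in> borel_measurable (borel \<Otimes>\<^sub>M borel)"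
      by (simp add: borel_prod borel_measurable_continuous_onI)
    moreover have "sets (angle_measure \<Otimes>\<^sub>M (lborel :: complex measure)) = sets (borel \<Otimes>\<^sub>M borel)"
      by (intro sets_pair_measure_cong) auto
    ultimately show "(\<lambda>(s, w). cis s * w) \<in> angle_measure \<Otimes>\<^sub>M lborel \<rightarrow>\<^sub>M lborel"
      using measurable_cong_sets[OF _ sets_lborel] by (auto simp: case_prod_unfold)
    show "distr lborel lborel ((*) (cis s)) = lborel" for s
      using lborel_rotate(1)[of s] by (simp cong: distr_cong)
  qed (use I(1) in \<open>auto intro: sigma_finite_lborel angle_measure.finite_measure_axioms\<close>)
  also have "\<dots> = (\<integral>w. a * of_real (r ^ (j + k) * real m powr (2 / 3) * h (norm (w :: complex) ^ 2)) \<partial>lborel)"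
  proof (rule integral_cong_AE)
    have eq: "(\<integral>s. \<Phi> (cis s * w) \<partial>angle_measure)
        = a * of_real (r ^ (j + k) * (indicator (ball 0 1) w * weight_root m w * ((1 - norm w ^ (2 * m)) ^ j * (norm w ^ 2) ^ k)))" for w
    proof (cases "norm w < 1")
      case True
      have D: "(of_real (r * R w), of_real r * w) \<in> egg_domain m"
        using egg_scale[OF m _ r, of "(of_real (R w), w)"] True
        by (auto simp: egg_closure_def R_def norm_mult power_le_one scaleR_conv_of_real)
      have Rw: "R w ^ 2 = 1 - norm w ^ (2 * m)"
        using True by (simp add: R_def power_le_one)
      have rot: "weight_root m (cis s * w) = weight_root m w" "R (cis s * w) = R w" for s
        by (simp_all add: weight_root_def R_def norm_mult)
      have "(\<integral>t. G (cis t * of_real (R w), cis s * w) \<partial>angle_measure)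
        = cnj (of_real (R w) ^ j * w ^ k) * ((\<integral>t. f (cis t * of_real (r * R w), cis s * (of_real r * w)) * cis (- (real j * t)) \<partial>angle_measure)
              * cis (- (real k * s)))" for s
      proof -
        have "G (cis t * of_real (R w), cis s * w)
            = (cnj (of_real (R w) ^ j * w ^ k) * cis (- (real k * s))) * (f (cis t * of_real (r * R w), cis s * (of_real r * w)) * cis (- (real j * t)))" for t
          by (simp add: G_def power_mult_distrib Complex.DeMoivre cis_cnj scaleR_conv_of_real mult_ac)
        then have "(\<integral>t. G (cis t * of_real (R w), cis s * w) \<partial>angle_measure)
            = (\<integral>t. (cnj (of_real (R w) ^ j * w ^ k) * cis (- (real k * s))) * (f (cis t * of_real (r * R w), cis s * (of_real r * w)) * cis (- (real j * t))) \<partial>angle_measure)"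
          by (rule Bochner_Integration.integral_cong[OF refl])
        also have "\<dots> = (cnj (of_real (R w) ^ j * w ^ k) * cis (- (real k * s))) *
            (\<integral>t. f (cis t * of_real (r * R w), cis s * (of_real r * w)) * cis (- (real j * t)) \<partial>angle_measure)"
          by (rule integral_mult_right_zero)
        finally show ?thesis
          by (simp only: mult_ac)
      qed
      then have "\<Phi> (cis s * w) = (of_real (weight_root m w) * cnj (of_real (R w) ^ j * w ^ k))
          * ((\<integral>t. f (cis t * of_real (r * R w), cis s * (of_real r * w)) * cis (- (real j * t)) \<partial>angle_measure) * cis (- (real k * s)))" for s
        using True by (simp add: \<Phi>_def rot norm_mult scaleR_conv_of_real)
      then have "(\<integral>s. \<Phi> (cis s * w) \<partial>angle_measure)
          = (of_real (weight_root m w) * cnj (of_real (R w) ^ j * w ^ k)) * torus_mean f j k (of_real (r * R w)) (of_real r * w)"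
        unfolding torus_mean_def by (simp only: integral_mult_right_zero)
      also have "\<dots> = (of_real (weight_root m w) * cnj (of_real (R w) ^ j * w ^ k)) * (a * of_real (r * R w) ^ j * (of_real r * w) ^ k)"
        by (simp only: mean[OF D])
      also have "\<dots> = a * (of_real (r ^ (j + k) * weight_root m w * (R w ^ 2) ^ j) * (w * cnj w) ^ k)"
        by (simp add: power_mult_distrib power_add power2_eq_square mult_ac)
      also have "\<dots> = a * of_real (r ^ (j + k) * weight_root m w * ((R w ^ 2) ^ j * (norm w ^ 2) ^ k))"
        by (simp flip: complex_norm_square)
      finally show ?thesis
        using True by (simp add: Rw mult_ac)
    qed (simp add: \<Phi>_def norm_mult)
    show "AE w in lborel. (\<integral>s. \<Phi> (cis s * w) \<partial>angle_measure) = a * of_real (r ^ (j + k) * real m powr (2 / 3) * h (norm w ^ 2))"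
      using AE_complex_nonzero
    proof eventually_elim
      case (elim w)
      have "indicator (ball 0 1) w * weight_root m w * ((1 - norm w ^ (2 * m)) ^ j * (norm w ^ 2) ^ k)
          = real m powr (2 / 3) * h (norm w ^ 2)"
      proof (cases "norm w < 1")
        case True
        have "p - 1 = (real m - 1) / 3 + real k"
          by (simp add: p_def field_simps)
        then have "(norm w ^ 2) powr (p - 1) = (norm w ^ 2) powr ((real m - 1) / 3) * (norm w ^ 2) ^ k"
          using elim by (simp only: powr_add) (simp add: powr_realpow)
        moreover have "norm w ^ 2 \<in> {0<..<1}"
          using True elim by (simp add: power_less_one_iff)
        ultimately show ?thesis
          using True unfolding norm_square_power by (simp add: h_def weight_root_eq_powr[OF m elim])
      qed (auto simp: h_def indicator_def power_less_one_iff)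
      then show ?case
        unfolding eq by (simp only: mult.assoc)
    qed
    show "(\<lambda>w. \<integral>s. \<Phi> (cis s * w) \<partial>angle_measure) \<in> borel_measurable lborel"
    proof -
      have "(\<lambda>w :: complex. indicator (ball 0 1) w * weight_root m w * ((1 - norm w ^ (2 * m)) ^ j * (norm w ^ 2) ^ k)) \<in> borel_measurable borel"
        by (intro borel_measurable_times borel_measurable_indicator measurable_weight_root
            borel_measurable_continuous_onI continuous_intros) auto
      from measurable_compose[OF borel_measurable_times[OF borel_measurable_const this] borel_measurable_of_real]
      have "(\<lambda>w. \<integral>s. \<Phi> (cis s * w) \<partial>angle_measure) \<in> borel_measurable borel"
        unfolding eq by (intro borel_measurable_times borel_measurable_const)
      then show ?thesis
        by simp
    qed
    show "(\<lambda>w. a * of_real (r ^ (j + k) * real m powr (2 / 3) * h (norm w ^ 2))) \<in> borel_measurable lborel"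
      unfolding h_def by measurable
  qed
  also have "\<dots> = a * of_real (r ^ (j + k) * real m powr (2 / 3) * (\<integral>w. h (norm (w :: complex) ^ 2) \<partial>lborel))"
    by (simp only: integral_mult_right_zero Bochner_Integration.integral_complex_of_real)
  also have "(\<integral>w. h (norm (w :: complex) ^ 2) \<partial>lborel) = pi * radial_moment m p j"
    unfolding h_def by (rule complex_radial_moment(2)[OF m p])
  finally have "(\<integral>w. \<Phi> w \<partial>lborel) = a * of_real (r ^ (j + k) * real m powr (2 / 3) * (pi * radial_moment m p j))" .
  then show ?thesis
    unfolding G_def[symmetric] I(2) by (simp add: p_def power2_eq_square mult_ac)
qed

section \<open>Approach regions\<close>

definition egg_normal :: "nat \<Rightarrow> C2 \<Rightarrow> C2" where
  "egg_normal m \<xi> = (1 / egg_gradient m \<xi>) *\<^sub>R (fst \<xi>, (real m * norm (snd \<xi>) ^ (2 * (m - 1))) *\<^sub>R snd \<xi>)"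

lemma unit_normal_egg:
  assumes m: "m \<ge> 1"
  shows "unit_normal m \<xi> = egg_normal m \<xi>"
  unfolding unit_normal_def Let_def egg_rho_def[symmetric] rho_gradient_norm_egg[OF m] egg_normal_def
  by (simp add: egg_rho_derivatives norm_square_power scaleR_conv_of_real flip: complex_norm_square)

lemma norm_egg_normal:
  assumes m: "m \<ge> 1" and x: "\<xi> \<in> frontier (egg_domain m)"
  shows "norm (egg_normal m \<xi>) = 1"
proof -
  have e: "norm w ^ (2 * (m - Suc 0)) * norm w = norm w ^ (2 * m - Suc 0)" for w :: complex
    using m by (cases m) auto
  have "norm (fst \<xi>, (real m * norm (snd \<xi>) ^ (2 * (m - 1))) *\<^sub>R snd \<xi>) = egg_gradient m \<xi>"
    unfolding norm_Pair egg_gradient_def norm_scaleR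
    by (simp add: abs_mult mult.assoc e)
  then show ?thesis
    unfolding egg_normal_def norm_scaleR using egg_gradient_pos[OF m x] by simp
qed

lemma continuous_on_egg_normal:
  assumes m: "m \<ge> 1"
  shows "continuous_on (frontier (egg_domain m)) (egg_normal m)"
  unfolding egg_normal_def
  by (intro continuous_intros continuous_on_egg_gradient) (use egg_gradient_pos[OF m] in force)

lemma le_infdistI: "A \<noteq> {} \<Longrightarrow> (\<And>q. q \<in> A \<Longrightarrow> c \<le> dist p q) \<Longrightarrow> c \<le> infdist p A"
  by (simp add: infdist_def cINF_greatest)

lemma infdist_tangent_plane:
  assumes m: "m \<ge> 1" and x: "\<xi> \<in> frontier (egg_domain m)"
  shows "infdist p (tangent_plane m \<xi>) = \<bar>(p - \<xi>) \<bullet> egg_normal m \<xi>\<bar>"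
proof -
  define n where "n = egg_normal m \<xi>"
  have n: "n \<bullet> n = 1"
    using norm_egg_normal[OF m x] by (simp add: n_def norm_eq_1)
  have plane: "tangent_plane m \<xi> = {q. (q - \<xi>) \<bullet> n = 0}"
    by (simp add: tangent_plane_def unit_normal_egg[OF m] n_def)
  define q where "q = p - ((p - \<xi>) \<bullet> n) *\<^sub>R n"
  have q: "q \<in> tangent_plane m \<xi>"
    using n by (simp add: plane q_def algebra_simps)
  have "infdist p (tangent_plane m \<xi>) \<le> dist p q"
    using q by (rule infdist_le)
  also have "dist p q = \<bar>(p - \<xi>) \<bullet> n\<bar>"
    using norm_egg_normal[OF m x] by (simp add: q_def dist_norm n_def)
  finally have "infdist p (tangent_plane m \<xi>) \<le> \<bar>(p - \<xi>) \<bullet> n\<bar>" .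
  moreover have "\<bar>(p - \<xi>) \<bullet> n\<bar> \<le> infdist p (tangent_plane m \<xi>)"
  proof (rule le_infdistI)
    show "tangent_plane m \<xi> \<noteq> {}"
      using q by auto
    fix q assume "q \<in> tangent_plane m \<xi>"
    then have "(p - \<xi>) \<bullet> n = (p - q) \<bullet> n"
      by (simp add: plane algebra_simps)
    then show "\<bar>(p - \<xi>) \<bullet> n\<bar> \<le> dist p q"
      using Cauchy_Schwarz_ineq2[of "p - q" n] norm_egg_normal[OF m x] by (simp add: n_def dist_norm)
  qed
  ultimately show ?thesis
    by (simp add: n_def)
qed

text \<open>A second-order Taylor remainder by induction: from m to m + 1 the remainder E becomes y
  E + m x^(m-1) (y - x)^2, and m^2 + m <= (m + 1)^2.\<close>

lemma power_tangent_bound: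
  fixes x y :: real
  assumes "0 \<le> x" "x \<le> 1" "0 \<le> y" "y \<le> 1"
  shows "y ^ m - x ^ m - real m * x ^ (m - 1) * (y - x) \<le> real m ^ 2 * (y - x) ^ 2"
proof (induction m)
  case (Suc m)
  define E where "E = y ^ m - x ^ m - real m * x ^ (m - 1) * (y - x)"
  have xm: "real m * x ^ (m - 1) * x = real m * x ^ m"
    by (cases m) auto
  have "y ^ Suc m - x ^ Suc m - real (Suc m) * x ^ (Suc m - 1) * (y - x) = y * E + real m * x ^ (m - 1) * (y - x) ^ 2 + (real m * x ^ (m - 1) * x - real m * x ^ m) * (y - x)"
    by (simp add: E_def power2_eq_square algebra_simps)
  also have "\<dots> = y * E + real m * x ^ (m - 1) * (y - x) ^ 2"
    unfolding xm by simp
  also have "\<dots> \<le> real m ^ 2 * (y - x) ^ 2 + real m * (y - x) ^ 2"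
  proof (rule add_mono)
    have "y * E \<le> y * (real m ^ 2 * (y - x) ^ 2)"
      using Suc assms by (intro mult_left_mono) (auto simp: E_def)
    also have "\<dots> \<le> 1 * (real m ^ 2 * (y - x) ^ 2)"
      using assms by (intro mult_right_mono) auto
    finally show "y * E \<le> real m ^ 2 * (y - x) ^ 2"
      by simp
    show "real m * x ^ (m - 1) * (y - x) ^ 2 \<le> real m * (y - x) ^ 2"
      using assms by (intro mult_right_mono mult_left_le power_le_one) auto
  qed
  also have "\<dots> \<le> real (Suc m) ^ 2 * (y - x) ^ 2"
    unfolding distrib_right[symmetric] by (intro mult_right_mono) (simp add: power2_eq_square algebra_simps, simp)
  finally show ?case .
qed simp

text \<open>In the difference of the two boundary equations the linear part is 2 |d rho| times the
  normal component of q - \<xi>, and the rest is quadratic. So the boundary leaves its tangent plane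
  at most quadratically, uniformly in \<xi>. In m + 4 m^2 the first summand comes from |k|^2 in the
  increment of |w|^2, the second from (Y - X)^2 <= 4 |k|^2, with \<open>k\<close> the increment of
  w.\<close>

lemma frontier_tangent_bound:
  assumes m: "m \<ge> 1" and x: "\<xi> \<in> frontier (egg_domain m)" and q: "q \<in> frontier (egg_domain m)"
  shows "- (real m + 4 * real m ^ 2) * norm (q - \<xi>) ^ 2 \<le> 2 * egg_gradient m \<xi> * ((q - \<xi>) \<bullet> egg_normal m \<xi>)"
proof -
  obtain z w z' w' where zw: "\<xi> = (z, w)" "q = (z', w')"
    by (metis surj_pair)
  define h k where "h = z' - z" and "k = w' - w"
  have le1: "norm w \<le> 1" "norm w' \<le> 1"
    using egg_closure_norm[OF m] frontier_subset_egg_closure[OF m] x q zw by auto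
  have eqs: "norm z ^ 2 + norm w ^ (2 * m) = 1" "norm z' ^ 2 + norm w' ^ (2 * m) = 1"
    using x q by (auto simp: frontier_egg_domain_iff[OF m] zw)
  define X Y where "X = norm w ^ 2" and "Y = norm w' ^ 2"
  have YX: "Y - X = 2 * (w \<bullet> k) + norm k ^ 2"
    by (simp add: X_def Y_def k_def power2_norm_eq_inner algebra_simps inner_commute)
  have "\<bar>norm w' - norm w\<bar> \<le> norm k"
    by (simp add: k_def norm_triangle_ineq3)
  then have "\<bar>Y - X\<bar> \<le> norm k * 2"
  proof -
    have "\<bar>Y - X\<bar> = \<bar>norm w' - norm w\<bar> * (norm w' + norm w)"
      by (simp add: X_def Y_def power2_eq_square square_diff_square_factored abs_mult mult.commute)
    also have "\<dots> \<le> norm k * 2"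
      using le1 \<open>\<bar>norm w' - norm w\<bar> \<le> norm k\<close> by (intro mult_mono) auto
    finally show ?thesis .
  qed
  then have YX2: "(Y - X) ^ 2 \<le> 4 * norm k ^ 2"
    using power_mono[of "\<bar>Y - X\<bar>" "norm k * 2" 2] by (simp add: power_mult_distrib)
  have X1: "0 \<le> X" "X \<le> 1" "0 \<le> Y" "Y \<le> 1"
    using le1 by (auto simp: X_def Y_def power_le_one)
  have "Y ^ m - X ^ m \<le> real m * X ^ (m - 1) * (2 * (w \<bullet> k) + norm k ^ 2) + real m ^ 2 * (Y - X) ^ 2"
    using power_tangent_bound[OF X1, of m] unfolding YX[symmetric] by simp
  also have "\<dots> \<le> real m * X ^ (m - 1) * 2 * (w \<bullet> k) + (real m * norm k ^ 2 + real m ^ 2 * (4 * norm k ^ 2))"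
  proof -
    have "real m * X ^ (m - 1) * norm k ^ 2 \<le> real m * norm k ^ 2"
      using X1 by (intro mult_right_mono mult_left_le power_le_one) auto
    moreover have "real m ^ 2 * (Y - X) ^ 2 \<le> real m ^ 2 * (4 * norm k ^ 2)"
      using YX2 by (intro mult_left_mono) auto
    ultimately show ?thesis
      by (simp add: algebra_simps)
  qed
  finally have w: "Y ^ m - X ^ m \<le> 2 * (real m * X ^ (m - 1) * (w \<bullet> k)) + (real m + 4 * real m ^ 2) * norm k ^ 2"
    by (simp add: algebra_simps)
  have z: "norm z' ^ 2 - norm z ^ 2 = 2 * (z \<bullet> h) + norm h ^ 2"
    by (simp add: h_def power2_norm_eq_inner algebra_simps inner_commute)
  have "Y ^ m = norm w' ^ (2 * m)" "X ^ m = norm w ^ (2 * m)" "X ^ (m - 1) = norm w ^ (2 * (m - 1))"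
    by (simp_all add: X_def Y_def norm_square_power)
  then have sum: "0 \<le> 2 * (z \<bullet> h + real m * norm w ^ (2 * (m - 1)) * (w \<bullet> k)) + (norm h ^ 2 + (real m + 4 * real m ^ 2) * norm k ^ 2)"
    using w z eqs by simp
  have "norm h ^ 2 * 1 \<le> norm h ^ 2 * (real m + 4 * real m ^ 2)"
    using m by (intro mult_left_mono) (auto intro: order_trans[of 1 "real m"])
  then have bound: "norm h ^ 2 + (real m + 4 * real m ^ 2) * norm k ^ 2 \<le> (real m + 4 * real m ^ 2) * norm (q - \<xi>) ^ 2"
    by (simp add: zw norm_Pair h_def k_def algebra_simps)
  have eq: "egg_gradient m \<xi> * ((q - \<xi>) \<bullet> egg_normal m \<xi>) = z \<bullet> h + real m * norm w ^ (2 * (m - 1)) * (w \<bullet> k)"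
    using egg_gradient_pos[OF m x] by (simp only: egg_normal_def) (simp add: zw h_def k_def inner_commute field_simps)
  have "- x \<le> 2 * P" if "0 \<le> 2 * P + S" "S \<le> x" for x P S :: real
    using that by linarith
  from this[OF sum bound] show ?thesis
    by (simp only: mult.assoc eq minus_mult_left)
qed

text \<open>The product of |d rho| and the normal component of \<xi> is |z|^2 + m |w|^(2m) >= 1; as
  these factors are at most m + 1 and 2, both lower bounds follow. The last claim holds since each
  coordinate of the normal is a real multiple of that of \<xi>.\<close>

lemma frontier_dilation_bounds:
  assumes m: "m \<ge> 1" and x: "\<xi> \<in> frontier (egg_domain m)"
  shows "norm \<xi> \<le> 2" "egg_gradient m \<xi> \<ge> 1 / 2" "\<xi> \<bullet> egg_normal m \<xi> \<ge> 1 / (real m + 1)"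
    and "bilinear_dot \<xi> (map_prod cnj cnj (egg_normal m \<xi>)) = of_real (\<xi> \<bullet> egg_normal m \<xi>)"
proof -
  obtain z w where zw: "\<xi> = (z, w)"
    by fastforce
  have eq: "norm z ^ 2 + norm w ^ (2 * m) = 1"
    using x by (simp add: frontier_egg_domain_iff[OF m] zw)
  have le1: "norm z \<le> 1" "norm w \<le> 1"
    using egg_closure_norm[OF m] frontier_subset_egg_closure[OF m] x zw by auto
  show n2: "norm \<xi> \<le> 2"
    using norm_Pair_le[of z w] le1 by (simp add: zw)
  define L where "L = egg_gradient m \<xi>"
  have L: "L > 0"
    unfolding L_def by (rule egg_gradient_pos[OF m x])
  define \<tau> where "\<tau> = \<xi> \<bullet> egg_normal m \<xi>"
  have pw: "norm w ^ (2 * (m - Suc 0)) * norm w ^ 2 = norm w ^ (2 * m)"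
    using m by (cases m) (auto simp: power2_eq_square)
  have L\<tau>: "L * \<tau> = norm z ^ 2 + real m * norm w ^ (2 * m)"
    using L by (simp only: \<tau>_def egg_normal_def L_def[symmetric])
      (simp add: zw power2_norm_eq_inner[symmetric] mult.assoc pw distrib_left)
  also have "\<dots> \<ge> norm z ^ 2 + 1 * norm w ^ (2 * m)"
    using m by (intro add_left_mono mult_right_mono) auto
  finally have L1: "L * \<tau> \<ge> 1"
    using eq by simp
  have "\<tau> \<le> norm \<xi> * norm (egg_normal m \<xi>)"
    unfolding \<tau>_def by (rule norm_cauchy_schwarz)
  then have \<tau>2: "\<tau> \<le> 2"
    using n2 norm_egg_normal[OF m x] by simp
  then have "L * \<tau> \<le> L * 2"
    using L by (intro mult_left_mono) auto
  then show "egg_gradient m \<xi> \<ge> 1 / 2"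
    using L1 by (simp add: L_def)
  have "\<tau> > 0"
    using L1 L by (smt (verit) zero_less_mult_pos)
  have "L \<le> norm z + real m * norm w ^ (2 * m - 1)"
    unfolding L_def egg_gradient_def zw by (simp add: sqrt_sum_squares_le_sum)
  also have "\<dots> \<le> 1 + real m * 1"
    using le1 by (intro add_mono mult_left_mono power_le_one) auto
  finally have "L * \<tau> \<le> (real m + 1) * \<tau>"
    using \<open>\<tau> > 0\<close> by (intro mult_right_mono) auto
  then show "\<xi> \<bullet> egg_normal m \<xi> \<ge> 1 / (real m + 1)"
    using L1 by (simp add: \<tau>_def[symmetric] field_simps)
  have "bilinear_dot \<xi> (map_prod cnj cnj (egg_normal m \<xi>))
      = (z * cnj z + of_real (real m * norm w ^ (2 * (m - 1))) * (w * cnj w)) / of_real L"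
    unfolding bilinear_dot_def egg_normal_def L_def[symmetric]
    by (simp add: zw scaleR_conv_of_real add_divide_distrib mult_ac)
  also have "\<dots> = of_real ((norm z ^ 2 + real m * norm w ^ (2 * (m - 1)) * norm w ^ 2) / L)"
    by (simp flip: complex_norm_square)
  also have "(norm z ^ 2 + real m * norm w ^ (2 * (m - 1)) * norm w ^ 2) / L = \<tau>"
    using L\<tau> L by (simp add: mult.assoc pw) (simp add: field_simps)
  finally show "bilinear_dot \<xi> (map_prod cnj cnj (egg_normal m \<xi>)) = of_real (\<xi> \<bullet> egg_normal m \<xi>)"
    by (simp add: \<tau>_def)
qed

text \<open>For p = (1 - t) \<xi> the depth d below the tangent plane is of order t, while nearby
  boundary points stray from that plane only by order t^2. So the distance to the boundary is at
  least d / (1 + \<beta>). With \<beta> = \<alpha>/2 this gives the first approach inequality; the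
  second compares t^2 with t.\<close>

lemma dilation_in_approach_region:
  assumes m: "m \<ge> 1" and \<alpha>: "\<alpha> > 0"
  obtains t0 where "0 < t0" "t0 < 1"
    "\<And>\<xi> t. \<xi> \<in> frontier (egg_domain m) \<Longrightarrow> 0 < t \<Longrightarrow> t \<le> t0 \<Longrightarrow> (1 - t) *\<^sub>R \<xi> \<in> approach_region m \<alpha> \<xi>"
proof -
  define C where "C = real m + 4 * real m ^ 2"
  define \<beta> where "\<beta> = \<alpha> / 2"
  define \<mu> where "\<mu> = 1 / (real m + 1)"
  have pos: "C > 0" "\<beta> > 0" "\<mu> > 0"
    using m \<alpha> by (auto simp: C_def \<beta>_def \<mu>_def intro!: add_pos_nonneg)
  \<comment> \<open>The three entries ensure, in turn, t0 < 1, the estimate 16 C t^2 <= (\<beta> /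
    (1 + \<beta>)) d, and 4 t^2 < \<alpha> d / (1 + \<beta>), where \<mu> bounds the normal
    component of \<xi> from below.\<close>
  define t0 where "t0 = min (1 / 2) (min (\<beta> / (1 + \<beta>) * \<mu> / (16 * C)) (\<alpha> * \<mu> / (8 * (1 + \<beta>))))"
  have t0: "0 < t0" "t0 < 1"
    using pos \<alpha> by (auto simp: t0_def)
  have "(1 - t) *\<^sub>R \<xi> \<in> approach_region m \<alpha> \<xi>" if x: "\<xi> \<in> frontier (egg_domain m)" and t: "0 < t" "t \<le> t0" for \<xi> t
  proof -
    define p where "p = (1 - t) *\<^sub>R \<xi>"
    define n where "n = egg_normal m \<xi>"
    define \<tau> where "\<tau> = \<xi> \<bullet> n"
    define d where "d = t * \<tau>"
    have nn: "norm n = 1"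
      using norm_egg_normal[OF m x] by (simp add: n_def)
    note b = frontier_dilation_bounds[OF m x]
    have "\<tau> \<ge> \<mu>"
      using b(3) by (simp add: \<tau>_def n_def \<mu>_def)
    moreover have "\<tau> \<le> 2"
      using norm_cauchy_schwarz[of \<xi> n] b(1) nn by (simp add: \<tau>_def)
    ultimately have \<tau>: "\<tau> \<ge> \<mu>" "\<tau> > 0" "\<tau> \<le> 2"
      using pos(3) by auto
    have d: "d > 0" "d \<ge> t * \<mu>"
      using \<tau> t by (auto simp: d_def)
    have px: "p - \<xi> = - (t *\<^sub>R \<xi>)"
      by (simp add: p_def algebra_simps)
    have t1: "16 * C * t \<le> \<beta> / (1 + \<beta>) * \<mu>"
    proof -
      have "t \<le> \<beta> / (1 + \<beta>) * \<mu> / (16 * C)"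
        using t by (simp add: t0_def)
      then have "t * (16 * C) \<le> \<beta> / (1 + \<beta>) * \<mu>"
        using pos by (simp only: pos_le_divide_eq)
      then show ?thesis
        by (simp add: mult_ac)
    qed
    have t2: "8 * (1 + \<beta>) * t \<le> \<alpha> * \<mu>"
      using t pos by (auto simp: t0_def field_simps)
    \<comment> \<open>Only boundary points closer to p than d matter; these lie within 4 t of \<xi>,
      where the tangent bound costs at most 16 C t^2.\<close>
    have dist_front: "d / (1 + \<beta>) \<le> dist p q" if q: "q \<in> frontier (egg_domain m)" for q
    proof (cases "d \<le> dist p q")
      case True
      have "d / (1 + \<beta>) \<le> d"
        using pos d by (simp add: divide_le_eq)
      then show ?thesis
        using True by simp
    next
      case False
      have "norm (q - \<xi>) \<le> dist p q + norm (p - \<xi>)"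
        using norm_triangle_ineq[of "q - p" "p - \<xi>"] by (simp add: dist_norm norm_minus_commute)
      also have "\<dots> \<le> t * 2 + t * 2"
      proof (rule add_mono)
        show "dist p q \<le> t * 2"
        proof -
          have "t * \<tau> \<le> t * 2"
            using \<tau>(3) t by (intro mult_left_mono) auto
          then show ?thesis
            using False by (simp add: d_def)
        qed
        show "norm (p - \<xi>) \<le> t * 2"
          using b(1) t by (simp add: px)
      qed
      finally have "norm (q - \<xi>) \<le> 4 * t"
        by simp
      then have "norm (q - \<xi>) ^ 2 \<le> 16 * t ^ 2"
        using power_mono[of "norm (q - \<xi>)" "4 * t" 2] by (simp add: power_mult_distrib)
      then have "C * norm (q - \<xi>) ^ 2 \<le> C * (16 * t ^ 2)"
        using pos by (intro mult_left_mono) auto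
      moreover have "- C * norm (q - \<xi>) ^ 2 \<le> 2 * egg_gradient m \<xi> * ((q - \<xi>) \<bullet> n)"
        using frontier_tangent_bound[OF m x q] by (simp add: C_def n_def)
      ultimately have "- (16 * C * t ^ 2) \<le> 2 * egg_gradient m \<xi> * ((q - \<xi>) \<bullet> n)"
        by (simp add: algebra_simps)
      have "- (16 * C * t ^ 2) \<le> (q - \<xi>) \<bullet> n"
      proof (cases "(q - \<xi>) \<bullet> n \<ge> 0")
        case True
        then show ?thesis
          using pos by (intro order_trans[OF _ True]) simp
      next
        case False
        then have "2 * egg_gradient m \<xi> * ((q - \<xi>) \<bullet> n) \<le> 1 * ((q - \<xi>) \<bullet> n)"
          using b(2) by (intro mult_right_mono_neg) auto
        then show ?thesis
          using \<open>- (16 * C * t ^ 2) \<le> 2 * egg_gradient m \<xi> * ((q - \<xi>) \<bullet> n)\<close> by simp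
      qed
      moreover have "16 * C * t ^ 2 \<le> \<beta> / (1 + \<beta>) * d"
      proof -
        have "16 * C * t ^ 2 = (16 * C * t) * t"
          by (simp add: power2_eq_square)
        also have "\<dots> \<le> (\<beta> / (1 + \<beta>) * \<mu>) * t"
          using t1 t by (intro mult_right_mono) auto
        also have "\<dots> = \<beta> / (1 + \<beta>) * (t * \<mu>)"
          by simp
        also have "\<dots> \<le> \<beta> / (1 + \<beta>) * d"
          using d pos by (intro mult_left_mono) auto
        finally show ?thesis .
      qed
      moreover have "(q - p) \<bullet> n = (q - \<xi>) \<bullet> n + d"
        by (simp add: p_def d_def \<tau>_def algebra_simps)
      moreover have "(q - p) \<bullet> n \<le> dist p q"
        using norm_cauchy_schwarz[of "q - p" n] nn by (simp add: dist_norm norm_minus_commute)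
      ultimately have "d - \<beta> / (1 + \<beta>) * d \<le> dist p q"
        by linarith
      moreover have "d - \<beta> / (1 + \<beta>) * d = d / (1 + \<beta>)"
        using pos by (simp add: field_simps)
      ultimately show ?thesis
        by simp
    qed
    have "d / (1 + \<beta>) \<le> infdist p (frontier (egg_domain m))"
      using x dist_front by (intro le_infdistI) auto
    moreover have "d / (1 + \<beta>) \<le> infdist p (tangent_plane m \<xi>)"
    proof -
      have "infdist p (tangent_plane m \<xi>) = d"
        using d by (simp add: infdist_tangent_plane[OF m x] px n_def[symmetric] d_def \<tau>_def)
      then show ?thesis
        using pos d by (simp add: divide_le_eq)
    qed
    ultimately have \<delta>: "d / (1 + \<beta>) \<le> approach_dist m \<xi> p"
      by (simp add: approach_dist_def)
    have "p \<in> egg_domain m"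
      unfolding p_def using t t0 x frontier_subset_egg_closure[OF m] by (intro egg_scale[OF m]) auto
    moreover have "norm (bilinear_dot (\<xi> - p) (map_prod cnj cnj (unit_normal m \<xi>))) < (1 + \<alpha>) * approach_dist m \<xi> p"
    proof -
      have xp: "\<xi> - p = t *\<^sub>R \<xi>"
        by (simp add: p_def algebra_simps)
      have "bilinear_dot (\<xi> - p) (map_prod cnj cnj (unit_normal m \<xi>)) = of_real t * bilinear_dot \<xi> (map_prod cnj cnj (egg_normal m \<xi>))"
        unfolding xp by (simp add: bilinear_dot_def unit_normal_egg[OF m] scaleR_conv_of_real distrib_left)
      also have "\<dots> = of_real d"
        by (simp add: b(4) d_def \<tau>_def n_def)
      finally have "norm (bilinear_dot (\<xi> - p) (map_prod cnj cnj (unit_normal m \<xi>))) = d"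
        using d by simp
      also have "d < (1 + \<alpha>) * (d / (1 + \<beta>))"
        using pos d \<alpha> by (simp add: \<beta>_def field_simps)
      also have "\<dots> \<le> (1 + \<alpha>) * approach_dist m \<xi> p"
        using \<delta> \<alpha> by (intro mult_left_mono) auto
      finally show ?thesis .
    qed
    moreover have "norm (\<xi> - p) ^ 2 < \<alpha> * approach_dist m \<xi> p"
    proof -
      have "norm (\<xi> - p) \<le> t * 2"
        using b(1) t by (simp add: norm_minus_commute[of \<xi>] px)
      then have "norm (\<xi> - p) ^ 2 \<le> 4 * t ^ 2"
        using power_mono[of "norm (\<xi> - p)" "t * 2" 2] by (simp add: power_mult_distrib)
      also have "\<dots> < 8 * t * t"
        using t by (simp add: power2_eq_square)
      also have "8 * t * t \<le> \<alpha> * \<mu> / (1 + \<beta>) * t"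
        using t2 pos t by (intro mult_right_mono) (auto simp: field_simps)
      also have "\<dots> = \<alpha> * ((t * \<mu>) / (1 + \<beta>))"
        by simp
      also have "\<dots> \<le> \<alpha> * (d / (1 + \<beta>))"
        using d pos \<alpha> by (intro mult_left_mono divide_right_mono) auto
      also have "\<dots> \<le> \<alpha> * approach_dist m \<xi> p"
        using \<delta> \<alpha> by (intro mult_left_mono) auto
      finally show ?thesis .
    qed
    ultimately show ?thesis
      by (simp add: approach_region_def p_def)
  qed
  then show ?thesis
    using t0 that by blast
qed

text \<open>The set where the maximal function exceeds c is the union, over all p with |f p| > c, of
  the sets of \<xi> whose approach region contains p. For fixed p the approach inequalities are
  strict and continuous in \<xi>, so each of these sets is relatively open, and so is their
  union.\<close>

lemma measurable_nt_maximal: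
  assumes m: "m \<ge> 1"
  shows "nt_maximal m \<alpha> f \<in> borel_measurable (fefferman_measure m)"
proof (rule borel_measurableI_greater)
  fix c :: ennreal
  let ?S = "frontier (egg_domain m)"
  define V where "V = (\<lambda>p. {\<xi> \<in> ?S. p \<in> approach_region m \<alpha> \<xi>})"
  have "openin (top_of_set ?S) (V p)" for p
  proof (cases "p \<in> egg_domain m")
    case True
    define \<delta> where "\<delta> = (\<lambda>\<xi>. min (infdist p ?S) \<bar>(p - \<xi>) \<bullet> egg_normal m \<xi>\<bar>)"
    note cn = continuous_on_egg_normal[OF m]
    have c\<delta>: "continuous_on ?S \<delta>"
      unfolding \<delta>_def by (intro continuous_intros cn)
    define A where "A = (\<lambda>\<xi>. (1 + \<alpha>) * \<delta> \<xi> - norm (bilinear_dot (\<xi> - p) (map_prod cnj cnj (egg_normal m \<xi>))))"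
    define B where "B = (\<lambda>\<xi>. \<alpha> * \<delta> \<xi> - norm (\<xi> - p) ^ 2)"
    have "continuous_on ?S A"
      unfolding A_def bilinear_dot_def fst_map_prod snd_map_prod by (intro continuous_intros c\<delta> cn)
    then have "openin (top_of_set ?S) (?S \<inter> A -` {0<..})"
      by (rule continuous_openin_preimage_gen) simp
    moreover have "continuous_on ?S B"
      unfolding B_def by (intro continuous_intros c\<delta>)
    then have "openin (top_of_set ?S) (?S \<inter> B -` {0<..})"
      by (rule continuous_openin_preimage_gen) simp
    ultimately have "openin (top_of_set ?S) ((?S \<inter> A -` {0<..}) \<inter> (?S \<inter> B -` {0<..}))"
      by (rule openin_Int)
    also have "(?S \<inter> A -` {0<..}) \<inter> (?S \<inter> B -` {0<..}) = V p"
      using True by (auto simp: V_def A_def B_def approach_region_def approach_dist_def \<delta>_def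
          infdist_tangent_plane[OF m] unit_normal_egg[OF m])
    finally show ?thesis .
  next
    case False
    then have "V p = {}"
      by (auto simp: V_def approach_region_def)
    then show ?thesis
      by simp
  qed
  then have "openin (top_of_set ?S) (\<Union>p\<in>{p. c < ennreal (norm (f p))}. V p)"
    by (intro openin_Union) auto
  moreover have "{\<xi> \<in> space (fefferman_measure m). c < nt_maximal m \<alpha> f \<xi>} = (\<Union>p\<in>{p. c < ennreal (norm (f p))}. V p)"
    by (auto simp: nt_maximal_def less_SUP_iff V_def)
  ultimately obtain T where "open T" "{\<xi> \<in> space (fefferman_measure m). c < nt_maximal m \<alpha> f \<xi>} = ?S \<inter> T"
    by (auto simp: openin_open)
  then show "{\<xi> \<in> space (fefferman_measure m). c < nt_maximal m \<alpha> f \<xi>} \<in> sets (fefferman_measure m)"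
    by (auto simp: sets_restrict_space)
qed

section \<open>The Fefferman--Szego kernel\<close>

text \<open>With p = k + (m+2)/3 the squared norm of z^j w^k is 2 pi^2 m^(2/3) j! / (p (p/m + 1)_j);
  this is the reciprocal of its value at j = 0.\<close>

definition szego_weight :: "nat \<Rightarrow> nat \<Rightarrow> real" where
  "szego_weight m k = (real k + (real m + 2) / 3) / (2 * pi ^ 2 * real m powr (2 / 3))"

text \<open>Chosen so that adding k/m gives p/m + 1 for p = k + (m+2)/3.\<close>

definition szego_exponent :: "nat \<Rightarrow> real" where
  "szego_exponent m = 1 + (real m + 2) / (3 * real m)"

lemma egg_weight_szego:
  assumes "m \<ge> 1"
  shows "egg_weight m (szego_exponent m) (szego_weight m)"
proof (rule egg_weightI[where a = "(real m + 2) / 3" and b = 1 and c = "1 / (2 * pi ^ 2 * real m powr (2 / 3))"])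
  show "szego_weight m k \<le> 1 / (2 * pi ^ 2 * real m powr (2 / 3)) * ((real m + 2) / 3 + real k) * (1 + real k)" for k
  proof -
    have "szego_weight m k = 1 / (2 * pi ^ 2 * real m powr (2 / 3)) * ((real m + 2) / 3 + real k) * 1"
      by (simp add: szego_weight_def add.commute)
    also have "\<dots> \<le> 1 / (2 * pi ^ 2 * real m powr (2 / 3)) * ((real m + 2) / 3 + real k) * (1 + real k)"
      by (intro mult_left_mono) auto
    finally show ?thesis .
  qed
qed (use assms in \<open>auto simp: szego_weight_def szego_exponent_def intro!: add_pos_nonneg divide_nonneg_nonneg mult_nonneg_nonneg\<close>)

lemma szego_coef_moment:
  assumes m: "m \<ge> 1"
  shows "szego_weight m k * (pochhammer (szego_exponent m + k / m) j / fact j) *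
    (2 * pi ^ 2 * real m powr (2 / 3) * radial_moment m (real k + (real m + 2) / 3) j) = 1"
proof -
  define p where "p = real k + (real m + 2) / 3"
  have p: "p > 0"
    by (auto simp: p_def intro!: add_nonneg_pos)
  have e: "szego_exponent m + k / m = p / m + 1"
    using m by (simp add: szego_exponent_def p_def field_simps)
  define P where "P = pochhammer (p / m + 1) j"
  have P: "P > 0"
    using p m by (auto simp: P_def intro!: pochhammer_pos add_pos_pos)
  define c where "c = 2 * pi ^ 2 * real m powr (2 / 3)"
  have c: "c > 0"
    using m by (simp add: c_def)
  have "pochhammer (p / m) (Suc j) = p / m * P"
    by (simp add: P_def pochhammer_rec)
  then show ?thesis
    unfolding szego_weight_def radial_moment_def e p_def[symmetric] P_def[symmetric] c_def[symmetric]
    using p P c m by simp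
qed

section \<open>Uniqueness on the diagonal and boundary moments of Hardy functions\<close>

lemma nt_boundary_value_cnj:
  assumes "nt_boundary_value m \<alpha> f g"
  shows "nt_boundary_value m \<alpha> (\<lambda>p. cnj (f p)) (\<lambda>\<xi>. cnj (g \<xi>))"
proof -
  have "cnj \<in> borel_measurable borel"
    by (intro borel_measurable_continuous_onI continuous_intros)
  then have "(\<lambda>\<xi>. cnj (g \<xi>)) \<in> borel_measurable (fefferman_measure m)"
    using assms measurable_compose unfolding nt_boundary_value_def by blast
  moreover have "AE \<xi> in fefferman_measure m. ((\<lambda>p. cnj (f p)) \<longlongrightarrow> cnj (g \<xi>)) (at \<xi> within approach_region m \<alpha> \<xi>)"
    using assms unfolding nt_boundary_value_def by (auto elim!: eventually_mono intro: tendsto_cnj)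
  ultimately show ?thesis
    by (simp add: nt_boundary_value_def)
qed

text \<open>As for the Bergman kernel: conjugating a boundary function gives the boundary function
  of the conjugate, so each reproducing formula can be tested on the other kernel.\<close>

lemma fefferman_szego_kernel_unique_diag:
  assumes S: "is_fefferman_szego_kernel m \<alpha> S" and T: "is_fefferman_szego_kernel m \<alpha> T" and z: "\<zeta> \<in> egg_domain m"
  shows "S \<zeta> \<zeta> = T \<zeta> \<zeta>"
proof -
  have *: "T \<zeta> \<zeta> = cnj (S \<zeta> \<zeta>)"
    if S: "is_fefferman_szego_kernel m \<alpha> S" and T: "is_fefferman_szego_kernel m \<alpha> T" for S T
  proof -
    obtain s where s: "(\<lambda>\<eta>. cnj (S \<zeta> \<eta>)) \<in> fefferman_hardy m \<alpha>" "nt_boundary_value m \<alpha> (S \<zeta>) s"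
      "\<And>f g. f \<in> fefferman_hardy m \<alpha> \<Longrightarrow> nt_boundary_value m \<alpha> f g \<Longrightarrow> f \<zeta> = (LINT \<xi>|fefferman_measure m. s \<xi> * g \<xi>)"
      using S z unfolding is_fefferman_szego_kernel_def by blast
    obtain t where t: "(\<lambda>\<eta>. cnj (T \<zeta> \<eta>)) \<in> fefferman_hardy m \<alpha>" "nt_boundary_value m \<alpha> (T \<zeta>) t"
      "\<And>f g. f \<in> fefferman_hardy m \<alpha> \<Longrightarrow> nt_boundary_value m \<alpha> f g \<Longrightarrow> f \<zeta> = (LINT \<xi>|fefferman_measure m. t \<xi> * g \<xi>)"
      using T z unfolding is_fefferman_szego_kernel_def by blast
    have "cnj (T \<zeta> \<zeta>) = (LINT \<xi>|fefferman_measure m. s \<xi> * cnj (t \<xi>))"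
      using s(3)[OF t(1) nt_boundary_value_cnj[OF t(2)]] .
    moreover have "cnj (S \<zeta> \<zeta>) = (LINT \<xi>|fefferman_measure m. t \<xi> * cnj (s \<xi>))"
      using t(3)[OF s(1) nt_boundary_value_cnj[OF s(2)]] .
    moreover have "(LINT \<xi>|fefferman_measure m. t \<xi> * cnj (s \<xi>)) = cnj (LINT \<xi>|fefferman_measure m. s \<xi> * cnj (t \<xi>))"
      unfolding Bochner_Integration.integral_cnj[symmetric]
      by (intro Bochner_Integration.integral_cong) (auto simp: mult.commute)
    ultimately show ?thesis
      by (metis complex_cnj_cnj)
  qed
  show ?thesis
    using *[OF S S] *[OF S T] by simp
qed

text \<open>From x <= 1 + x^2 and the finiteness of the measure. \<open>enn2real\<close> sends
  infinity to 0, which by the first claim affects only a null set.\<close>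

lemma nt_maximal_finite_AE_integrable:
  assumes m: "m \<ge> 1" and f: "f \<in> fefferman_hardy m \<alpha>"
  shows "AE \<xi> in fefferman_measure m. nt_maximal m \<alpha> f \<xi> < \<infinity>"
    and "integrable (fefferman_measure m) (\<lambda>\<xi>. enn2real (nt_maximal m \<alpha> f \<xi>))"
proof -
  interpret finite_measure "fefferman_measure m"
    by (rule finite_fefferman_measure[OF m])
  have [measurable]: "nt_maximal m \<alpha> f \<in> borel_measurable (fefferman_measure m)"
    and fin: "(\<integral>\<^sup>+\<xi>. nt_maximal m \<alpha> f \<xi> ^ 2 \<partial>fefferman_measure m) < \<infinity>"
    using f by (auto simp: fefferman_hardy_def)
  have "AE \<xi> in fefferman_measure m. nt_maximal m \<alpha> f \<xi> ^ 2 \<noteq> \<infinity>"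
    using fin by (intro nn_integral_PInf_AE) auto
  then show "AE \<xi> in fefferman_measure m. nt_maximal m \<alpha> f \<xi> < \<infinity>"
    by (auto elim!: eventually_mono simp: less_top power2_eq_square ennreal_mult_eq_top_iff)
  have le: "x \<le> 1 + x ^ 2" for x :: ennreal
  proof (cases "x \<le> 1")
    case True
    then show ?thesis
      by (intro add_increasing2) auto
  next
    case False
    then have "x * 1 \<le> x * x"
      by (intro mult_left_mono) auto
    then show ?thesis
      by (intro add_increasing) (auto simp: power2_eq_square)
  qed
  show "integrable (fefferman_measure m) (\<lambda>\<xi>. enn2real (nt_maximal m \<alpha> f \<xi>))"
  proof (rule integrableI_bounded)
    have "(\<integral>\<^sup>+\<xi>. ennreal (norm (enn2real (nt_maximal m \<alpha> f \<xi>))) \<partial>fefferman_measure m)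
        \<le> (\<integral>\<^sup>+\<xi>. 1 + nt_maximal m \<alpha> f \<xi> ^ 2 \<partial>fefferman_measure m)"
    proof (intro nn_integral_mono)
      fix \<xi>
      have "ennreal (norm (enn2real (nt_maximal m \<alpha> f \<xi>))) \<le> nt_maximal m \<alpha> f \<xi>"
        by (cases "nt_maximal m \<alpha> f \<xi>") auto
      also have "\<dots> \<le> 1 + nt_maximal m \<alpha> f \<xi> ^ 2"
        by (rule le)
      finally show "ennreal (norm (enn2real (nt_maximal m \<alpha> f \<xi>))) \<le> 1 + nt_maximal m \<alpha> f \<xi> ^ 2" .
    qed
    also have "\<dots> = emeasure (fefferman_measure m) (space (fefferman_measure m)) + (\<integral>\<^sup>+\<xi>. nt_maximal m \<alpha> f \<xi> ^ 2 \<partial>fefferman_measure m)"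
      by (subst nn_integral_add) auto
    also have "\<dots> < \<infinity>"
      using fin emeasure_finite by (simp add: less_top[symmetric])
    finally show "(\<integral>\<^sup>+\<xi>. ennreal (norm (enn2real (nt_maximal m \<alpha> f \<xi>))) \<partial>fefferman_measure m) < \<infinity>" .
  qed simp
qed

lemma hardy_boundary_moment:
  assumes m: "m \<ge> 1" and \<alpha>: "\<alpha> > 0"
    and f: "f \<in> fefferman_hardy m \<alpha>" and g: "nt_boundary_value m \<alpha> f g"
    and mean: "\<And>z w j k. (z, w) \<in> egg_domain m \<Longrightarrow> torus_mean f j k z w = a k j * z ^ j * w ^ k"
  shows "integrable (fefferman_measure m) g"
    and "(\<integral>\<xi>. cnj (fst \<xi> ^ j * snd \<xi> ^ k) * g \<xi> \<partial>fefferman_measure m)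
      = a k j * of_real (2 * pi ^ 2 * real m powr (2 / 3) * radial_moment m (real k + (real m + 2) / 3) j)"
proof -
  let ?\<mu> = "fefferman_measure m" and ?S = "frontier (egg_domain m)"
  have cont: "continuous_on (egg_domain m) f"
    using f by (auto simp: fefferman_hardy_def intro: holomorphic2_on_imp_continuous_on)
  obtain t0 where t0: "0 < t0" "t0 < 1"
    "\<And>\<xi> t. \<xi> \<in> ?S \<Longrightarrow> 0 < t \<Longrightarrow> t \<le> t0 \<Longrightarrow> (1 - t) *\<^sub>R \<xi> \<in> approach_region m \<alpha> \<xi>"
    using dilation_in_approach_region[OF m \<alpha>] by blast
  define t where "t = (\<lambda>n. t0 * inverse (real (Suc n)))"
  define r where "r = (\<lambda>n. 1 - t n)"
  have t: "0 < t n" "t n \<le> t0" for n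
    using t0 by (auto simp: t_def field_simps)
  have "t \<longlonglongrightarrow> t0 * 0"
    unfolding t_def by (intro tendsto_intros LIMSEQ_inverse_real_of_nat)
  then have "r \<longlonglongrightarrow> 1 - 0"
    unfolding r_def by (intro tendsto_diff tendsto_const) simp
  then have rlim: "r \<longlonglongrightarrow> 1"
    by simp
  have r: "0 \<le> r n" "r n < 1" for n
    using t[of n] t0 by (auto simp: r_def)
  have region: "r n *\<^sub>R \<xi> \<in> approach_region m \<alpha> \<xi>" if "\<xi> \<in> ?S" for n \<xi>
    unfolding r_def by (intro t0(3) that t)
  have bound: "norm (f (r n *\<^sub>R \<xi>)) \<le> enn2real (nt_maximal m \<alpha> f \<xi>)"
    if "\<xi> \<in> ?S" "nt_maximal m \<alpha> f \<xi> < \<infinity>" for n \<xi>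
  proof -
    have "ennreal (norm (f (r n *\<^sub>R \<xi>))) \<le> nt_maximal m \<alpha> f \<xi>"
      unfolding nt_maximal_def by (intro SUP_upper region that)
    then show ?thesis
      using that(2) enn2real_mono[of "ennreal (norm (f (r n *\<^sub>R \<xi>)))" "nt_maximal m \<alpha> f \<xi>"] by simp
  qed
  have lim: "(\<lambda>n. f (r n *\<^sub>R \<xi>)) \<longlonglongrightarrow> g \<xi>"
    if x: "\<xi> \<in> ?S" and l: "(f \<longlongrightarrow> g \<xi>) (at \<xi> within approach_region m \<alpha> \<xi>)" for \<xi>
  proof (rule filterlim_compose[OF l])
    have "\<xi> \<noteq> 0"
      using x m by (auto simp: frontier_egg_domain_iff power_0_left)
    \<comment> \<open>The filter at \<xi> omits \<xi> itself, so the dilated points must be seen to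
      differ from it.\<close>
    then have "r n *\<^sub>R \<xi> \<noteq> \<xi>" for n
      using r(2)[of n] by (metis less_irrefl scaleR_cancel_right scaleR_one)
    moreover have "(\<lambda>n. r n *\<^sub>R \<xi>) \<longlonglongrightarrow> 1 *\<^sub>R \<xi>"
      by (intro tendsto_intros rlim)
    ultimately show "filterlim (\<lambda>n. r n *\<^sub>R \<xi>) (at \<xi> within approach_region m \<alpha> \<xi>) sequentially"
      using region[OF x] by (simp add: filterlim_at)
  qed
  have AE: "AE \<xi> in ?\<mu>. nt_maximal m \<alpha> f \<xi> < \<infinity> \<and> \<xi> \<in> ?S \<and> (f \<longlongrightarrow> g \<xi>) (at \<xi> within approach_region m \<alpha> \<xi>)"
    using nt_maximal_finite_AE_integrable(1)[OF m f] g AE_space[of ?\<mu>]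
    unfolding nt_boundary_value_def by (auto elim: eventually_elim2)
  have w: "integrable ?\<mu> (\<lambda>\<xi>. enn2real (nt_maximal m \<alpha> f \<xi>))"
    by (rule nt_maximal_finite_AE_integrable(2)[OF m f])
  have gm: "g \<in> borel_measurable ?\<mu>"
    using g by (simp add: nt_boundary_value_def)
  have cr: "continuous_on ?S (\<lambda>\<xi>. f (r n *\<^sub>R \<xi>))" for n
    using egg_scale[OF m _ r] frontier_subset_egg_closure[OF m]
    by (intro continuous_on_compose2[OF cont] continuous_intros) auto
  have meas: "h \<in> borel_measurable ?\<mu>" if "continuous_on ?S h" for h :: "C2 \<Rightarrow> complex"
    using borel_measurable_continuous_on_restrict[OF that]
    by (simp cong: measurable_cong_sets)
  \<comment> \<open>The domination passes to the limit and makes g integrable.\<close>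
  have AEg: "AE \<xi> in ?\<mu>. norm (g \<xi>) \<le> enn2real (nt_maximal m \<alpha> f \<xi>)"
    using AE
  proof eventually_elim
    case (elim \<xi>)
    then show ?case
      using tendsto_norm[OF lim] bound by (intro LIMSEQ_le_const2[of "\<lambda>n. norm (f (r n *\<^sub>R \<xi>))"]) auto
  qed
  then show "integrable ?\<mu> g"
    by (intro Bochner_Integration.integrable_bound[OF w gm]) (auto elim!: eventually_mono)
  define u where "u = (\<lambda>\<xi> :: C2. cnj (fst \<xi> ^ j * snd \<xi> ^ k))"
  have uc: "continuous_on ?S u"
    unfolding u_def by (intro continuous_intros)
  have u1: "norm (u \<xi>) \<le> 1" if "\<xi> \<in> ?S" for \<xi>
    using egg_closure_norm[OF m, of "fst \<xi>" "snd \<xi>"] frontier_subset_egg_closure[OF m] that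
    by (auto simp: u_def norm_mult norm_power intro!: mult_le_one power_le_one)
  define N where "N = 2 * pi ^ 2 * real m powr (2 / 3) * radial_moment m (real k + (real m + 2) / 3) j"
  have "(\<lambda>n. \<integral>\<xi>. u \<xi> * f (r n *\<^sub>R \<xi>) \<partial>?\<mu>) \<longlonglongrightarrow> (\<integral>\<xi>. u \<xi> * g \<xi> \<partial>?\<mu>)"
  proof (rule integral_dominated_convergence[OF _ _ w])
    show "(\<lambda>\<xi>. u \<xi> * g \<xi>) \<in> borel_measurable ?\<mu>"
      by (intro borel_measurable_times meas uc gm)
    show "(\<lambda>\<xi>. u \<xi> * f (r n *\<^sub>R \<xi>)) \<in> borel_measurable ?\<mu>" for n
      by (intro borel_measurable_times meas uc cr)
    show "AE \<xi> in ?\<mu>. (\<lambda>n. u \<xi> * f (r n *\<^sub>R \<xi>)) \<longlonglongrightarrow> u \<xi> * g \<xi>"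
      using AE by eventually_elim (intro tendsto_mult tendsto_const lim; simp)
    show "AE \<xi> in ?\<mu>. norm (u \<xi> * f (r n *\<^sub>R \<xi>)) \<le> enn2real (nt_maximal m \<alpha> f \<xi>)" for n
      using AE
    proof eventually_elim
      case (elim \<xi>)
      have "norm (u \<xi>) * norm (f (r n *\<^sub>R \<xi>)) \<le> 1 * enn2real (nt_maximal m \<alpha> f \<xi>)"
        using elim by (intro mult_mono u1 bound) auto
      then show ?case
        by (simp add: norm_mult)
    qed
  qed
  moreover have "(\<integral>\<xi>. u \<xi> * f (r n *\<^sub>R \<xi>) \<partial>?\<mu>) = a k j * of_real (r n ^ (j + k) * N)" for n
    unfolding u_def N_def by (rule fefferman_moment[OF m cont r]) (rule mean)
  moreover have "(\<lambda>n. a k j * of_real (r n ^ (j + k) * N)) \<longlonglongrightarrow> a k j * of_real (1 ^ (j + k) * N)"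
    by (intro tendsto_intros rlim)
  ultimately have "(\<integral>\<xi>. u \<xi> * g \<xi> \<partial>?\<mu>) = a k j * of_real (1 ^ (j + k) * N)"
    using LIMSEQ_unique by fastforce
  then show "(\<integral>\<xi>. cnj (fst \<xi> ^ j * snd \<xi> ^ k) * g \<xi> \<partial>?\<mu>)
      = a k j * of_real (2 * pi ^ 2 * real m powr (2 / 3) * radial_moment m (real k + (real m + 2) / 3) j)"
    by (simp add: u_def N_def)
qed

theorem is_fefferman_szego_kernel_egg:
  assumes m: "m \<ge> 1" and \<alpha>: "\<alpha> > 0"
  shows "is_fefferman_szego_kernel m \<alpha> (egg_kernel m (szego_exponent m) (szego_weight m))"
proof -
  interpret egg_weight m "szego_exponent m" "szego_weight m"
    by (rule egg_weight_szego[OF m])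
  interpret R: reinhardt_domain "egg_domain m"
    by (rule reinhardt_egg_domain[OF m])
  interpret finite_measure "fefferman_measure m"
    by (rule finite_fefferman_measure[OF m])
  have sub: "p \<in> egg_closure m" if "p \<in> egg_domain m" for p
    using egg_domain_subset_closure that by auto
  have subf: "p \<in> egg_closure m" if "p \<in> frontier (egg_domain m)" for p
    using frontier_subset_egg_closure[OF m] that by auto
  have hardy: "(\<lambda>\<eta>. cnj (K \<zeta> \<eta>)) \<in> fefferman_hardy m \<alpha>" if z: "\<zeta> \<in> egg_domain m" for \<zeta>
  proof -
    have "nt_maximal m \<alpha> (\<lambda>\<eta>. cnj (K \<zeta> \<eta>)) \<xi> \<le> ennreal (kernel_bound \<zeta>)" for \<xi>
      unfolding nt_maximal_def
      by (intro SUP_least ennreal_leI) (auto simp: approach_region_def intro!: norm_K_le[OF z] sub)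
    then have "(\<integral>\<^sup>+\<xi>. nt_maximal m \<alpha> (\<lambda>\<eta>. cnj (K \<zeta> \<eta>)) \<xi> ^ 2 \<partial>fefferman_measure m)
        \<le> (\<integral>\<^sup>+\<xi>. ennreal (kernel_bound \<zeta>) ^ 2 \<partial>fefferman_measure m)"
      by (intro nn_integral_mono power_mono) auto
    also have "\<dots> < \<infinity>"
    proof -
      have "emeasure (fefferman_measure m) (space (fefferman_measure m)) \<noteq> top"
        using emeasure_finite by simp
      then show ?thesis
        by (simp add: power2_eq_square ennreal_mult_eq_top_iff less_top[symmetric] del: space_fefferman_measure)
    qed
    finally show ?thesis
      using cnj_K_holomorphic[OF z] measurable_nt_maximal[OF m] by (simp add: fefferman_hardy_def)
  qed
  have boundary: "nt_boundary_value m \<alpha> (K \<zeta>) (K \<zeta>)" if z: "\<zeta> \<in> egg_domain m" for \<zeta>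
    unfolding nt_boundary_value_def
  proof
    have "continuous_on (frontier (egg_domain m)) (K \<zeta>)"
      using K_continuous[OF z] frontier_subset_egg_closure[OF m] by (rule continuous_on_subset)
    then show "K \<zeta> \<in> borel_measurable (fefferman_measure m)"
      using borel_measurable_continuous_on_restrict by (simp cong: measurable_cong_sets)
    show "AE \<xi> in fefferman_measure m. (K \<zeta> \<longlongrightarrow> K \<zeta> \<xi>) (at \<xi> within approach_region m \<alpha> \<xi>)"
    proof (rule AE_I2)
      fix \<xi> assume "\<xi> \<in> space (fefferman_measure m)"
      then have "(K \<zeta> \<longlongrightarrow> K \<zeta> \<xi>) (at \<xi> within egg_closure m)"
        using K_continuous[OF z] subf by (simp add: continuous_on_def)
      then show "(K \<zeta> \<longlongrightarrow> K \<zeta> \<xi>) (at \<xi> within approach_region m \<alpha> \<xi>)"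
        by (rule tendsto_within_subset) (auto simp: approach_region_def sub)
    qed
  qed
  have repr: "f \<zeta> = (LINT \<xi>|fefferman_measure m. K \<zeta> \<xi> * g \<xi>)"
    if z: "\<zeta> \<in> egg_domain m" and f: "f \<in> fefferman_hardy m \<alpha>" and g: "nt_boundary_value m \<alpha> f g" for \<zeta> f g
  proof -
    have hol: "holomorphic2_on f (egg_domain m)"
      using f by (simp add: fefferman_hardy_def)
    obtain a where a: "\<And>z w j k. (z, w) \<in> egg_domain m \<Longrightarrow> torus_mean f j k z w = a k j * z ^ j * w ^ k"
      "\<And>z w. (z, w) \<in> egg_domain m \<Longrightarrow> ((\<lambda>(k, j). a k j * z ^ j * w ^ k) has_sum f (z, w)) UNIV"
      using R.power_series[OF holomorphic2_on_imp_continuous_on[OF hol] holomorphic2_on_slice[OF hol]] by blast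
    obtain z0 w0 where zw: "\<zeta> = (z0, w0)"
      by fastforce
    have "(\<integral>\<xi>. K (z0, w0) \<xi> * g \<xi> \<partial>fefferman_measure m) = f (z0, w0)"
    proof (rule reproducing[where a = a])
      show "(z0, w0) \<in> egg_domain m"
        using z zw by simp
      then show "((\<lambda>(k, j). a k j * z0 ^ j * w0 ^ k) has_sum f (z0, w0)) UNIV"
        by (rule a(2))
      show "(\<lambda>\<xi>. \<xi>) \<in> borel_measurable (fefferman_measure m)"
        using measurable_restrict_space1[of "\<lambda>\<xi>. \<xi>" borel borel] by (simp cong: measurable_cong_sets)
      show "\<xi> \<in> egg_closure m" if "\<xi> \<in> space (fefferman_measure m)" for \<xi>
        using that subf by simp
      show "integrable (fefferman_measure m) g"
        by (rule hardy_boundary_moment(1)[OF m \<alpha> f g]) (rule a(1))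
      fix k j
      have M: "(\<integral>\<xi>. cnj (fst \<xi> ^ j * snd \<xi> ^ k) * g \<xi> \<partial>fefferman_measure m)
          = a k j * of_real (2 * pi ^ 2 * real m powr (2 / 3) * radial_moment m (real k + (real m + 2) / 3) j)"
        by (rule hardy_boundary_moment(2)[OF m \<alpha> f g]) (rule a(1))
      have "of_real (coef k j) * (\<integral>\<xi>. cnj (fst \<xi> ^ j * snd \<xi> ^ k) * g \<xi> \<partial>fefferman_measure m)
          = a k j * of_real (coef k j * (2 * pi ^ 2 * real m powr (2 / 3) * radial_moment m (real k + (real m + 2) / 3) j))"
        unfolding M by simp
      also have "coef k j * (2 * pi ^ 2 * real m powr (2 / 3) * radial_moment m (real k + (real m + 2) / 3) j) = 1"
        unfolding coef_def by (rule szego_coef_moment[OF m])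
      finally show "of_real (coef k j) * (\<integral>\<xi>. cnj (fst \<xi> ^ j * snd \<xi> ^ k) * g \<xi> \<partial>fefferman_measure m) = a k j"
        by simp
    qed
    then show ?thesis
      by (simp add: zw)
  qed
  show ?thesis
    unfolding is_fefferman_szego_kernel_def using hardy boundary repr by blast
qed

theorem fefferman_szego_kernel_egg:
  assumes m: "m \<ge> 1" and \<alpha>: "\<alpha> > 0" and p: "p \<in> egg_domain m"
  defines "u \<equiv> egg_ratio m p" and "c \<equiv> (real m + 2) / 3"
  shows "fefferman_szego_kernel m \<alpha> p p =
    of_real ((1 - norm (fst p) ^ 2) powr (- szego_exponent m) * (c + (1 - c) * u) / (2 * pi ^ 2 * real m powr (2 / 3) * (1 - u) ^ 2))"
proof -
  interpret egg_weight m "szego_exponent m" "szego_weight m"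
    by (rule egg_weight_szego[OF m])
  have "is_fefferman_szego_kernel m \<alpha> (fefferman_szego_kernel m \<alpha>)"
    unfolding fefferman_szego_kernel_def
    by (rule someI[of "\<lambda>S. is_fefferman_szego_kernel m \<alpha> S", OF is_fefferman_szego_kernel_egg[OF m \<alpha>]])
  then have "fefferman_szego_kernel m \<alpha> p p = K p p"
    using is_fefferman_szego_kernel_egg[OF m \<alpha>] p by (rule fefferman_szego_kernel_unique_diag)
  also have "K p p = of_real ((1 - norm (fst p) ^ 2) powr (- szego_exponent m)) * gen (of_real u)"
    unfolding u_def by (rule K_diag(1)[OF p])
  also have "gen (of_real u) = of_real ((c + (1 - c) * u) / (2 * pi ^ 2 * real m powr (2 / 3) * (1 - u) ^ 2))"
  proof -
    have u: "norm (complex_of_real u) < 1"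
      unfolding u_def by (rule K_diag(2)[OF p])
    define d where "d = 2 * pi ^ 2 * real m powr (2 / 3)"
    \<comment> \<open>k + c = (k + 1) + (c - 1), which splits q into the series of 1/(1-u)^2 and
      (c-1)/(1-u).\<close>
    have "(\<lambda>k. complex_of_real (1 / d) * (of_nat (Suc k) * of_real u ^ k + of_real (c - 1) * of_real u ^ k))
      sums (of_real (1 / d) * (1 / (1 - of_real u) ^ 2 + of_real (c - 1) * (1 / (1 - of_real u))))"
      by (intro sums_mult sums_add geometric_deriv_sums geometric_sums u)
    moreover have "complex_of_real (1 / d) * (of_nat (Suc k) * of_real u ^ k + of_real (c - 1) * of_real u ^ k)
        = of_real (szego_weight m k) * complex_of_real u ^ k" for k
    proof -
      have "1 / d * (real (Suc k) * u ^ k + (c - 1) * u ^ k) = szego_weight m k * u ^ k"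
      proof -
        have w: "szego_weight m k = (real k + c) / d"
          by (simp add: szego_weight_def d_def c_def)
        show ?thesis
          by (simp add: w algebra_simps add_divide_distrib)
      qed
      then show ?thesis
        by (metis (no_types, lifting) of_real_add of_real_mult of_real_of_nat_eq of_real_power)
    qed
    ultimately have "(\<lambda>k. of_real (szego_weight m k) * complex_of_real u ^ k) sums
        (of_real (1 / d) * (1 / (1 - of_real u) ^ 2 + of_real (c - 1) * (1 / (1 - of_real u))))"
      by simp
    then have "gen (of_real u) = of_real (1 / d) * (1 / (1 - of_real u) ^ 2 + of_real (c - 1) * (1 / (1 - of_real u)))"
      using gen_sums[OF u] sums_unique2 by blast
    also have "\<dots> = of_real (1 / d * (1 / (1 - u) ^ 2 + (c - 1) * (1 / (1 - u))))"
      by simp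
    also have "1 / d * (1 / (1 - u) ^ 2 + (c - 1) * (1 / (1 - u))) = (c + (1 - c) * u) / (d * (1 - u) ^ 2)"
    proof -
      have "1 - u > 0"
        using u by auto
      then have "1 / (1 - u) ^ 2 + (c - 1) * (1 / (1 - u)) = (1 + (c - 1) * (1 - u)) / (1 - u) ^ 2"
        by (simp add: divide_simps power2_eq_square)
      also have "1 + (c - 1) * (1 - u) = c + (1 - c) * u"
        by (simp add: algebra_simps)
      finally show ?thesis
        by simp
    qed
    finally show ?thesis
      by (simp only: d_def)
  qed
  finally show ?thesis
    by simp
qed

section \<open>Boundary limits\<close>

lemma powr_power_nat:
  fixes x a :: real
  assumes "x > 0"
  shows "(x powr a) ^ n = x powr (a * real n)"
  using powr_realpow[of "x powr a" n] assms by (simp add: powr_powr)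

lemma SK_egg:
  assumes m: "m \<ge> 1" and \<alpha>: "\<alpha> > 0" and p: "p \<in> egg_domain m"
  defines "u \<equiv> egg_ratio m p" and "c \<equiv> (real m + 2) / 3"
  shows "SK m \<alpha> p = of_real ((c + (1 - c) * u) ^ 3 / (8 * pi ^ 2 * ((real m + 1) - (real m - 1) * u) ^ 2))"
proof -
  interpret egg_weight m "szego_exponent m" "szego_weight m"
    by (rule egg_weight_szego[OF m])
  have u: "\<bar>u\<bar> < 1"
    using K_diag(2)[OF p] by (simp add: u_def)
  define x where "x = 1 - norm (fst p) ^ 2"
  have x: "x > 0"
    using egg_domain_norm(1)[OF m, of "fst p" "snd p"] p by (simp add: x_def power_less_one_iff)
  define A where "A = c + (1 - c) * u"
  define B where "B = (real m + 1) - (real m - 1) * u"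
  have B: "B > 0"
  proof -
    have "(real m - 1) * u \<le> (real m - 1) * 1"
      using m u by (intro mult_left_mono) auto
    then show ?thesis
      by (simp add: B_def)
  qed
  define y where "y = x powr (- (2 + 1 / real m))"
  have y: "y > 0"
    using x by (simp add: y_def)
  have S3: "(x powr (- szego_exponent m)) ^ 3 = y ^ 2"
  proof -
    have "(x powr (- szego_exponent m)) ^ 3 = x powr (- szego_exponent m * 3)"
      using powr_power_nat[OF x, of "- szego_exponent m" 3] by simp
    also have "- szego_exponent m * 3 = - (2 + 1 / real m) * 2"
      using m by (simp add: szego_exponent_def field_simps)
    also have "x powr (- (2 + 1 / real m) * 2) = y ^ 2"
      unfolding y_def using powr_power_nat[OF x, of "- (2 + 1 / real m)" 2] by simp
    finally show ?thesis .
  qed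
  \<comment> \<open>The cube turns m^(2/3) into m^2, which cancels against the squared Bergman
    kernel, as (1 - u)^6 does.\<close>
  have m3: "(real m powr (2 / 3)) ^ 3 = real m ^ 2"
    using powr_power_nat[of "real m" "2 / 3" 3] m by simp
  have "SK m \<alpha> p = of_real ((x powr (- szego_exponent m) * A / (2 * pi ^ 2 * real m powr (2 / 3) * (1 - u) ^ 2)) ^ 3
      / (y * B / (m * pi ^ 2 * (1 - u) ^ 3)) ^ 2)"
    unfolding SK_def fefferman_szego_kernel_egg[OF m \<alpha> p] bergman_kernel_egg[OF m p] A_def B_def y_def x_def u_def c_def
    by simp
  also have "(x powr (- szego_exponent m) * A / (2 * pi ^ 2 * real m powr (2 / 3) * (1 - u) ^ 2)) ^ 3
      = y ^ 2 * A ^ 3 / (8 * pi ^ 6 * real m ^ 2 * (1 - u) ^ 6)"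
    unfolding power_divide power_mult_distrib S3 m3 by (simp flip: power_mult)
  also have "(y * B / (m * pi ^ 2 * (1 - u) ^ 3)) ^ 2 = y ^ 2 * B ^ 2 / (real m ^ 2 * pi ^ 4 * (1 - u) ^ 6)"
    unfolding power_divide power_mult_distrib by (simp flip: power_mult)
  also have "y ^ 2 * A ^ 3 / (8 * pi ^ 6 * real m ^ 2 * (1 - u) ^ 6) / (y ^ 2 * B ^ 2 / (real m ^ 2 * pi ^ 4 * (1 - u) ^ 6))
      = A ^ 3 / (8 * pi ^ 2 * B ^ 2)"
  proof -
    have pi6: "pi ^ 6 = pi ^ 4 * pi ^ 2"
      by (simp flip: power_add)
    have "(1 - u) ^ 6 \<noteq> 0"
      using u by auto
    then show ?thesis
      unfolding pi6 using y B m by (simp add: divide_simps)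
  qed
  finally show ?thesis
    by (simp only: A_def B_def)
qed

text \<open>The bound l <= 1 keeps the denominator away from 0, since (m+1) - (m-1) l >= 2.\<close>

lemma SK_tendsto:
  assumes m: "m \<ge> 1" and \<alpha>: "\<alpha> > 0"
    and D: "eventually (\<lambda>p. p \<in> egg_domain m) F"
    and lim: "(egg_ratio m \<longlongrightarrow> l) F" and l: "l \<le> 1"
  shows "(SK m \<alpha> \<longlongrightarrow> of_real (((real m + 2) / 3 + (1 - (real m + 2) / 3) * l) ^ 3
      / (8 * pi ^ 2 * ((real m + 1) - (real m - 1) * l) ^ 2))) F"
proof -
  have "(real m - 1) * l \<le> (real m - 1) * 1"
    using m l by (intro mult_left_mono) auto
  then have "(real m + 1) - (real m - 1) * l \<noteq> 0"
    by simp
  then have "((\<lambda>p. complex_of_real (((real m + 2) / 3 + (1 - (real m + 2) / 3) * egg_ratio m p) ^ 3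
      / (8 * pi ^ 2 * ((real m + 1) - (real m - 1) * egg_ratio m p) ^ 2))) \<longlongrightarrow> of_real (((real m + 2) / 3 + (1 - (real m + 2) / 3) * l) ^ 3
      / (8 * pi ^ 2 * ((real m + 1) - (real m - 1) * l) ^ 2))) F"
    by (intro tendsto_intros lim) auto
  then show ?thesis
    by (rule Lim_transform_eventually)
       (use D in \<open>auto elim!: eventually_mono simp: SK_egg[OF m \<alpha>]\<close>)
qed

lemma egg_ratio_tendsto_1:
  assumes m: "m \<ge> 1"
  shows "(egg_ratio m \<longlongrightarrow> 1) (at (0, cis \<theta>) within S)"
proof -
  have "((\<lambda>p. norm (snd p) ^ 2 * (1 - norm (fst p) ^ 2) powr (- 1 / real m)) \<longlongrightarrow>
      norm (snd (0 :: complex, cis \<theta>)) ^ 2 * (1 - norm (fst (0 :: complex, cis \<theta>)) ^ 2) powr (- 1 / real m)) (at (0, cis \<theta>) within S)"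
    by (intro tendsto_intros) auto
  then show ?thesis
    by (simp add: egg_ratio_def[abs_def])
qed

lemma egg_ratio_power:
  assumes m: "m \<ge> 1" and p: "p \<in> egg_domain m"
  shows "egg_ratio m p \<ge> 0" "egg_ratio m p ^ m = norm (snd p) ^ (2 * m) / (1 - norm (fst p) ^ 2)"
proof -
  have x: "1 - norm (fst p) ^ 2 > 0"
    using egg_domain_norm(1)[OF m, of "fst p" "snd p"] p by (simp add: power_less_one_iff)
  show "egg_ratio m p \<ge> 0"
    by (simp add: egg_ratio_def)
  have "((1 - norm (fst p) ^ 2) powr (- 1 / real m)) ^ m = (1 - norm (fst p) ^ 2) powr (- 1 / real m * m)"
    using x by (subst powr_powr[symmetric]) (simp add: powr_realpow[symmetric])
  also have "- 1 / real m * m = - 1"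
    using m by simp
  finally have "((1 - norm (fst p) ^ 2) powr (- 1 / real m)) ^ m = 1 / (1 - norm (fst p) ^ 2)"
    using x by (simp add: powr_minus divide_inverse)
  then show "egg_ratio m p ^ m = norm (snd p) ^ (2 * m) / (1 - norm (fst p) ^ 2)"
    unfolding egg_ratio_def power_mult_distrib norm_square_power by simp
qed

text \<open>On the domain the m-th power of the ratio is |w|^(2m) / (1 - |z|^2), which is at most
  the quotient in the little-o hypothesis.\<close>

lemma egg_ratio_tendsto_0:
  assumes m: "m \<ge> 1" and D: "eventually (\<lambda>p. p \<in> egg_domain m) F"
    and o: "(\<lambda>(z, w). norm w ^ (2 * m)) \<in> o[F](\<lambda>(z, w). 1 - norm z ^ 2 - norm w ^ (2 * m))"
  shows "(egg_ratio m \<longlongrightarrow> 0) F"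
proof (rule tendstoI)
  fix e :: real assume e: "e > 0"
  \<comment> \<open>Taking m-th roots turns this constant into e/2.\<close>
  define d where "d = (e / 2) ^ m"
  have d: "d > 0"
    using e by (simp add: d_def)
  have "eventually (\<lambda>p. norm (case p of (z, w) \<Rightarrow> norm w ^ (2 * m)) \<le> d * norm (case p of (z, w) \<Rightarrow> 1 - norm z ^ 2 - norm w ^ (2 * m))) F"
    using landau_o.smallD[OF o d] .
  then show "eventually (\<lambda>p. dist (egg_ratio m p) 0 < e) F"
    using D
  proof eventually_elim
    case (elim p)
    obtain z w where p: "p = (z, w)"
      by fastforce
    have pos: "1 - norm z ^ 2 - norm w ^ (2 * m) > 0"
      using elim(2) by (simp add: p egg_domain_def)
    have "norm w ^ (2 * m) \<le> d * (1 - norm z ^ 2 - norm w ^ (2 * m))"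
      using elim(1) pos by (simp add: p)
    also have "\<dots> \<le> d * (1 - norm z ^ 2)"
      using d by (intro mult_left_mono) auto
    finally have "norm w ^ (2 * m) \<le> d * (1 - norm z ^ 2)" .
    moreover have "1 - norm z ^ 2 > 0"
      using pos zero_le_power[OF norm_ge_zero[of w], of "2 * m"] by linarith
    ultimately have "egg_ratio m p ^ m \<le> (e / 2) ^ m"
      unfolding egg_ratio_power(2)[OF m elim(2)] d_def by (simp add: p pos_divide_le_eq)
    then have "egg_ratio m p \<le> e / 2"
      using egg_ratio_power(1)[OF m elim(2)] e m by (simp add: power_mono_iff)
    then show ?case
      using egg_ratio_power(1)[OF m elim(2)] e by simp
  qed
qed

text \<open>The restricted limit (ii) is expressed through all filters F that refine the approach
  within the domain and along which the little-o relation holds.\<close>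

theorem proposition3p12:
  fixes m :: nat and \<alpha> \<theta> :: real
  assumes "m \<ge> 1" and "\<alpha> > 0" and "\<theta> \<in> {-pi<..pi}"
  shows "(SK m \<alpha> \<longlongrightarrow> complex_of_real (1 / (32 * pi ^ 2)))
           (at (0, cis \<theta>) within egg_domain m) \<and>
         (\<forall>F. F \<le> at (cis \<theta>, 0) within egg_domain m \<longrightarrow>
            (\<lambda>(z, w). norm w ^ (2 * m)) \<in> o[F](\<lambda>(z, w). 1 - norm z ^ 2 - norm w ^ (2 * m)) \<longrightarrow>
            (SK m \<alpha> \<longlongrightarrow>
               complex_of_real (1 / (6 ^ 3 * pi ^ 2) * (real m + 2) ^ 3 / (real m + 1) ^ 2)) F)"
proof (intro conjI allI impI)
  have within: "eventually (\<lambda>p. p \<in> egg_domain m) (at q within egg_domain m)" for q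
    by (simp add: eventually_at_filter)
  \<comment> \<open>At ratio 1 the numerator is 1 and the denominator is 8 pi^2 2^2, whatever m
    is.\<close>
  have "(SK m \<alpha> \<longlongrightarrow> of_real (((real m + 2) / 3 + (1 - (real m + 2) / 3) * 1) ^ 3
      / (8 * pi ^ 2 * ((real m + 1) - (real m - 1) * 1) ^ 2))) (at (0, cis \<theta>) within egg_domain m)"
    by (rule SK_tendsto[OF assms(1,2) within egg_ratio_tendsto_1[OF assms(1)]]) simp
  then show "(SK m \<alpha> \<longlongrightarrow> complex_of_real (1 / (32 * pi ^ 2))) (at (0, cis \<theta>) within egg_domain m)"
    by simp
  fix F
  assume F: "F \<le> at (cis \<theta>, 0) within egg_domain m"
    and o: "(\<lambda>(z, w). norm w ^ (2 * m)) \<in> o[F](\<lambda>(z, w). 1 - norm z ^ 2 - norm w ^ (2 * m))"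
  have D: "eventually (\<lambda>p. p \<in> egg_domain m) F"
    using within F by (rule filter_leD[rotated])
  have "(SK m \<alpha> \<longlongrightarrow> of_real (((real m + 2) / 3 + (1 - (real m + 2) / 3) * 0) ^ 3
      / (8 * pi ^ 2 * ((real m + 1) - (real m - 1) * 0) ^ 2))) F"
    by (rule SK_tendsto[OF assms(1,2) D egg_ratio_tendsto_0[OF assms(1) D o]]) simp
  \<comment> \<open>The constant is 3^3 times 8, that is 6^3.\<close>
  moreover have "((real m + 2) / 3 + (1 - (real m + 2) / 3) * 0) ^ 3 / (8 * pi ^ 2 * ((real m + 1) - (real m - 1) * 0) ^ 2)
      = 1 / (6 ^ 3 * pi ^ 2) * (real m + 2) ^ 3 / (real m + 1) ^ 2"
    by (simp add: power_divide)
  ultimately show "(SK m \<alpha> \<longlongrightarrow> complex_of_real (1 / (6 ^ 3 * pi ^ 2) * (real m + 2) ^ 3 / (real m + 1) ^ 2)) F"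
    by (simp only:)
qed

end
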